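(* Let $G=S_3$, and let $\{c_i : i=1,\dots,22\}$ be the $\mathbb{Q}$-basis of the rational double Burnside algebra $\mathbb{Q}B(G,G)$ defined in the context. Then the linear map $\beta'_{G\times G}\colon\mathbb{Q}B(G,G)\to\mathbb{Q}^{8\times 8}$ defined by $$\beta'_{G\times G}\Bigl(\sum_{i=1}^{22}x_ic_i\Bigr)=\left(\begin{array}{cccccccc} x_1&x_2&x_3&x_4&0&0&0&0\\ x_5&x_6&x_7&x_8&0&0&0&0\\ x_9&x_{10}&x_{11}&x_{12}&0&0&0&0\\ 0&0&0&x_{22}&0&0&0&0\\ 0&0&0&0&x_{17}&x_{18}&0&0\\ 0&0&0&0&0&x_{22}&0&0\\ 0&0&0&0&0&0&x_{21}&0\\ x_{13}&x_{14}&x_{15}&x_{16}&x_{19}&x_{20}&0&x_{22} \end{array}\right),$$ where $x_i\in\mathbb{Q}$, $i=1,\dots,22$, is an injective homomorphism of algebras.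
   Context: Double Burnside algebra: for finite groups $G,H$, $B(G,H)$ is the Grothendieck group of finite $(G,H)$-bisets (left $G$-, right $H$-sets with commuting actions; addition is disjoint union). Identifying $(G,H)$-bisets with $G\times H$-sets, the classes $[(G\times H)/L]$, $L$ running over representatives of conjugacy classes of subgroups of $G\times H$, form a $\mathbb{Z}$-basis. $B(G,G)$ is a ring under $[X]\cdot_G[Y]=[X\times_GY]$, where $X\times_GY=(X\times Y)/G$ is the set of orbits under $(x,y).g=(xg,g^{-1}y)$. On basis elements, $[(G\times G)/L]\cdot_G[(G\times G)/M]=\sum_x[(G\times G)/(L^{(1,x)}\ast M)]$, $x$ running over representatives of the $(p_2(L),p_1(M))$-double cosets in $G$, where $p_i$ is projection to the $i$th factor and $L\ast M=\{(g_1,g_3):(g_1,g_2)\in L,\ (g_2,g_3)\in M\text{ for some }g_2\in G\}$. $\mathbb{Q}B(G,G)=\mathbb{Q}\otimes_{\mathbb{Z}}B(G,G)$. Subgroups of $S_3\times S_3$: a subgroup $L$ of $G\times G$ corresponds to an isomorphism $P_1/K_1\to P_2/K_2$ between sections (pairs $K_i\trianglelefteq P_i\leq G$), with $L=\{(a_1,a_2)\in P_1\times P_2: a_1K_1\mapsto a_2K_2\}$. For $G=S_3$, write $1,2,3,G$ for representatives of the four conjugacy classes of subgroups, of orders $1,2,3,6$. There is exactly one conjugacy class of subgroups of $G\times G$ for each pair of conjugacy classes of isomorphic sections $(P_1,K_1),(P_2,K_2)$. The representatives $L_1,\dots,L_{22}$ are labelled as follows, $L_i$ having an isomorphism of the form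 $P_1/K_1\to P_2/K_2$. Trivial quotients: with the sections ordered $s_1=(1,1)$, $s_2=(2,2)$, $s_3=(3,3)$, $s_4=(G,G)$, the subgroup with $(P_1,K_1)=s_a$, $(P_2,K_2)=s_b$ is $L_{4(a-1)+b}$ ($1\le a,b\le4$). Quotients of order 2: $L_{17}\colon 2/1\to2/1$, $L_{18}\colon 2/1\to G/3$, $L_{19}\colon G/3\to2/1$, $L_{20}\colon G/3\to G/3$. Further $L_{21}\colon 3/1\to3/1$ and $L_{22}\colon G/1\to G/1$. Bases: $b_i=[(G\times G)/L_i]$, $i=1,\dots,22$, is a basis of $\mathbb{Q}B(G,G)$. The basis $(c_i)$ is the unique family satisfying $b_i=\sum_jm'_{ij}c_j$, where the (invertible) matrix $M'=(m'_{ij})$ is given by: $b_1=6c_1$; $b_2=3c_1+c_2$; $b_3=2c_1+2c_3$; $b_4=c_1+c_2+c_3+c_4$; $b_5=3c_1+3c_5$; $b_6=\frac32c_1+\frac12c_2+\frac32c_5+\frac12c_6$; $b_7=c_1+c_3+c_5+c_7$; $b_8=\frac12(c_1+c_2+c_3+c_4+c_5+c_6+c_7+c_8)$; $b_9=2c_1+4c_9$; $b_{10}=c_1+\frac13c_2+2c_9+\frac23c_{10}$; $b_{11}=\frac23c_1+\frac23c_3+\frac43c_9+\frac43c_{11}$; $b_{12}=\frac13(c_1+c_2+c_3+c_4)+\frac23(c_9+c_{10}+c_{11}+c_{12})$; $b_{13}=c_1+3c_5+2c_9+6c_{13}$; $b_{14}=\frac12c_1+\frac16c_2+\frac32c_5+\frac12c_6+c_9+\frac13c_{10}+3c_{13}+c_{14}$;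 $b_{15}=\frac13c_1+\frac13c_3+c_5+c_7+\frac23c_9+\frac23c_{11}+2c_{13}+2c_{15}$; $b_{16}=\frac16(c_1+c_2+c_3+c_4)+\frac12(c_5+c_6+c_7+c_8)+\frac13(c_9+c_{10}+c_{11}+c_{12})+c_{13}+c_{14}+c_{15}+c_{16}$; $b_{17}=3c_1+c_6+c_{17}$; $b_{18}=c_1+c_3+c_6+c_8+c_{17}+c_{18}$; $b_{19}=c_1+c_6+2c_9+2c_{14}+c_{17}+2c_{19}$; $b_{20}=\frac13c_1+\frac13c_3+c_6+c_8+\frac23c_9+\frac23c_{11}+2c_{14}+2c_{16}+c_{17}+c_{18}+2c_{19}+2c_{20}$; $b_{21}=2c_1+2c_{11}+2c_{21}$; $b_{22}=c_1+c_6+c_{11}+c_{17}+c_{21}+c_{22}$. *)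

theory Defs
  imports
    "HOL-Algebra.Left_Coset"
    "HOL-Algebra.Sym_Groups"
    "HOL-Algebra.Module"
    "HOL-Algebra.Free_Abelian_Groups"
    "HOL-Algebra.Algebraic_Closure_Type"
    "Jordan_Normal_Form.Matrix"
begin

no_notation Polynomials.var (\<open>X\<index>\<close>)


section \<open>Bisets\<close>

record ('g, 'h, 'x) biset = "'x partial_object" +
  lact :: "'g \<Rightarrow> 'x \<Rightarrow> 'x"
  ract :: "'x \<Rightarrow> 'h \<Rightarrow> 'x"

locale finite_biset = G: group G + H: group H
  for G :: "('g, 'm) monoid_scheme" (structure)
    and H :: "('h, 'n) monoid_scheme" (structure) +
  fixes X :: "('g, 'h, 'x) biset"
  assumes finite_carrier: "finite (carrier X)"
    and lact_closed: "\<lbrakk>a \<in> carrier G; x \<in> carrier X\<rbrakk> \<Longrightarrow> lact X a x \<in> carrier X"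
    and ract_closed: "\<lbrakk>x \<in> carrier X; b \<in> carrier H\<rbrakk> \<Longrightarrow> ract X x b \<in> carrier X"
    and lact_one: "x \<in> carrier X \<Longrightarrow> lact X \<one>\<^bsub>G\<^esub> x = x"
    and ract_one: "x \<in> carrier X \<Longrightarrow> ract X x \<one>\<^bsub>H\<^esub> = x"
    and lact_mult: "\<lbrakk>a \<in> carrier G; a' \<in> carrier G; x \<in> carrier X\<rbrakk>
      \<Longrightarrow> lact X (a \<otimes>\<^bsub>G\<^esub> a') x = lact X a (lact X a' x)"
    and ract_mult: "\<lbrakk>x \<in> carrier X; b \<in> carrier H; b' \<in> carrier H\<rbrakk>
      \<Longrightarrow> ract X x (b \<otimes>\<^bsub>H\<^esub> b') = ract X (ract X x b) b'"
    and act_commute: "\<lbrakk>a \<in> carrier G; x \<in> carrier X; b \<in> carrier H\<rbrakk>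
      \<Longrightarrow> ract X (lact X a x) b = lact X a (ract X x b)"

definition biset_isomorphic ::
  "('g, 'm) monoid_scheme \<Rightarrow> ('h, 'n) monoid_scheme
    \<Rightarrow> ('g, 'h, 'x) biset \<Rightarrow> ('g, 'h, 'y) biset \<Rightarrow> bool" where
  "biset_isomorphic G H X Y \<longleftrightarrow>
    (\<exists>f. bij_betw f (carrier X) (carrier Y) \<and>
      (\<forall>a\<in>carrier G. \<forall>x\<in>carrier X. f (lact X a x) = lact Y a (f x)) \<and>
      (\<forall>x\<in>carrier X. \<forall>b\<in>carrier H. f (ract X x b) = ract Y (f x) b))"

text \<open>
  Every finite biset is isomorphic to one whose points are natural numbers. The isomorphism class
  of a finite biset, whatever its type of points, is represented by the set of all isomorphic
  bisets with points in \<^typ>\<open>nat\<close>.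
\<close>

definition biset_class ::
  "('g, 'm) monoid_scheme \<Rightarrow> ('h, 'n) monoid_scheme
    \<Rightarrow> ('g, 'h, 'x) biset \<Rightarrow> ('g, 'h, nat) biset set" where
  "biset_class G H X = {Y. finite_biset G H Y \<and> biset_isomorphic G H X Y}"

definition biset_classes ::
  "('g, 'm) monoid_scheme \<Rightarrow> ('h, 'n) monoid_scheme \<Rightarrow> ('g, 'h, nat) biset set set" where
  "biset_classes G H = biset_class G H ` {X :: ('g, 'h, nat) biset. finite_biset G H X}"

definition biset_union ::
  "('g, 'h, 'x) biset \<Rightarrow> ('g, 'h, 'y) biset \<Rightarrow> ('g, 'h, 'x + 'y) biset" where
  "biset_union X Y =
    \<lparr> carrier = carrier X <+> carrier Y,
      lact = (\<lambda>a. map_sum (lact X a) (lact Y a)),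
      ract = (\<lambda>z b. map_sum (\<lambda>x. ract X x b) (\<lambda>y. ract Y y b) z) \<rparr>"

text \<open>The product \<open>X \<times>\<^sub>G Y\<close>: orbits of \<open>X \<times> Y\<close> under \<open>(x, y).g = (x g, g\<^sup>-\<^sup>1 y)\<close>.\<close>

definition biset_tensor ::
  "('k, 'm) monoid_scheme \<Rightarrow> ('g, 'k, 'x) biset \<Rightarrow> ('k, 'h, 'y) biset
    \<Rightarrow> ('g, 'h, ('x \<times> 'y) set) biset" where
  "biset_tensor K X Y =
    \<lparr> carrier = (\<lambda>(x, y). (\<lambda>g. (ract X x g, lact Y (inv\<^bsub>K\<^esub> g) y)) ` carrier K)
                  ` (carrier X \<times> carrier Y),
      lact = (\<lambda>a T. (\<lambda>(x, y). (lact X a x, y)) ` T),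
      ract = (\<lambda>T b. (\<lambda>(x, y). (x, ract Y y b)) ` T) \<rparr>"

definition regular_biset :: "('g, 'm) monoid_scheme \<Rightarrow> ('g, 'g, 'g) biset" where
  "regular_biset G = \<lparr> carrier = carrier G, lact = monoid.mult G, ract = monoid.mult G \<rparr>"

text \<open>
  The biset \<open>(G \<times> H)/L\<close>; a \<open>(G \<times> H)\<close>-set is a \<open>(G, H)\<close>-biset via \<open>a x b = (a, b\<^sup>-\<^sup>1) x\<close>.
\<close>

definition coset_biset ::
  "('g, 'm) monoid_scheme \<Rightarrow> ('h, 'n) monoid_scheme \<Rightarrow> ('g \<times> 'h) set
    \<Rightarrow> ('g, 'h, ('g \<times> 'h) set) biset" where
  "coset_biset G H L =
    \<lparr> carrier = lcosets\<^bsub>G \<times>\<times> H\<^esub> L,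
      lact = (\<lambda>a C. (a, \<one>\<^bsub>H\<^esub>) <#\<^bsub>G \<times>\<times> H\<^esub> C),
      ract = (\<lambda>C b. (\<one>\<^bsub>G\<^esub>, inv\<^bsub>H\<^esub> b) <#\<^bsub>G \<times>\<times> H\<^esub> C) \<rparr>"


section \<open>The double Burnside ring\<close>

definition burnside_relations ::
  "('g, 'm) monoid_scheme \<Rightarrow> ('h, 'n) monoid_scheme
    \<Rightarrow> (('g, 'h, nat) biset set \<Rightarrow>\<^sub>0 int) set" where
  "burnside_relations G H =
    generate (free_Abelian_group (biset_classes G H))
      {frag_of (biset_class G H (biset_union X Y))
         - frag_of (biset_class G H X) - frag_of (biset_class G H Y)
       | (X :: ('g, 'h, nat) biset) (Y :: ('g, 'h, nat) biset).
         finite_biset G H X \<and> finite_biset G H Y}"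

text \<open>The Grothendieck group \<open>B(G, H)\<close>, written multiplicatively as a quotient group.\<close>

definition burnside_group ::
  "('g, 'm) monoid_scheme \<Rightarrow> ('h, 'n) monoid_scheme
    \<Rightarrow> (('g, 'h, nat) biset set \<Rightarrow>\<^sub>0 int) set monoid" where
  "burnside_group G H =
    free_Abelian_group (biset_classes G H) Mod burnside_relations G H"

definition burnside_of ::
  "('g, 'm) monoid_scheme \<Rightarrow> ('h, 'n) monoid_scheme \<Rightarrow> ('g, 'h, 'x) biset
    \<Rightarrow> (('g, 'h, nat) biset set \<Rightarrow>\<^sub>0 int) set" where
  "burnside_of G H X =
    burnside_relations G H #>\<^bsub>free_Abelian_group (biset_classes G H)\<^esub>
      frag_of (biset_class G H X)"

text \<open>
  \<open>X \<times>\<^sub>G Y\<close> on isomorphism classes, then extended bilinearly to formal combinations. All members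
  of the union below are equal, and so are those of the unions over cosets further down.
\<close>

definition class_tensor ::
  "('g, 'm) monoid_scheme \<Rightarrow> ('g, 'g, nat) biset set \<Rightarrow> ('g, 'g, nat) biset set
    \<Rightarrow> ('g, 'g, nat) biset set" where
  "class_tensor G A B = (\<Union>X\<in>A. \<Union>Y\<in>B. biset_class G G (biset_tensor G X Y))"

definition frag_tensor ::
  "('g, 'm) monoid_scheme \<Rightarrow> (('g, 'g, nat) biset set \<Rightarrow>\<^sub>0 int)
    \<Rightarrow> (('g, 'g, nat) biset set \<Rightarrow>\<^sub>0 int) \<Rightarrow> (('g, 'g, nat) biset set \<Rightarrow>\<^sub>0 int)" where
  "frag_tensor G u v =
    frag_extend (\<lambda>A. frag_extend (\<lambda>B. frag_of (class_tensor G A B)) v) u"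

definition burnside_ring ::
  "('g, 'm) monoid_scheme \<Rightarrow> (('g, 'g, nat) biset set \<Rightarrow>\<^sub>0 int) set ring" where
  "burnside_ring G =
    \<lparr> carrier = carrier (burnside_group G G),
      monoid.mult = (\<lambda>U V. \<Union>u\<in>U. \<Union>v\<in>V.
        burnside_relations G G #>\<^bsub>free_Abelian_group (biset_classes G G)\<^esub> frag_tensor G u v),
      one = burnside_of G G (regular_biset G),
      zero = one (burnside_group G G),
      add = monoid.mult (burnside_group G G) \<rparr>"


section \<open>Extension of scalars to the rationals\<close>

abbreviation rat_ring :: "rat ring" where
  "rat_ring \<equiv> ring_of_type_algebra"

definition rat_tensor_free :: "('a, 'm) ring_scheme \<Rightarrow> (rat \<times> 'a \<Rightarrow>\<^sub>0 int) monoid" where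
  "rat_tensor_free A = free_Abelian_group (UNIV \<times> carrier A)"

definition rat_tensor_relations :: "('a, 'm) ring_scheme \<Rightarrow> (rat \<times> 'a \<Rightarrow>\<^sub>0 int) set" where
  "rat_tensor_relations A =
    generate (rat_tensor_free A)
      ({frag_of (p + q, a) - frag_of (p, a) - frag_of (q, a) | p q a. a \<in> carrier A} \<union>
       {frag_of (p, a \<oplus>\<^bsub>A\<^esub> b) - frag_of (p, a) - frag_of (p, b)
        | p a b. a \<in> carrier A \<and> b \<in> carrier A})"

definition rat_tensor_group :: "('a, 'm) ring_scheme \<Rightarrow> (rat \<times> 'a \<Rightarrow>\<^sub>0 int) set monoid" where
  "rat_tensor_group A = rat_tensor_free A Mod rat_tensor_relations A"

definition pure_tensor ::
  "('a, 'm) ring_scheme \<Rightarrow> rat \<Rightarrow> 'a \<Rightarrow> (rat \<times> 'a \<Rightarrow>\<^sub>0 int) set" where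
  "pure_tensor A q a = rat_tensor_relations A #>\<^bsub>rat_tensor_free A\<^esub> frag_of (q, a)"

text \<open>The algebra \<open>\<rat> \<otimes>\<^sub>\<int> A\<close>, where \<open>(p \<otimes> a) (q \<otimes> b) = p q \<otimes> a b\<close> and \<open>r (p \<otimes> a) = r p \<otimes> a\<close>.\<close>

definition rat_tensor ::
  "('a, 'm) ring_scheme \<Rightarrow> (rat, (rat \<times> 'a \<Rightarrow>\<^sub>0 int) set) module" where
  "rat_tensor A =
    \<lparr> carrier = carrier (rat_tensor_group A),
      monoid.mult = (\<lambda>U V. \<Union>u\<in>U. \<Union>v\<in>V. rat_tensor_relations A #>\<^bsub>rat_tensor_free A\<^esub>
        frag_extend (\<lambda>(p, a). frag_extend (\<lambda>(q, b). frag_of (p * q, a \<otimes>\<^bsub>A\<^esub> b)) v) u),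
      one = pure_tensor A 1 \<one>\<^bsub>A\<^esub>,
      zero = one (rat_tensor_group A),
      add = monoid.mult (rat_tensor_group A),
      module.smult = (\<lambda>r U. \<Union>u\<in>U. rat_tensor_relations A #>\<^bsub>rat_tensor_free A\<^esub>
        frag_extend (\<lambda>(p, a). frag_of (r * p, a)) u) \<rparr>"

definition QB ::
  "('g, 'm) monoid_scheme
    \<Rightarrow> (rat, (rat \<times> (('g, 'g, nat) biset set \<Rightarrow>\<^sub>0 int) set \<Rightarrow>\<^sub>0 int) set) module" where
  "QB G = rat_tensor (burnside_ring G)"

definition QB_of ::
  "('g, 'm) monoid_scheme \<Rightarrow> ('g, 'g, 'x) biset
    \<Rightarrow> (rat \<times> (('g, 'g, nat) biset set \<Rightarrow>\<^sub>0 int) set \<Rightarrow>\<^sub>0 int) set" where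
  "QB_of G X = pure_tensor (burnside_ring G) 1 (burnside_of G G X)"


section \<open>Algebra homomorphisms\<close>

text \<open>The locale \<^locale>\<open>algebra\<close> of the library only covers commutative algebras.\<close>

locale assoc_algebra = module + ring M +
  assumes smult_mult_left:
      "\<lbrakk>a \<in> carrier R; x \<in> carrier M; y \<in> carrier M\<rbrakk>
        \<Longrightarrow> (a \<odot>\<^bsub>M\<^esub> x) \<otimes>\<^bsub>M\<^esub> y = a \<odot>\<^bsub>M\<^esub> (x \<otimes>\<^bsub>M\<^esub> y)"
    and smult_mult_right:
      "\<lbrakk>a \<in> carrier R; x \<in> carrier M; y \<in> carrier M\<rbrakk>
        \<Longrightarrow> x \<otimes>\<^bsub>M\<^esub> (a \<odot>\<^bsub>M\<^esub> y) = a \<odot>\<^bsub>M\<^esub> (x \<otimes>\<^bsub>M\<^esub> y)"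

definition linear_map ::
  "('r, 'k) ring_scheme \<Rightarrow> ('r, 'a, 'm) module_scheme \<Rightarrow> ('r, 'b, 'n) module_scheme
    \<Rightarrow> ('a \<Rightarrow> 'b) \<Rightarrow> bool" where
  "linear_map R M N f \<longleftrightarrow>
    f \<in> carrier M \<rightarrow> carrier N \<and>
    (\<forall>x\<in>carrier M. \<forall>y\<in>carrier M. f (x \<oplus>\<^bsub>M\<^esub> y) = f x \<oplus>\<^bsub>N\<^esub> f y) \<and>
    (\<forall>r\<in>carrier R. \<forall>x\<in>carrier M. f (r \<odot>\<^bsub>M\<^esub> x) = r \<odot>\<^bsub>N\<^esub> f x)"

definition algebra_hom ::
  "('r, 'k) ring_scheme \<Rightarrow> ('r, 'a, 'm) module_scheme \<Rightarrow> ('r, 'b, 'n) module_scheme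
    \<Rightarrow> ('a \<Rightarrow> 'b) \<Rightarrow> bool" where
  "algebra_hom R A B f \<longleftrightarrow>
    assoc_algebra R A \<and> assoc_algebra R B \<and> linear_map R A B f \<and> f \<in> Ring.ring_hom A B"


section \<open>The subgroups of \<open>S\<^sub>3 \<times> S\<^sub>3\<close> and the two bases\<close>

abbreviation S3 :: "(nat \<Rightarrow> nat) monoid" where
  "S3 \<equiv> sym_group 3"

definition goursat_subgroup ::
  "('g, 'm) monoid_scheme \<Rightarrow> 'g set \<times> 'g set \<Rightarrow> 'g set \<times> 'g set \<Rightarrow> ('g \<times> 'g) set \<Rightarrow> bool" where
  "goursat_subgroup G = (\<lambda>(P\<^sub>1, K\<^sub>1) (P\<^sub>2, K\<^sub>2) L.
    subgroup P\<^sub>1 G \<and> K\<^sub>1 \<lhd> G\<lparr>carrier := P\<^sub>1\<rparr> \<and> subgroup P\<^sub>2 G \<and> K\<^sub>2 \<lhd> G\<lparr>carrier := P\<^sub>2\<rparr> \<and>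
    (\<exists>\<phi> \<in> iso (G\<lparr>carrier := P\<^sub>1\<rparr> Mod K\<^sub>1) (G\<lparr>carrier := P\<^sub>2\<rparr> Mod K\<^sub>2).
      L = {(a\<^sub>1, a\<^sub>2) \<in> P\<^sub>1 \<times> P\<^sub>2. \<phi> (K\<^sub>1 #>\<^bsub>G\<^esub> a\<^sub>1) = K\<^sub>2 #>\<^bsub>G\<^esub> a\<^sub>2}))"

text \<open>
  \<open>P n\<close> is a chosen subgroup of order \<open>n\<close>. The entry with index \<open>i - 1\<close> is the pair of sections
  that belongs to \<open>L\<^sub>i\<close>; the comprehension runs through \<open>L\<^sub>1, \<dots>, L\<^sub>1\<^sub>6\<close> with \<open>b\<close> varying fastest.
\<close>

definition S3_sections ::
  "(nat \<Rightarrow> 'g set) \<Rightarrow> (('g set \<times> 'g set) \<times> ('g set \<times> 'g set)) list" where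
  "S3_sections P =
    [((P a, P a), (P b, P b)). a \<leftarrow> [1, 2, 3, 6], b \<leftarrow> [1, 2, 3, 6]] @
    [((P 2, P 1), (P 2, P 1)),
     ((P 2, P 1), (P 6, P 3)),
     ((P 6, P 3), (P 2, P 1)),
     ((P 6, P 3), (P 6, P 3)),
     ((P 3, P 1), (P 3, P 1)),
     ((P 6, P 1), (P 6, P 1))]"

definition S3_representatives ::
  "(nat \<Rightarrow> (nat \<Rightarrow> nat) set) \<Rightarrow> (nat \<Rightarrow> ((nat \<Rightarrow> nat) \<times> (nat \<Rightarrow> nat)) set) \<Rightarrow> bool" where
  "S3_representatives P L \<longleftrightarrow>
    (\<forall>n\<in>{1, 2, 3, 6}. subgroup (P n) S3 \<and> card (P n) = n) \<and>
    (\<forall>i\<in>{1..22}. case S3_sections P ! (i - 1) of (s, t) \<Rightarrow> goursat_subgroup S3 s t (L i))"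

text \<open>Row \<open>i\<close> of \<open>M'\<close> as the list of the pairs \<open>(j, m'\<^sub>i\<^sub>j)\<close> with \<open>m'\<^sub>i\<^sub>j \<noteq> 0\<close>.\<close>

definition M'_rows :: "(nat \<times> rat) list list" where
  "M'_rows = [
    [(1, 6)],
    [(1, 3), (2, 1)],
    [(1, 2), (3, 2)],
    [(1, 1), (2, 1), (3, 1), (4, 1)],
    [(1, 3), (5, 3)],
    [(1, 3/2), (2, 1/2), (5, 3/2), (6, 1/2)],
    [(1, 1), (3, 1), (5, 1), (7, 1)],
    [(1, 1/2), (2, 1/2), (3, 1/2), (4, 1/2), (5, 1/2), (6, 1/2), (7, 1/2), (8, 1/2)],
    [(1, 2), (9, 4)],
    [(1, 1), (2, 1/3), (9, 2), (10, 2/3)],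
    [(1, 2/3), (3, 2/3), (9, 4/3), (11, 4/3)],
    [(1, 1/3), (2, 1/3), (3, 1/3), (4, 1/3), (9, 2/3), (10, 2/3), (11, 2/3), (12, 2/3)],
    [(1, 1), (5, 3), (9, 2), (13, 6)],
    [(1, 1/2), (2, 1/6), (5, 3/2), (6, 1/2), (9, 1), (10, 1/3), (13, 3), (14, 1)],
    [(1, 1/3), (3, 1/3), (5, 1), (7, 1), (9, 2/3), (11, 2/3), (13, 2), (15, 2)],
    [(1, 1/6), (2, 1/6), (3, 1/6), (4, 1/6), (5, 1/2), (6, 1/2), (7, 1/2), (8, 1/2), (9, 1/3), (10, 1/3), (11, 1/3), (12, 1/3), (13, 1), (14, 1), (15, 1), (16, 1)],
    [(1, 3), (6, 1), (17, 1)],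
    [(1, 1), (3, 1), (6, 1), (8, 1), (17, 1), (18, 1)],
    [(1, 1), (6, 1), (9, 2), (14, 2), (17, 1), (19, 2)],
    [(1, 1/3), (3, 1/3), (6, 1), (8, 1), (9, 2/3), (11, 2/3), (14, 2), (16, 2), (17, 1), (18, 1), (19, 2), (20, 2)],
    [(1, 2), (11, 2), (21, 2)],
    [(1, 1), (6, 1), (11, 1), (17, 1), (21, 1), (22, 1)]]"

definition M' :: "nat \<Rightarrow> nat \<Rightarrow> rat" where
  "M' i j = (case map_of (M'_rows ! (i - 1)) j of None \<Rightarrow> 0 | Some q \<Rightarrow> q)"

definition S3_b ::
  "(nat \<Rightarrow> ((nat \<Rightarrow> nat) \<times> (nat \<Rightarrow> nat)) set) \<Rightarrow> nat \<Rightarrow> _" where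
  "S3_b L i = QB_of S3 (coset_biset S3 S3 (L i))"

text \<open>The unique family with \<open>b\<^sub>i = \<Sum>\<^sub>j m'\<^sub>i\<^sub>j c\<^sub>j\<close>; \<open>M'\<close> is invertible.\<close>

definition S3_c ::
  "(nat \<Rightarrow> ((nat \<Rightarrow> nat) \<times> (nat \<Rightarrow> nat)) set) \<Rightarrow> nat \<Rightarrow> _" where
  "S3_c L = (THE c. c \<in> {1..22} \<rightarrow>\<^sub>E carrier (QB S3) \<and>
    (\<forall>i\<in>{1..22}. S3_b L i =
      (\<Oplus>\<^bsub>QB S3\<^esub>j\<in>{1..22}. M' i j \<odot>\<^bsub>QB S3\<^esub> c j)))"

definition beta_matrix :: "(nat \<Rightarrow> rat) \<Rightarrow> rat mat" where
  "beta_matrix x = mat_of_rows_list 8 [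
    [x 1,  x 2,  x 3,  x 4,  0,    0,    0,    0],
    [x 5,  x 6,  x 7,  x 8,  0,    0,    0,    0],
    [x 9,  x 10, x 11, x 12, 0,    0,    0,    0],
    [0,    0,    0,    x 22, 0,    0,    0,    0],
    [0,    0,    0,    0,    x 17, x 18, 0,    0],
    [0,    0,    0,    0,    0,    x 22, 0,    0],
    [0,    0,    0,    0,    0,    0,    x 21, 0],
    [x 13, x 14, x 15, x 16, x 19, x 20, 0,    x 22]]"

text \<open>Linear maps only matter on the carrier, so uniqueness is stated for extensional functions.\<close>

definition is_beta' ::
  "(nat \<Rightarrow> ((nat \<Rightarrow> nat) \<times> (nat \<Rightarrow> nat)) set) \<Rightarrow> (_ \<Rightarrow> rat mat) \<Rightarrow> bool" where
  "is_beta' L \<beta> \<longleftrightarrow>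
    \<beta> \<in> extensional (carrier (QB S3)) \<and>
    linear_map rat_ring (QB S3) (module_mat TYPE(rat) 8 8) \<beta> \<and>
    (\<forall>x :: nat \<Rightarrow> rat.
      \<beta> (\<Oplus>\<^bsub>QB S3\<^esub>i\<in>{1..22}. x i \<odot>\<^bsub>QB S3\<^esub> S3_c L i) = beta_matrix x)"

end

theory Submission
  imports Defs
begin

text \<open>
  Send a finite biset \<open>X\<close> to the rational vector that sums, over the points \<open>x\<close> of \<open>X\<close>, \<open>|Stab x| / 36\<close>
  times the row of the base change matrix belonging to the type of \<open>Stab x\<close>; the transitive biset of \<open>L\<^sub>i\<close>
  goes to the \<open>i\<close>-th row. Stabilisers in a tensor product are relational compositions of stabilisers, and the
  orbits of the middle group have sizes given by the intersections of the inner kernels. The type of a composite is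
  determined by the orders of the intersections of the middle sections, hence multiplicativity of the resulting
  map to matrices reduces, after averaging over conjugates of one factor, to finitely many identities between the
  22 types. Since the base change matrix is triangular with nonzero diagonal, and every subgroup is conjugate to exactly
  one \<open>L\<^sub>i\<close>, the relations defining the rational double Burnside algebra are exactly the kernel of
  these coordinates. The algebra therefore embeds into the matrices, which also yields its ring axioms.
\<close>

section \<open>Subgroups of direct products\<close>

text \<open>The factor |Stab x| / 36 reflects that an orbit with stabiliser D has 36 / |D| points,
  so that a transitive biset receives its row exactly once. Rows are expressed in the c_j because
  the 8 x 8 pattern attached to them is closed under multiplication. The obstacle is that the types
  of two factors do not determine the type of their composite: subgroups of S_3 of equal order
  coincide, except for the three of order 2, so one bit about the middle projections is missing.
  Translating a point of the left biset by the middle group conjugates its middle projection. Two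
  subgroups of order 2 are matched by 2 of the 6 group elements and kept apart by the other 4; this
  is the origin of the coefficients 2 and 4. Summing over all pairs of points, weighted by inverse
  orbit lengths, takes the place of double coset representatives. A second obstacle is that products
  in both quotient constructions are unions over coset representatives. They become tractable once
  each coset is recognised as a fibre of the coordinate map, which is done twice: for integral
  classes, then for rational tensors.\<close>

definition left_kernel :: "('h, 'n) monoid_scheme \<Rightarrow> ('g \<times> 'h) set \<Rightarrow> 'g set" where
  "left_kernel H D = {a. (a, \<one>\<^bsub>H\<^esub>) \<in> D}"

text \<open>The two kernels are the groups K_1 and K_2 of the Goursat description. Each takes as
  argument the group whose identity fills the other slot, so \<open>left_kernel\<close> is given the
  right-hand group.\<close>

definition right_kernel :: "('g, 'm) monoid_scheme \<Rightarrow> ('g \<times> 'h) set \<Rightarrow> 'h set" where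
  "right_kernel G D = {b. (\<one>\<^bsub>G\<^esub>, b) \<in> D}"

text \<open>Reversing a relation exchanges its sides; the right-hand versions of the counting lemmas
  below are derived by this symmetry.\<close>

lemma left_kernel_converse: "left_kernel G (D\<inverse>) = right_kernel G D"
  and right_kernel_converse: "right_kernel H (D\<inverse>) = left_kernel H D"
  by (simp_all add: left_kernel_def right_kernel_def)

lemma fst_converse: "fst ` (D\<inverse>) = snd ` D" and snd_converse: "snd ` (D\<inverse>) = fst ` D"
  by force+

lemma left_kernel_subset: "left_kernel H D \<subseteq> fst ` D"
  and right_kernel_subset: "right_kernel G D \<subseteq> snd ` D"
  by (force simp: left_kernel_def right_kernel_def)+

locale subgroup_DirProd = G: group G + H: group H
  for G :: "('g, 'm) monoid_scheme" and H :: "('h, 'n) monoid_scheme" +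
  fixes D :: "('g \<times> 'h) set"
  assumes subgroup: "subgroup D (G \<times>\<times> H)"
begin

lemma carrierD: "(a, b) \<in> D \<Longrightarrow> a \<in> carrier G" "(a, b) \<in> D \<Longrightarrow> b \<in> carrier H"
  using subgroup.subset[OF subgroup] by auto

lemma subset: "D \<subseteq> carrier G \<times> carrier H"
  using subgroup.subset[OF subgroup] by simp

lemma one: "(\<one>\<^bsub>G\<^esub>, \<one>\<^bsub>H\<^esub>) \<in> D"
  using subgroup.one_closed[OF subgroup] by simp

lemma mult: "(a, b) \<in> D \<Longrightarrow> (c, d) \<in> D \<Longrightarrow> (a \<otimes>\<^bsub>G\<^esub> c, b \<otimes>\<^bsub>H\<^esub> d) \<in> D"
  using subgroup.m_closed[OF subgroup, of "(a, b)" "(c, d)"] by simp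

lemma inverse: "(a, b) \<in> D \<Longrightarrow> (inv\<^bsub>G\<^esub> a, inv\<^bsub>H\<^esub> b) \<in> D"
  using subgroup.m_inv_closed[OF subgroup, of "(a, b)"] carrierD[of a b]
  by (simp add: inv_DirProd[OF G.group_axioms H.group_axioms])

lemma converse: "subgroup_DirProd H G (D\<inverse>)"
proof -
  interpret P: group "H \<times>\<times> G" by (rule DirProd_group) unfold_locales
  have "subgroup (D\<inverse>) (H \<times>\<times> G)"
  proof (rule P.subgroupI)
    fix x assume "x \<in> D\<inverse>"
    then show "inv\<^bsub>H \<times>\<times> G\<^esub> x \<in> D\<inverse>"
      using carrierD by (auto simp: inv_DirProd[OF H.group_axioms G.group_axioms] inverse)
  qed (use one carrierD mult in auto)
  then show ?thesis
    by (intro subgroup_DirProd.intro subgroup_DirProd_axioms.intro G.group_axioms H.group_axioms)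
qed

lemma subgroup_fst: "subgroup (fst ` D) G"
proof (rule G.subgroupI)
  show "fst ` D \<noteq> {}" using one by auto
  show "fst ` D \<subseteq> carrier G" using carrierD by auto
  fix a assume "a \<in> fst ` D"
  then show "inv\<^bsub>G\<^esub> a \<in> fst ` D" using inverse by force
  fix c assume "c \<in> fst ` D"
  with \<open>a \<in> fst ` D\<close> show "a \<otimes>\<^bsub>G\<^esub> c \<in> fst ` D" using mult by force
qed

lemma subgroup_left_kernel: "subgroup (left_kernel H D) G"
proof (rule G.subgroupI)
  show "left_kernel H D \<noteq> {}" using one by (auto simp: left_kernel_def)
  show "left_kernel H D \<subseteq> carrier G" using carrierD by (auto simp: left_kernel_def)
  fix a assume a: "a \<in> left_kernel H D"
  then show "inv\<^bsub>G\<^esub> a \<in> left_kernel H D" using inverse by (force simp: left_kernel_def)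
  fix c assume "c \<in> left_kernel H D"
  with a show "a \<otimes>\<^bsub>G\<^esub> c \<in> left_kernel H D" using mult by (force simp: left_kernel_def)
qed

lemma left_kernel_normal:
  assumes "a \<in> fst ` D" "k \<in> left_kernel H D"
  shows "a \<otimes>\<^bsub>G\<^esub> k \<otimes>\<^bsub>G\<^esub> inv\<^bsub>G\<^esub> a \<in> left_kernel H D"
proof -
  obtain b where b: "(a, b) \<in> D" using assms(1) unfolding fst_eq_Domain by blast
  have "(a \<otimes>\<^bsub>G\<^esub> k \<otimes>\<^bsub>G\<^esub> inv\<^bsub>G\<^esub> a, b \<otimes>\<^bsub>H\<^esub> \<one>\<^bsub>H\<^esub> \<otimes>\<^bsub>H\<^esub> inv\<^bsub>H\<^esub> b) \<in> D"
    using assms b by (intro mult inverse) (auto simp: left_kernel_def)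
  then show ?thesis using carrierD[OF b] by (simp add: left_kernel_def)
qed

text \<open>Every fibre of the first projection is a translate of the right kernel by any one of its
  points.\<close>

lemma card_fst:
  assumes "finite D"
  shows "card D = card (fst ` D) * card (right_kernel G D)"
proof -
  have fib: "card {z \<in> D. fst z = a} = card (right_kernel G D)" if a: "a \<in> fst ` D" for a
  proof -
    obtain b where b: "(a, b) \<in> D" using a unfolding fst_eq_Domain by blast
    note cb = carrierD[OF b]
    have "bij_betw (\<lambda>k. (a, b \<otimes>\<^bsub>H\<^esub> k)) (right_kernel G D) {z \<in> D. fst z = a}"
    proof (rule bij_betw_byWitness[where f' = "\<lambda>z. inv\<^bsub>H\<^esub> b \<otimes>\<^bsub>H\<^esub> snd z"])
      show "\<forall>k\<in>right_kernel G D. inv\<^bsub>H\<^esub> b \<otimes>\<^bsub>H\<^esub> snd (a, b \<otimes>\<^bsub>H\<^esub> k) = k"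
        using cb carrierD by (auto simp: right_kernel_def H.m_assoc[symmetric])
      show "\<forall>z\<in>{z \<in> D. fst z = a}. (a, b \<otimes>\<^bsub>H\<^esub> (inv\<^bsub>H\<^esub> b \<otimes>\<^bsub>H\<^esub> snd z)) = z"
        using cb carrierD by (auto simp: H.m_assoc[symmetric])
      show "(\<lambda>k. (a, b \<otimes>\<^bsub>H\<^esub> k)) ` right_kernel G D \<subseteq> {z \<in> D. fst z = a}"
        using cb b mult[OF b] by (auto simp: right_kernel_def) (metis G.r_one)
      show "(\<lambda>z. inv\<^bsub>H\<^esub> b \<otimes>\<^bsub>H\<^esub> snd z) ` {z \<in> D. fst z = a} \<subseteq> right_kernel G D"
        using cb b mult[OF inverse[OF b]] by (auto simp: right_kernel_def) (metis G.l_inv)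
    qed
    then show ?thesis by (metis bij_betw_same_card)
  qed
  have "card D = (\<Sum>a\<in>fst ` D. card {z \<in> D. fst z = a})"
    using assms sum.image_gen[of D "\<lambda>_. 1::nat" fst] by simp
  then show ?thesis by (simp add: fib)
qed

end

context subgroup_DirProd
begin

interpretation C: subgroup_DirProd H G "D\<inverse>" by (rule converse)

lemma subgroup_snd: "subgroup (snd ` D) H"
  using C.subgroup_fst by (simp add: fst_converse)

lemma subgroup_right_kernel: "subgroup (right_kernel G D) H"
  using C.subgroup_left_kernel by (simp add: left_kernel_converse)

lemma right_kernel_normal:
  assumes "b \<in> snd ` D" "k \<in> right_kernel G D"
  shows "b \<otimes>\<^bsub>H\<^esub> k \<otimes>\<^bsub>H\<^esub> inv\<^bsub>H\<^esub> b \<in> right_kernel G D"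
  using C.left_kernel_normal assms by (simp add: left_kernel_converse fst_converse)

lemma card_snd:
  assumes "finite D"
  shows "card D = card (snd ` D) * card (left_kernel H D)"
  using C.card_fst assms by (simp add: right_kernel_converse fst_converse)

text \<open>Cut \<open>D\<close> down to second components in \<open>B\<close> and count the result
  through both projections. The left kernel survives because \<open>B\<close> contains the identity,
  while the right kernel is intersected with \<open>B\<close>.\<close>

lemma card_restrict:
  assumes "finite D" "subgroup B H"
  shows "card (fst ` (D \<inter> UNIV \<times> B)) * card (right_kernel G D \<inter> B)
    = card (left_kernel H D) * card (snd ` D \<inter> B)"
proof -
  interpret P: group "G \<times>\<times> H" by (rule DirProd_group) unfold_locales
  have "D \<inter> UNIV \<times> B = D \<inter> carrier G \<times> B" using carrierD by auto
  also have "subgroup \<dots> (G \<times>\<times> H)"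
    using subgroup assms DirProd_subgroups[OF G.group_axioms G.subgroup_self H.group_axioms]
    by (intro P.subgroups_Inter_pair)
  finally interpret R: subgroup_DirProd G H "D \<inter> UNIV \<times> B"
    by (intro subgroup_DirProd.intro subgroup_DirProd_axioms.intro G.group_axioms H.group_axioms)
  have "right_kernel G (D \<inter> UNIV \<times> B) = right_kernel G D \<inter> B"
    by (auto simp: right_kernel_def)
  moreover have "left_kernel H (D \<inter> UNIV \<times> B) = left_kernel H D"
    using subgroup.one_closed[OF assms(2)] by (auto simp: left_kernel_def)
  moreover have "snd ` (D \<inter> UNIV \<times> B) = snd ` D \<inter> B" by force
  ultimately show ?thesis
    using R.card_fst R.card_snd assms by (simp add: mult.commute)
qed

end

section \<open>Orders of the projections and kernels of a composite relation\<close>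

locale composable_subgroups = L: subgroup_DirProd G K L + M: subgroup_DirProd K H M
  for G :: "('g, 'm) monoid_scheme" and K :: "('k, 'o) monoid_scheme"
    and H :: "('h, 'n) monoid_scheme" and L M +
  assumes finite: "finite L" "finite M"
begin

text \<open>An element has a partner in the composite precisely when \<open>L\<close> links it to
  the first projection of \<open>M\<close>, so \<open>card_restrict\<close> applies with that
  projection as \<open>B\<close>.\<close>

lemma card_fst_relcomp:
  "card (fst ` (L O M)) * card (right_kernel G L \<inter> fst ` M)
    = card (left_kernel K L) * card (snd ` L \<inter> fst ` M)"
proof -
  have "fst ` (L O M) = fst ` (L \<inter> UNIV \<times> fst ` M)" by force
  then show ?thesis using L.card_restrict[OF finite(1) M.subgroup_fst] by simp
qed

text \<open>The same restriction argument, now with the left kernel of \<open>M\<close> as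
  \<open>B\<close>.\<close>

lemma card_left_kernel_relcomp:
  "card (left_kernel H (L O M)) * card (right_kernel G L \<inter> left_kernel H M)
    = card (left_kernel K L) * card (snd ` L \<inter> left_kernel H M)"
proof -
  have "left_kernel H (L O M) = fst ` (L \<inter> UNIV \<times> left_kernel H M)"
    by (force simp: left_kernel_def)
  then show ?thesis using L.card_restrict[OF finite(1) M.subgroup_left_kernel] by simp
qed

end

context composable_subgroups
begin

interpretation C: composable_subgroups H K G "M\<inverse>" "L\<inverse>"
  using L.converse M.converse finite by (simp add: composable_subgroups_def composable_subgroups_axioms_def)

text \<open>This is the left-hand count for the reversed relations, since the converse of a
  composite composes the converses in the opposite order.\<close>

lemma card_snd_relcomp:
  "card (snd ` (L O M)) * card (snd ` L \<inter> left_kernel H M)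
    = card (right_kernel K M) * card (snd ` L \<inter> fst ` M)"
  using C.card_fst_relcomp
  unfolding converse_relcomp[symmetric] fst_converse snd_converse
    left_kernel_converse right_kernel_converse
  by (simp only: Int_commute)

lemma card_right_kernel_relcomp:
  "card (right_kernel G (L O M)) * card (right_kernel G L \<inter> left_kernel H M)
    = card (right_kernel K M) * card (right_kernel G L \<inter> fst ` M)"
  using C.card_left_kernel_relcomp
  unfolding converse_relcomp[symmetric] fst_converse snd_converse
    left_kernel_converse right_kernel_converse
  by (simp only: Int_commute)

end

lemma (in group) conjugate_doubleton:
  assumes g: "g \<in> carrier G" and x: "x \<in> carrier G"
  shows "{b \<in> carrier G. g \<otimes> b \<otimes> inv g \<in> {\<one>, x}} = {\<one>, inv g \<otimes> x \<otimes> g}"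
proof -
  have "g \<otimes> b \<otimes> inv g = y \<longleftrightarrow> b = inv g \<otimes> y \<otimes> g" if "b \<in> carrier G" "y \<in> carrier G" for b y
    using that g by (metis inv_closed inv_solve_left inv_solve_right m_assoc m_closed)
  from this[of _ \<one>] this[of _ x] show ?thesis using g x by auto
qed

section \<open>The symmetric group on three letters\<close>

text \<open>The six elements get opaque names, so that later case distinctions run on the
  composition table and the inequalities instead of evaluating functions. Here \<open>r3\<close> is
  the cycle 1 -> 2 -> 3 -> 1 and \<open>s3\<close> is its inverse.\<close>

definition "t12 = transpose 1 (2 :: nat)"
definition "t13 = transpose 1 (3 :: nat)"
definition "t23 = transpose 2 (3 :: nat)"
definition "r3 = t12 \<circ> t23"
definition "s3 = t23 \<circ> t12"

lemmas S3_defs = t12_def t13_def t23_def r3_def s3_def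

lemma S3_table:
  "t12 \<circ> t12 = id" "t13 \<circ> t13 = id" "t23 \<circ> t23 = id"
  "t12 \<circ> t23 = r3" "t23 \<circ> t12 = s3" "t12 \<circ> t13 = s3" "t13 \<circ> t12 = r3"
  "t13 \<circ> t23 = s3" "t23 \<circ> t13 = r3"
  "r3 \<circ> r3 = s3" "s3 \<circ> s3 = r3" "r3 \<circ> s3 = id" "s3 \<circ> r3 = id"
  "t12 \<circ> r3 = t23" "r3 \<circ> t12 = t13" "t12 \<circ> s3 = t13" "s3 \<circ> t12 = t23"
  "t13 \<circ> r3 = t12" "r3 \<circ> t13 = t23" "t13 \<circ> s3 = t23" "s3 \<circ> t13 = t12"
  "t23 \<circ> r3 = t13" "r3 \<circ> t23 = t12" "t23 \<circ> s3 = t12" "s3 \<circ> t23 = t13"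
  by (auto simp: fun_eq_iff S3_defs transpose_def)

lemma S3_distinct: "distinct [id, t12, t13, t23, r3, s3]"
proof -
  have "distinct (map (\<lambda>f. map f [1, 2, 3]) [id, t12, t13, t23, r3, s3])"
    by (simp add: S3_defs transpose_def)
  then show ?thesis unfolding distinct_map by blast
qed

lemma S3_neq [simp]:
  "id \<noteq> t12" "id \<noteq> t13" "id \<noteq> t23" "id \<noteq> r3" "id \<noteq> s3"
  "t12 \<noteq> id" "t12 \<noteq> t13" "t12 \<noteq> t23" "t12 \<noteq> r3" "t12 \<noteq> s3"
  "t13 \<noteq> id" "t13 \<noteq> t12" "t13 \<noteq> t23" "t13 \<noteq> r3" "t13 \<noteq> s3"
  "t23 \<noteq> id" "t23 \<noteq> t12" "t23 \<noteq> t13" "t23 \<noteq> r3" "t23 \<noteq> s3"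
  "r3 \<noteq> id" "r3 \<noteq> t12" "r3 \<noteq> t13" "r3 \<noteq> t23" "r3 \<noteq> s3"
  "s3 \<noteq> id" "s3 \<noteq> t12" "s3 \<noteq> t13" "s3 \<noteq> t23" "s3 \<noteq> r3"
  using S3_distinct by auto

declare S3_table [simp]

lemma carrier_S3: "carrier S3 = {id, t12, t13, t23, r3, s3}"
proof -
  have t: "t12 permutes {1..3}" "t13 permutes {1..3}" "t23 permutes {1..3}"
    unfolding t12_def t13_def t23_def by (rule permutes_swap_id; simp)+
  then have "r3 permutes {1..3}" "s3 permutes {1..3}"
    unfolding r3_def s3_def by (blast intro: permutes_compose)+
  with t have sub: "{id, t12, t13, t23, r3, s3} \<subseteq> carrier S3"
    by (auto simp: sym_group_carrier permutes_id)
  have card: "card (carrier S3) = 6"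
    by (simp add: sym_group_card_carrier numeral_3_eq_3)
  have "card {id, t12, t13, t23, r3, s3} = 6"
    using distinct_card[OF S3_distinct] by simp
  with sub card show ?thesis
    by (intro card_subset_eq[symmetric]) (auto intro: card_ge_0_finite)
qed

interpretation S3: group S3 by (rule sym_group_is_group)

lemma S3_simps [simp]: "monoid.mult S3 = (\<circ>)" "\<one>\<^bsub>S3\<^esub> = id"
  by (simp_all add: sym_group_mult sym_group_one)

lemma S3_inv [simp]:
  "inv\<^bsub>S3\<^esub> id = id" "inv\<^bsub>S3\<^esub> t12 = t12" "inv\<^bsub>S3\<^esub> t13 = t13" "inv\<^bsub>S3\<^esub> t23 = t23"
  "inv\<^bsub>S3\<^esub> r3 = s3" "inv\<^bsub>S3\<^esub> s3 = r3"
  by (rule S3.inv_equality; simp add: carrier_S3)+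

lemma S3_subgroup_cases:
  assumes "subgroup A S3"
  shows "A = {id} \<or> A = {id, t12} \<or> A = {id, t13} \<or> A = {id, t23} \<or> A = {id, r3, s3}
    \<or> A = {id, t12, t13, t23, r3, s3}"
proof -
  have sub: "A \<subseteq> {id, t12, t13, t23, r3, s3}" and id: "id \<in> A"
    using subgroup.subset[OF assms] subgroup.one_closed[OF assms] by (auto simp: carrier_S3)
  have m: "x \<in> A \<Longrightarrow> y \<in> A \<Longrightarrow> x \<circ> y \<in> A" for x y
    using subgroup.m_closed[OF assms] by simp
  \<comment> \<open>These eight closure conditions exclude every subset containing \<open>id\<close>
    that is not a subgroup; all 64 subsets of the carrier are tested against them below.\<close>
  have c: "r3 \<in> A \<Longrightarrow> s3 \<in> A" "s3 \<in> A \<Longrightarrow> r3 \<in> A"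
    "t12 \<in> A \<Longrightarrow> t13 \<in> A \<Longrightarrow> s3 \<in> A" "t12 \<in> A \<Longrightarrow> t23 \<in> A \<Longrightarrow> r3 \<in> A"
    "t13 \<in> A \<Longrightarrow> t23 \<in> A \<Longrightarrow> s3 \<in> A" "t12 \<in> A \<Longrightarrow> r3 \<in> A \<Longrightarrow> t23 \<in> A"
    "t13 \<in> A \<Longrightarrow> r3 \<in> A \<Longrightarrow> t12 \<in> A" "t23 \<in> A \<Longrightarrow> r3 \<in> A \<Longrightarrow> t13 \<in> A"
    using m[of r3 r3] m[of s3 s3] m[of t12 t13] m[of t12 t23] m[of t13 t23] m[of t12 r3] m[of t13 r3]
      m[of t23 r3] by simp_all
  have "A \<in> Pow {id, t12, t13, t23, r3, s3}" using sub by simp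
  then show ?thesis
    unfolding Pow_insert Pow_empty image_insert image_empty image_Un Un_insert_left Un_empty_left
      Un_iff insert_iff empty_iff
    using c id by (elim disjE FalseE; hypsubst; simp)
qed

lemma S3_card [simp]:
  "card {id, t12} = 2" "card {id, t13} = 2" "card {id, t23} = 2" "card {id, r3, s3} = 3"
  "card {id, t12, t13, t23, r3, s3} = 6"
  by simp_all

text \<open>Subgroups of S_3 of order 1, 3 or 6 are unique, and 2 and 3 are coprime, so an
  intersection has order gcd(a, b) in all cases but one. Two subgroups of order 2 may coincide or
  meet trivially, and \<open>e\<close> records which.\<close>

definition inter_card :: "bool \<Rightarrow> nat \<Rightarrow> nat \<Rightarrow> nat" where
  "inter_card e a b = (if a = 2 \<and> b = 2 then if e then 2 else 1 else gcd a b)"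

lemma gcd_orders: "gcd 2 (3::nat) = 1" "gcd 3 (2::nat) = 1" "gcd 6 (3::nat) = 3" "gcd 3 (6::nat) = 3"
  "gcd 2 (6::nat) = 2" "gcd 6 (2::nat) = 2"
  by (simp_all add: gcd_nat.simps)

lemma card_Int_S3:
  assumes "subgroup A S3" "subgroup B S3"
  shows "card (A \<inter> B) = inter_card (A = B) (card A) (card B)"
  using S3_subgroup_cases[OF assms(1)] S3_subgroup_cases[OF assms(2)]
  by (elim disjE) (simp_all add: inter_card_def gcd_orders, simp_all add: doubleton_eq_iff)

text \<open>Six indicator values turn the counting of solutions of a concrete condition into
  rewriting.\<close>

lemma card_filter_S3:
  "card {g \<in> carrier S3. Q g} = of_bool (Q id) + of_bool (Q t12) + of_bool (Q t13)
    + of_bool (Q t23) + of_bool (Q r3) + of_bool (Q s3)"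
proof -
  have "card {g \<in> carrier S3. Q g} = (\<Sum>g\<in>carrier S3. of_bool (Q g))"
    by (simp only: card_eq_sum of_bool_def) (rule sum.inter_filter, simp add: carrier_S3)
  also have "\<dots> = of_bool (Q id) + of_bool (Q t12) + of_bool (Q t13)
    + of_bool (Q t23) + of_bool (Q r3) + of_bool (Q s3)"
    by (simp add: carrier_S3)
  finally show ?thesis .
qed

lemma S3_order_2:
  assumes "subgroup A S3" "card A = 2"
  shows "\<exists>x\<in>{t12, t13, t23}. A = {id, x}"
  using S3_subgroup_cases[OF assms(1)] assms(2) by (elim disjE) simp_all

text \<open>The involutions form one conjugacy class of size 3, so the elements carrying one of them
  to another form a coset of a centraliser of order 2. The preimage form of the conjugate is the one
  produced by projections of \<open>conj_subgroup\<close>.\<close>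

lemma card_conjugators_S3:
  assumes "subgroup A S3" "subgroup B S3" "card A = 2" "card B = 2"
  shows "card {g \<in> carrier S3. {b \<in> carrier S3. g \<circ> b \<circ> inv\<^bsub>S3\<^esub> g \<in> A} = B} = 2"
proof -
  obtain x y where x: "A = {id, x}" "x \<in> {t12, t13, t23}" and y: "B = {id, y}" "y \<in> {t12, t13, t23}"
    using S3_order_2[OF assms(1,3)] S3_order_2[OF assms(2,4)] by blast
  have "x \<in> carrier S3" using x(2) by (auto simp: carrier_S3)
  then have "{b \<in> carrier S3. g \<circ> b \<circ> inv\<^bsub>S3\<^esub> g \<in> A} = {id, inv\<^bsub>S3\<^esub> g \<circ> x \<circ> g}"
    if "g \<in> carrier S3" for g
    using S3.conjugate_doubleton[OF that, of x] unfolding S3_simps x(1) by blast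
  moreover have "{id, u} = B \<longleftrightarrow> u = y" for u
    unfolding y(1) doubleton_eq_iff using y(2) by auto
  ultimately have eq: "{g \<in> carrier S3. {b \<in> carrier S3. g \<circ> b \<circ> inv\<^bsub>S3\<^esub> g \<in> A} = B}
      = {g \<in> carrier S3. inv\<^bsub>S3\<^esub> g \<circ> x \<circ> g = y}"
    by (intro Collect_cong conj_cong refl) simp
  show ?thesis
    unfolding eq card_filter_S3 using x(2) y(2) by (elim insertE emptyE) simp_all
qed

lemma S3_section_cases:
  assumes "subgroup P S3" "subgroup K S3" "K \<subseteq> P"
    and "\<And>p k. p \<in> P \<Longrightarrow> k \<in> K \<Longrightarrow> p \<circ> k \<circ> inv\<^bsub>S3\<^esub> p \<in> K"
  shows "(card P, card K) \<in> {(1, 1), (2, 1), (2, 2), (3, 1), (3, 3), (6, 1), (6, 3), (6, 6)}"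
    and "card K = 2 \<Longrightarrow> K = P"
proof -
  \<comment> \<open>Conjugating one transposition by another gives the third. These three instances
    are enough to exclude a normal subgroup of order 2 in the whole group.\<close>
  have t: "t12 \<in> P \<and> t13 \<in> K \<longrightarrow> t23 \<in> K" "t13 \<in> P \<and> t23 \<in> K \<longrightarrow> t12 \<in> K" "t23 \<in> P \<and> t12 \<in> K \<longrightarrow> t13 \<in> K"
    using assms(4)[of t12 t13] assms(4)[of t13 t23] assms(4)[of t23 t12] by simp_all
  show "(card P, card K) \<in> {(1, 1), (2, 1), (2, 2), (3, 1), (3, 3), (6, 1), (6, 3), (6, 6)}"
    using S3_subgroup_cases[OF assms(1)] S3_subgroup_cases[OF assms(2)] assms(3) t
    apply (elim disjE) apply simp_all done
  show "card K = 2 \<Longrightarrow> K = P"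
    using S3_subgroup_cases[OF assms(1)] S3_subgroup_cases[OF assms(2)] assms(3) t
    apply (elim disjE) apply simp_all done
qed

section \<open>Matrices of the standard shape\<close>

text \<open>Row \<open>k\<close> lists the pairs \<open>(i, j)\<close> for which \<open>c\<^sub>i c\<^sub>j\<close> contributes to the coefficient of \<open>c\<^sub>k\<close>.\<close>

definition product_terms :: "(nat \<times> nat) list list" where
  "product_terms = [
    [(1, 1), (2, 5), (3, 9)],
    [(1, 2), (2, 6), (3, 10)],
    [(1, 3), (2, 7), (3, 11)],
    [(1, 4), (2, 8), (3, 12), (4, 22)],
    [(5, 1), (6, 5), (7, 9)],
    [(5, 2), (6, 6), (7, 10)],
    [(5, 3), (6, 7), (7, 11)],
    [(5, 4), (6, 8), (7, 12), (8, 22)],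
    [(9, 1), (10, 5), (11, 9)],
    [(9, 2), (10, 6), (11, 10)],
    [(9, 3), (10, 7), (11, 11)],
    [(9, 4), (10, 8), (11, 12), (12, 22)],
    [(13, 1), (14, 5), (15, 9), (22, 13)],
    [(13, 2), (14, 6), (15, 10), (22, 14)],
    [(13, 3), (14, 7), (15, 11), (22, 15)],
    [(13, 4), (14, 8), (15, 12), (16, 22), (22, 16)],
    [(17, 17)],
    [(17, 18), (18, 22)],
    [(19, 17), (22, 19)],
    [(19, 18), (20, 22), (22, 20)],
    [(21, 21)],
    [(22, 22)]]"

text \<open>This is the multiplication of the pattern of \<open>beta_matrix\<close>, transported to
  coordinate vectors. The value 0 outside the range makes it a bilinear operation on functions on
  all natural numbers, so that coordinate vectors can be compared by plain equality.\<close>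

definition coeff_product :: "(nat \<Rightarrow> rat) \<Rightarrow> (nat \<Rightarrow> rat) \<Rightarrow> nat \<Rightarrow> rat" where
  "coeff_product x y k =
    (if k \<in> {1..22} then \<Sum>(i, j)\<leftarrow>product_terms ! (k - 1). x i * y j else 0)"

lemma sum_list_bilinear_left:
  fixes f g :: "'a \<Rightarrow> rat"
  shows "(\<Sum>(i, j)\<leftarrow>ps. (a * f i + b * g i) * y j) = a * (\<Sum>(i, j)\<leftarrow>ps. f i * y j) + b * (\<Sum>(i, j)\<leftarrow>ps. g i * y j)"
  by (induction ps) (auto simp: algebra_simps)

lemma sum_list_bilinear_right:
  fixes f g :: "'a \<Rightarrow> rat"
  shows "(\<Sum>(i, j)\<leftarrow>ps. y i * (a * f j + b * g j)) = a * (\<Sum>(i, j)\<leftarrow>ps. y i * f j) + b * (\<Sum>(i, j)\<leftarrow>ps. y i * g j)"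
  by (induction ps) (auto simp: algebra_simps)

lemma coeff_product_left:
  "coeff_product (\<lambda>i. a * x i + b * y i) z k = a * coeff_product x z k + b * coeff_product y z k"
  by (simp add: coeff_product_def sum_list_bilinear_left)

lemma coeff_product_right:
  "coeff_product z (\<lambda>i. a * x i + b * y i) k = a * coeff_product z x k + b * coeff_product z y k"
  by (simp add: coeff_product_def sum_list_bilinear_right)

lemma coeff_product_scale:
  "coeff_product (\<lambda>i. a * x i) (\<lambda>i. b * y i) k = a * b * coeff_product x y k"
  using coeff_product_left[of a x 0 x] coeff_product_right[of x b y 0 y] by (simp add: mult.assoc)

lemma range_22: "{1..22::nat} = {1, 2, 3, 4, 5, 6, 7, 8, 9, 10, 11, 12, 13, 14, 15, 16, 17, 18, 19, 20, 21, 22}"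
  by (auto simp: numeral_eq_Suc atLeastAtMostSuc_conv)

lemma mat_of_rows_list_mult:
  assumes "length A = n" "length B = n"
  shows "mat_of_rows_list n A * mat_of_rows_list n B
    = mat_of_rows_list n (map (\<lambda>r. map (\<lambda>j. \<Sum>k\<leftarrow>[0..<n]. r ! k * (B ! k) ! j) [0..<n]) A)"
  using assms
  by (intro eq_matI) (auto simp: mat_of_rows_list_def scalar_prod_def interv_sum_list_conv_sum_set_nat)

text \<open>The pattern is closed because the three diagonal positions sharing the entry
  \<open>x 22\<close> all receive the product of the two entries: rows 4 and 6 have no other nonzero
  entry, and column 8 has none outside row 8.\<close>

lemma beta_matrix_mult: "beta_matrix x * beta_matrix y = beta_matrix (coeff_product x y)"
  unfolding beta_matrix_def
  by (subst mat_of_rows_list_mult)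
    (simp_all add: coeff_product_def product_terms_def upt_rec algebra_simps)

text \<open>The diagonal reads x_1, x_6, x_11, x_22, x_17, x_22, x_21, x_22. The same index set
  supports row 22 of the base change matrix, which belongs to the regular biset.\<close>

lemma beta_matrix_one:
  "beta_matrix (\<lambda>j. if j \<in> {1, 6, 11, 17, 21, 22} then 1 else 0) = 1\<^sub>m 8"
proof (rule eq_matI)
  fix i j :: nat assume "i < dim_row (1\<^sub>m 8)" "j < dim_col (1\<^sub>m 8)"
  then have "i \<in> {0, 1, 2, 3, 4, 5, 6, 7}" "j \<in> {0, 1, 2, 3, 4, 5, 6, 7}"
    by auto
  then show "beta_matrix (\<lambda>j. if j \<in> {1, 6, 11, 17, 21, 22} then 1 else 0) $$ (i, j) = 1\<^sub>m 8 $$ (i, j)"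
    by (elim insertE emptyE) (simp_all add: beta_matrix_def mat_of_rows_list_def)
qed (simp_all add: beta_matrix_def mat_of_rows_list_def)

lemma beta_matrix_inject:
  assumes "beta_matrix x = beta_matrix y" "j \<in> {1..22}"
  shows "x j = y j"
proof -
  have *: "beta_matrix x $$ (a, b) = beta_matrix y $$ (a, b)" for a b using assms by simp
  \<comment> \<open>One position is read for each of the 22 coordinates, counted from 0; for the
    repeated entry \<open>x 22\<close> it is the last diagonal position.\<close>
  note this[of 0 0] this[of 0 1] this[of 0 2] this[of 0 3] this[of 1 0] this[of 1 1] this[of 1 2] this[of 1 3]
   this[of 2 0] this[of 2 1] this[of 2 2] this[of 2 3] this[of 7 0] this[of 7 1] this[of 7 2] this[of 7 3]
   this[of 4 4] this[of 4 5] this[of 7 4] this[of 7 5] this[of 6 6] this[of 7 7]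
  note m = this[unfolded beta_matrix_def mat_of_rows_list_def, simplified]
  show ?thesis using assms(2) unfolding range_22 by (elim insertE emptyE) (simp_all add: m)
qed

section \<open>Types of subgroups\<close>

type_synonym subgroup_type = "(nat \<times> nat) \<times> (nat \<times> nat)"

text \<open>A type records the orders ((|P_1|, |K_1|), (|P_2|, |K_2|)); the entry with index i - 1
  belongs to L_i. The 22 entries are distinct, so a type can serve as the key that selects a row of
  the matrix.\<close>

definition S3_types :: "subgroup_type list" where
  "S3_types = [((a, a), (b, b)). a \<leftarrow> [1, 2, 3, 6], b \<leftarrow> [1, 2, 3, 6]] @
    [((2, 1), (2, 1)), ((2, 1), (6, 3)), ((6, 3), (2, 1)), ((6, 3), (6, 3)),
     ((3, 1), (3, 1)), ((6, 1), (6, 1))]"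

definition type_coeff :: "subgroup_type \<Rightarrow> nat \<Rightarrow> rat" where
  "type_coeff t j = (case map_of (the (map_of (zip S3_types M'_rows) t)) j of None \<Rightarrow> 0 | Some q \<Rightarrow> q)"

lemma type_coeff_S3_types: "i \<in> {1..22} \<Longrightarrow> type_coeff (S3_types ! (i - 1)) = M' i"
  unfolding range_22
  by (elim insertE emptyE) (simp_all add: fun_eq_iff type_coeff_def M'_def S3_types_def M'_rows_def del: One_nat_def)

text \<open>Explicit lists make the identities between types plain equations between lists of
  numbers, which rewriting can evaluate.\<close>

definition type_row :: "subgroup_type \<Rightarrow> rat list" where
  "type_row t = map (type_coeff t) [1, 2, 3, 4, 5, 6, 7, 8, 9, 10, 11, 12, 13, 14, 15, 16, 17, 18, 19, 20, 21, 22]"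

lemma type_row_eq:
"type_row ((1, 1), (1, 1)) = [6, 0, 0, 0, 0, 0, 0, 0, 0, 0, 0, 0, 0, 0, 0, 0, 0, 0, 0, 0, 0, 0]"
  "type_row ((1, 1), (2, 2)) = [3, 1, 0, 0, 0, 0, 0, 0, 0, 0, 0, 0, 0, 0, 0, 0, 0, 0, 0, 0, 0, 0]"
  "type_row ((1, 1), (3, 3)) = [2, 0, 2, 0, 0, 0, 0, 0, 0, 0, 0, 0, 0, 0, 0, 0, 0, 0, 0, 0, 0, 0]"
  "type_row ((1, 1), (6, 6)) = [1, 1, 1, 1, 0, 0, 0, 0, 0, 0, 0, 0, 0, 0, 0, 0, 0, 0, 0, 0, 0, 0]"
  "type_row ((2, 2), (1, 1)) = [3, 0, 0, 0, 3, 0, 0, 0, 0, 0, 0, 0, 0, 0, 0, 0, 0, 0, 0, 0, 0, 0]"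
  "type_row ((2, 2), (2, 2)) = [3/2, 1/2, 0, 0, 3/2, 1/2, 0, 0, 0, 0, 0, 0, 0, 0, 0, 0, 0, 0, 0, 0, 0, 0]"
  "type_row ((2, 2), (3, 3)) = [1, 0, 1, 0, 1, 0, 1, 0, 0, 0, 0, 0, 0, 0, 0, 0, 0, 0, 0, 0, 0, 0]"
  "type_row ((2, 2), (6, 6)) = [1/2, 1/2, 1/2, 1/2, 1/2, 1/2, 1/2, 1/2, 0, 0, 0, 0, 0, 0, 0, 0, 0, 0, 0, 0, 0, 0]"
  "type_row ((3, 3), (1, 1)) = [2, 0, 0, 0, 0, 0, 0, 0, 4, 0, 0, 0, 0, 0, 0, 0, 0, 0, 0, 0, 0, 0]"
  "type_row ((3, 3), (2, 2)) = [1, 1/3, 0, 0, 0, 0, 0, 0, 2, 2/3, 0, 0, 0, 0, 0, 0, 0, 0, 0, 0, 0, 0]"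
  "type_row ((3, 3), (3, 3)) = [2/3, 0, 2/3, 0, 0, 0, 0, 0, 4/3, 0, 4/3, 0, 0, 0, 0, 0, 0, 0, 0, 0, 0, 0]"
  "type_row ((3, 3), (6, 6)) = [1/3, 1/3, 1/3, 1/3, 0, 0, 0, 0, 2/3, 2/3, 2/3, 2/3, 0, 0, 0, 0, 0, 0, 0, 0, 0, 0]"
  "type_row ((6, 6), (1, 1)) = [1, 0, 0, 0, 3, 0, 0, 0, 2, 0, 0, 0, 6, 0, 0, 0, 0, 0, 0, 0, 0, 0]"
  "type_row ((6, 6), (2, 2)) = [1/2, 1/6, 0, 0, 3/2, 1/2, 0, 0, 1, 1/3, 0, 0, 3, 1, 0, 0, 0, 0, 0, 0, 0, 0]"
  "type_row ((6, 6), (3, 3)) = [1/3, 0, 1/3, 0, 1, 0, 1, 0, 2/3, 0, 2/3, 0, 2, 0, 2, 0, 0, 0, 0, 0, 0, 0]"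
  "type_row ((6, 6), (6, 6)) = [1/6, 1/6, 1/6, 1/6, 1/2, 1/2, 1/2, 1/2, 1/3, 1/3, 1/3, 1/3, 1, 1, 1, 1, 0, 0, 0, 0, 0, 0]"
  "type_row ((2, 1), (2, 1)) = [3, 0, 0, 0, 0, 1, 0, 0, 0, 0, 0, 0, 0, 0, 0, 0, 1, 0, 0, 0, 0, 0]"
  "type_row ((2, 1), (6, 3)) = [1, 0, 1, 0, 0, 1, 0, 1, 0, 0, 0, 0, 0, 0, 0, 0, 1, 1, 0, 0, 0, 0]"
  "type_row ((6, 3), (2, 1)) = [1, 0, 0, 0, 0, 1, 0, 0, 2, 0, 0, 0, 0, 2, 0, 0, 1, 0, 2, 0, 0, 0]"
  "type_row ((6, 3), (6, 3)) = [1/3, 0, 1/3, 0, 0, 1, 0, 1, 2/3, 0, 2/3, 0, 0, 2, 0, 2, 1, 1, 2, 2, 0, 0]"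
  "type_row ((3, 1), (3, 1)) = [2, 0, 0, 0, 0, 0, 0, 0, 0, 0, 2, 0, 0, 0, 0, 0, 0, 0, 0, 0, 2, 0]"
  "type_row ((6, 1), (6, 1)) = [1, 0, 0, 0, 0, 1, 0, 0, 0, 0, 1, 0, 0, 0, 0, 0, 1, 0, 0, 0, 1, 1]"
  by (simp_all add: type_row_def type_coeff_def S3_types_def M'_rows_def del: One_nat_def)

lemma type_coeff_outside:
  assumes "t \<in> set S3_types" "j \<notin> {1..22}"
  shows "type_coeff t j = 0"
  using assms unfolding range_22
  by (auto simp: type_coeff_def S3_types_def M'_rows_def simp del: One_nat_def)

text \<open>
  \<open>e\<close> tells whether the middle projections of two subgroups agree in case both have order 2.
\<close>

fun composed_type :: "bool \<Rightarrow> subgroup_type \<Rightarrow> subgroup_type \<Rightarrow> subgroup_type" where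
  "composed_type e ((p1, k1), (p2, k2)) ((q1, l1), (q2, l2)) =
    ((k1 * inter_card e p2 q1 div inter_card e k2 q1, k1 * inter_card e p2 l1 div inter_card e k2 l1),
     (l2 * inter_card e p2 q1 div inter_card e p2 l1, l2 * inter_card e k2 q1 div inter_card e k2 l1))"

text \<open>This is the order of the stabiliser, in the middle group, of a pair of points with the
  given stabiliser types, that is, the factor by which the orbit of the pair falls short of the
  whole group.\<close>

fun middle_card :: "bool \<Rightarrow> subgroup_type \<Rightarrow> subgroup_type \<Rightarrow> nat" where
  "middle_card e (_, (p2, k2)) ((q1, l1), _) = inter_card e k2 l1"

fun type_order :: "subgroup_type \<Rightarrow> nat" where
  "type_order ((p1, k1), (p2, k2)) = p1 * k2"

section \<open>Finite verification of the product formula for types\<close>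

definition row_product :: "rat list \<Rightarrow> rat list \<Rightarrow> rat list" where
  "row_product xs ys = map (\<lambda>ps. \<Sum>(i, j)\<leftarrow>ps. xs ! (i - 1) * ys ! (j - 1)) product_terms"

lemma row_product_eq:
 "row_product [x1, x2, x3, x4, x5, x6, x7, x8, x9, x10, x11, x12, x13, x14, x15, x16, x17, x18, x19, x20, x21, x22] [y1, y2, y3, y4, y5, y6, y7, y8, y9, y10, y11, y12, y13, y14, y15, y16, y17, y18, y19, y20, y21, y22] = [x1 * y1 + x2 * y5 + x3 * y9,
     x1 * y2 + x2 * y6 + x3 * y10,
     x1 * y3 + x2 * y7 + x3 * y11,
     x1 * y4 + x2 * y8 + x3 * y12 + x4 * y22,
     x5 * y1 + x6 * y5 + x7 * y9,
     x5 * y2 + x6 * y6 + x7 * y10,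
     x5 * y3 + x6 * y7 + x7 * y11,
     x5 * y4 + x6 * y8 + x7 * y12 + x8 * y22,
     x9 * y1 + x10 * y5 + x11 * y9,
     x9 * y2 + x10 * y6 + x11 * y10,
     x9 * y3 + x10 * y7 + x11 * y11,
     x9 * y4 + x10 * y8 + x11 * y12 + x12 * y22,
     x13 * y1 + x14 * y5 + x15 * y9 + x22 * y13,
     x13 * y2 + x14 * y6 + x15 * y10 + x22 * y14,
     x13 * y3 + x14 * y7 + x15 * y11 + x22 * y15,
     x13 * y4 + x14 * y8 + x15 * y12 + x16 * y22 + x22 * y16,
     x17 * y17,
     x17 * y18 + x18 * y22,
     x19 * y17 + x22 * y19,
     x19 * y18 + x20 * y22 + x22 * y20,
     x21 * y21,
     x22 * y22]"
  by (simp add: row_product_def product_terms_def)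

text \<open>The numbers 2 and 4 count the elements of S_3 that match, respectively fail to match,
  two middle projections of order 2. Where \<open>e\<close> makes no difference the two terms add up
  to six equal ones. Multiplying by the orders of the types clears the denominators 36 of the
  weights.\<close>

definition type_product_check :: "subgroup_type \<Rightarrow> subgroup_type \<Rightarrow> bool" where
  "type_product_check t u \<longleftrightarrow>
    map (\<lambda>z. of_nat (type_order t * type_order u) * z) (row_product (type_row t) (type_row u)) =
    map2 (\<lambda>v w. of_nat (2 * middle_card True t u * type_order (composed_type True t u)) * v
        + of_nat (4 * middle_card False t u * type_order (composed_type False t u)) * w)
      (type_row (composed_type True t u)) (type_row (composed_type False t u))"

lemma set_S3_types: "set S3_types = {((1, 1), (1, 1)), ((1, 1), (2, 2)), ((1, 1), (3, 3)), ((1, 1), (6, 6)), ((2, 2), (1, 1)), ((2, 2), (2, 2)), ((2, 2), (3, 3)), ((2, 2), (6, 6)), ((3, 3), (1, 1)), ((3, 3), (2, 2)), ((3, 3), (3, 3)), ((3, 3), (6, 6)), ((6, 6), (1, 1)), ((6, 6), (2, 2)), ((6, 6), (3, 3)), ((6, 6), (6, 6)), ((2, 1), (2, 1)), ((2, 1), (6, 3)), ((6, 3), (2, 1)), ((6, 3), (6, 3)), ((3, 1), (3, 1)), ((6, 1), (6, 1))}"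
  by (simp add: S3_types_def)

text \<open>All 22 times 22 identities are evaluated here; this computation is where the entries of
  the base change matrix meet the multiplication of the pattern.\<close>

lemma type_product_check:
  assumes "t \<in> set S3_types"
  shows "list_all (type_product_check t) S3_types"
  using assms unfolding set_S3_types
  by (elim insertE emptyE)
    (simp_all add: S3_types_def type_product_check_def row_product_eq type_row_eq gcd_orders
      inter_card_def del: One_nat_def)

lemma type_row_nth:
  assumes "k \<in> {1..22}"
  shows "type_row t ! (k - 1) = type_coeff t k"
  using assms unfolding range_22 by (elim insertE emptyE) (simp_all add: type_row_def)

lemma length_rows: "length (type_row t) = 22" "length (row_product xs ys) = 22"
  by (simp_all add: type_row_def row_product_def product_terms_def)

lemma product_terms_range: "\<forall>ps\<in>set product_terms. \<forall>(i, j)\<in>set ps. i \<in> {1..22} \<and> j \<in> {1..22}"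
  by (simp add: product_terms_def)

lemma row_product_nth:
  assumes "k \<in> {1..22}"
  shows "row_product (type_row t) (type_row u) ! (k - 1) = coeff_product (type_coeff t) (type_coeff u) k"
proof -
  have k: "k - 1 < length product_terms" using assms by (auto simp: product_terms_def)
  then have "\<forall>(i, j)\<in>set (product_terms ! (k - 1)). i \<in> {1..22} \<and> j \<in> {1..22}"
    using product_terms_range nth_mem by blast
  then have "map (\<lambda>(i, j). type_row t ! (i - 1) * type_row u ! (j - 1)) (product_terms ! (k - 1))
      = map (\<lambda>(i, j). type_coeff t i * type_coeff u j) (product_terms ! (k - 1))"
    by (intro map_cong refl) (auto simp only: type_row_nth split: prod.splits)
  then show ?thesis
    unfolding row_product_def coeff_product_def nth_map[OF k] if_P[OF assms] by (simp only:)
qed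

text \<open>The cut-off applies to every type, including those outside \<open>S3_types\<close>, for
  which the lookup in \<open>type_coeff\<close> is unspecified. Product identities for composed
  types can thus be stated for all coordinates without first locating these types in the
  list.\<close>

definition type_weight :: "subgroup_type \<Rightarrow> nat \<Rightarrow> rat" where
  "type_weight t j = (if j \<in> {1..22} then of_nat (type_order t) / 36 * type_coeff t j else 0)"

lemma coeff_product_weight:
  assumes "k \<in> {1..22}"
  shows "coeff_product (type_weight t) (type_weight u) k
    = of_nat (type_order t) / 36 * (of_nat (type_order u) / 36) * coeff_product (type_coeff t) (type_coeff u) k"
proof -
  have k: "k - 1 < length product_terms" using assms by (auto simp: product_terms_def)
  then have "\<forall>(i, j)\<in>set (product_terms ! (k - 1)). i \<in> {1..22} \<and> j \<in> {1..22}"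
    using product_terms_range nth_mem by blast
  then have "map (\<lambda>(i, j). type_weight t i * type_weight u j) (product_terms ! (k - 1))
      = map (\<lambda>(i, j). of_nat (type_order t) / 36 * type_coeff t i * (of_nat (type_order u) / 36 * type_coeff u j)) (product_terms ! (k - 1))"
    by (intro map_cong refl) (auto simp only: type_weight_def if_True split: prod.splits)
  then have "coeff_product (type_weight t) (type_weight u) k = coeff_product (\<lambda>i. of_nat (type_order t) / 36 * type_coeff t i)
     (\<lambda>j. of_nat (type_order u) / 36 * type_coeff u j) k"
    unfolding coeff_product_def if_P[OF assms] by (simp only:)
  then show ?thesis unfolding coeff_product_scale .
qed

lemma weight_product:
  assumes "t \<in> set S3_types" "u \<in> set S3_types"
  shows "of_nat (2 * middle_card True t u) * type_weight (composed_type True t u) k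
      + of_nat (4 * middle_card False t u) * type_weight (composed_type False t u) k
    = 36 * coeff_product (type_weight t) (type_weight u) k"
proof (cases "k \<in> {1..22}")
  case False
  then have "coeff_product x y k = 0" for x y
    unfolding coeff_product_def by (simp only: if_False)
  with False show ?thesis by (simp only: type_weight_def if_False)
next
  case True
  then have k: "k - 1 < 22" by auto
  have "type_product_check t u"
    using type_product_check[OF assms(1)] assms(2) by (auto simp: list_all_iff)
  from arg_cong[OF this[unfolded type_product_check_def], of "\<lambda>xs. xs ! (k - 1)"]
  have "of_nat (type_order t * type_order u) * coeff_product (type_coeff t) (type_coeff u) k
    = of_nat (2 * middle_card True t u * type_order (composed_type True t u)) * type_coeff (composed_type True t u) k
      + of_nat (4 * middle_card False t u * type_order (composed_type False t u)) * type_coeff (composed_type False t u) k"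
    using k by (simp add: length_rows row_product_nth[OF True, unfolded One_nat_def] type_row_nth[OF True, unfolded One_nat_def])
  then show ?thesis
    unfolding coeff_product_weight[OF True] unfolding type_weight_def if_P[OF True] by (simp add: field_simps)
qed

section \<open>Types of actual subgroups of S_3 x S_3 and of their composites\<close>

definition subgroup_type :: "((nat \<Rightarrow> nat) \<times> (nat \<Rightarrow> nat)) set \<Rightarrow> subgroup_type" where
  "subgroup_type D = ((card (fst ` D), card (left_kernel S3 D)), (card (snd ` D), card (right_kernel S3 D)))"

locale S3_subgroup = subgroup_DirProd S3 S3 D for D
begin

lemma finite: "finite D"
  by (rule finite_subset[OF subset]) (simp add: carrier_S3)

lemma sections:
  "(card (fst ` D), card (left_kernel S3 D)) \<in> {(1, 1), (2, 1), (2, 2), (3, 1), (3, 3), (6, 1), (6, 3), (6, 6)}"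
  "card (left_kernel S3 D) = 2 \<Longrightarrow> left_kernel S3 D = fst ` D"
  "(card (snd ` D), card (right_kernel S3 D)) \<in> {(1, 1), (2, 1), (2, 2), (3, 1), (3, 3), (6, 1), (6, 3), (6, 6)}"
  "card (right_kernel S3 D) = 2 \<Longrightarrow> right_kernel S3 D = snd ` D"
  by (rule S3_section_cases[OF subgroup_fst subgroup_left_kernel left_kernel_subset left_kernel_normal[unfolded S3_simps]]
      S3_section_cases[OF subgroup_snd subgroup_right_kernel right_kernel_subset right_kernel_normal[unfolded S3_simps]];
      assumption)+

text \<open>Counting \<open>D\<close> through both projections shows that the two sections have
  equal index. Among pairs of the eight possible sections this leaves 16 of index 1, 4 of index 2
  and one each of index 3 and 6.\<close>

lemma type_in: "subgroup_type D \<in> set S3_types"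
proof -
  have "card (fst ` D) * card (right_kernel S3 D) = card (snd ` D) * card (left_kernel S3 D)"
    using card_fst card_snd finite by simp
  then show ?thesis
    using sections(1,3) unfolding subgroup_type_def S3_types_def
    by (elim insertE emptyE Pair_inject) simp_all
qed

lemma type_order: "type_order (subgroup_type D) = card D"
  using card_fst finite by (simp add: subgroup_type_def)

end

locale S3_subgroups = L: S3_subgroup L + M: S3_subgroup M for L M
begin

sublocale composable_subgroups S3 S3 S3 L M
  by unfold_locales (rule L.finite M.finite)+

text \<open>One truth value serves all four intersections although it only compares projections: a
  kernel of order 2 is equal to its projection, so whenever two groups of order 2 meet, their
  comparison is that of the projections.\<close>

lemma inter_cards:
  defines "e \<equiv> snd ` L = fst ` M"
  shows "card (snd ` L \<inter> fst ` M) = inter_card e (card (snd ` L)) (card (fst ` M))"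
    and "card (right_kernel S3 L \<inter> fst ` M) = inter_card e (card (right_kernel S3 L)) (card (fst ` M))"
    and "card (snd ` L \<inter> left_kernel S3 M) = inter_card e (card (snd ` L)) (card (left_kernel S3 M))"
    and "card (right_kernel S3 L \<inter> left_kernel S3 M)
      = inter_card e (card (right_kernel S3 L)) (card (left_kernel S3 M))"
proof -
  have *: "card (A \<inter> B) = inter_card e (card A) (card B)"
    if "subgroup A S3" "subgroup B S3" "card A = 2 \<Longrightarrow> card B = 2 \<Longrightarrow> (A = B) = e" for A B
  proof (cases "card A = 2 \<and> card B = 2")
    case True
    then have "(A = B) = e" using that(3) by blast
    then show ?thesis by (simp only: card_Int_S3[OF that(1,2)])
  next
    case False
    then show ?thesis by (simp only: card_Int_S3[OF that(1,2)] inter_card_def if_False)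
  qed
  show "card (snd ` L \<inter> fst ` M) = inter_card e (card (snd ` L)) (card (fst ` M))"
    using L.subgroup_snd M.subgroup_fst by (rule *) (simp only: e_def)
  show "card (right_kernel S3 L \<inter> fst ` M) = inter_card e (card (right_kernel S3 L)) (card (fst ` M))"
    using L.subgroup_right_kernel M.subgroup_fst by (rule *) (drule L.sections(4), simp only: e_def)
  show "card (snd ` L \<inter> left_kernel S3 M) = inter_card e (card (snd ` L)) (card (left_kernel S3 M))"
    using L.subgroup_snd M.subgroup_left_kernel by (rule *) (drule M.sections(2), simp only: e_def)
  show "card (right_kernel S3 L \<inter> left_kernel S3 M)
      = inter_card e (card (right_kernel S3 L)) (card (left_kernel S3 M))"
    using L.subgroup_right_kernel M.subgroup_left_kernel
    by (rule *) (drule L.sections(4), drule M.sections(2), simp only: e_def)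
qed

end

context S3_subgroups begin
text \<open>The four counting formulas for composites are solved for the order on the left. Division
  is legitimate because each intersection contains the identity, and the quotients are exactly the
  entries of \<open>composed_type\<close>.\<close>

lemma type_relcomp:
  "subgroup_type (L O M) = composed_type (snd ` L = fst ` M) (subgroup_type L) (subgroup_type M)"
  "card (right_kernel S3 L \<inter> left_kernel S3 M) = middle_card (snd ` L = fst ` M) (subgroup_type L) (subgroup_type M)"
proof -
  have fin: "finite (A \<inter> B)" if "subgroup A S3" for A B
    using finite_subset[OF subgroup.subset[OF that]] by (simp add: carrier_S3)
  have pos: "card (A \<inter> B) > 0" if "subgroup A S3" "subgroup B S3" for A B
    using subgroup.one_closed[OF that(1)] subgroup.one_closed[OF that(2)] fin[OF that(1)]
    by (auto simp: card_gt_0_iff)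
  have div: "a * c = b \<Longrightarrow> c > 0 \<Longrightarrow> a = b div c" for a b c :: nat by auto
  note sub = L.subgroup_snd L.subgroup_right_kernel M.subgroup_fst M.subgroup_left_kernel
  have "card (fst ` (L O M)) = card (left_kernel S3 L) * card (snd ` L \<inter> fst ` M) div card (right_kernel S3 L \<inter> fst ` M)"
    "card (left_kernel S3 (L O M)) = card (left_kernel S3 L) * card (snd ` L \<inter> left_kernel S3 M)
      div card (right_kernel S3 L \<inter> left_kernel S3 M)"
    "card (snd ` (L O M)) = card (right_kernel S3 M) * card (snd ` L \<inter> fst ` M) div card (snd ` L \<inter> left_kernel S3 M)"
    "card (right_kernel S3 (L O M)) = card (right_kernel S3 M) * card (right_kernel S3 L \<inter> fst ` M)
      div card (right_kernel S3 L \<inter> left_kernel S3 M)"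
    using div[OF card_fst_relcomp pos[OF L.subgroup_right_kernel M.subgroup_fst]]
      div[OF card_left_kernel_relcomp pos[OF L.subgroup_right_kernel M.subgroup_left_kernel]]
      div[OF card_snd_relcomp pos[OF L.subgroup_snd M.subgroup_left_kernel]]
      div[OF card_right_kernel_relcomp pos[OF L.subgroup_right_kernel M.subgroup_left_kernel]]
    by this+
  then show "subgroup_type (L O M) = composed_type (snd ` L = fst ` M) (subgroup_type L) (subgroup_type M)"
    by (simp only: subgroup_type_def composed_type.simps inter_cards)
  show "card (right_kernel S3 L \<inter> left_kernel S3 M) = middle_card (snd ` L = fst ` M) (subgroup_type L) (subgroup_type M)"
    by (simp only: subgroup_type_def middle_card.simps inter_cards(4))
qed

end

section \<open>Stabilisers in bisets\<close>

text \<open>With (a, b) acting by x -> a x b^-1 this is the usual stabiliser in G x H; the equation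
  a x = x b avoids the inverse and makes tensor products correspond to composition of
  relations.\<close>

definition biset_stab ::
  "('g, 'm) monoid_scheme \<Rightarrow> ('h, 'n) monoid_scheme \<Rightarrow> ('g, 'h, 'x) biset \<Rightarrow> 'x \<Rightarrow> ('g \<times> 'h) set" where
  "biset_stab G H X x = {(a, b) \<in> carrier G \<times> carrier H. lact X a x = ract X x b}"

text \<open>This is the conjugate of \<open>D\<close> by (c, g^-1), in preimage form: the stabiliser
  of c x g when \<open>D\<close> is that of x. The asymmetry comes from the right action.\<close>

definition conj_subgroup ::
  "('g, 'm) monoid_scheme \<Rightarrow> ('h, 'n) monoid_scheme \<Rightarrow> 'g \<Rightarrow> 'h \<Rightarrow> ('g \<times> 'h) set \<Rightarrow> ('g \<times> 'h) set" where
  "conj_subgroup G H c g D =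
    {(a, b) \<in> carrier G \<times> carrier H. (inv\<^bsub>G\<^esub> c \<otimes>\<^bsub>G\<^esub> a \<otimes>\<^bsub>G\<^esub> c, g \<otimes>\<^bsub>H\<^esub> b \<otimes>\<^bsub>H\<^esub> inv\<^bsub>H\<^esub> g) \<in> D}"

context finite_biset
begin

lemma lact_inv_cancel: "a \<in> carrier G \<Longrightarrow> x \<in> carrier X \<Longrightarrow> lact X (inv\<^bsub>G\<^esub> a) (lact X a x) = x"
  using lact_mult[of "inv\<^bsub>G\<^esub> a" a x] lact_one by simp

lemma lact_cancel_inv: "a \<in> carrier G \<Longrightarrow> x \<in> carrier X \<Longrightarrow> lact X a (lact X (inv\<^bsub>G\<^esub> a) x) = x"
  using lact_mult[of a "inv\<^bsub>G\<^esub> a" x] lact_one by simp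

lemma ract_cancel_inv: "b \<in> carrier H \<Longrightarrow> x \<in> carrier X \<Longrightarrow> ract X (ract X x b) (inv\<^bsub>H\<^esub> b) = x"
  using ract_mult[of x b "inv\<^bsub>H\<^esub> b"] ract_one by simp

lemma ract_inv_cancel: "b \<in> carrier H \<Longrightarrow> x \<in> carrier X \<Longrightarrow> ract X (ract X x (inv\<^bsub>H\<^esub> b)) b = x"
  using ract_mult[of x "inv\<^bsub>H\<^esub> b" b] ract_one by simp

lemma lact_eq_iff:
  assumes "a \<in> carrier G" "x \<in> carrier X" "y \<in> carrier X"
  shows "lact X a x = y \<longleftrightarrow> x = lact X (inv\<^bsub>G\<^esub> a) y"
  using assms lact_inv_cancel lact_cancel_inv by metis

lemma ract_eq_iff:
  assumes "b \<in> carrier H" "x \<in> carrier X" "y \<in> carrier X"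
  shows "ract X x b = y \<longleftrightarrow> x = ract X y (inv\<^bsub>H\<^esub> b)"
  using assms ract_inv_cancel ract_cancel_inv by metis

lemma stab_subgroup:
  assumes x: "x \<in> carrier X"
  shows "subgroup_DirProd G H (biset_stab G H X x)"
proof -
  interpret P: group "G \<times>\<times> H" by (rule DirProd_group) unfold_locales
  have mult: "lact X (a \<otimes>\<^bsub>G\<^esub> c) x = ract X x (b \<otimes>\<^bsub>H\<^esub> d)"
    if "a \<in> carrier G" "b \<in> carrier H" "c \<in> carrier G" "d \<in> carrier H"
      "lact X a x = ract X x b" "lact X c x = ract X x d" for a b c d
    using that x by (simp add: lact_mult ract_mult flip: act_commute)
  have inverse: "lact X (inv\<^bsub>G\<^esub> a) x = ract X x (inv\<^bsub>H\<^esub> b)"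
    if "a \<in> carrier G" "b \<in> carrier H" "lact X a x = ract X x b" for a b
  proof -
    have "ract X (lact X (inv\<^bsub>G\<^esub> a) x) b = lact X (inv\<^bsub>G\<^esub> a) (ract X x b)"
      using that x by (intro act_commute) auto
    also have "\<dots> = x"
      unfolding that(3)[symmetric] using that(1) x by (rule lact_inv_cancel)
    finally have "ract X (lact X (inv\<^bsub>G\<^esub> a) x) b = x" .
    then show ?thesis
      using that x ract_eq_iff[of b "lact X (inv\<^bsub>G\<^esub> a) x" x] by (simp add: lact_closed)
  qed
  have "subgroup (biset_stab G H X x) (G \<times>\<times> H)"
  proof (rule P.subgroupI)
    show "biset_stab G H X x \<subseteq> carrier (G \<times>\<times> H)" by (auto simp: biset_stab_def)
    have "(\<one>\<^bsub>G\<^esub>, \<one>\<^bsub>H\<^esub>) \<in> biset_stab G H X x"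
      using x by (simp add: biset_stab_def lact_one ract_one)
    then show "biset_stab G H X x \<noteq> {}" by blast
  next
    fix u assume "u \<in> biset_stab G H X x"
    then show "inv\<^bsub>G \<times>\<times> H\<^esub> u \<in> biset_stab G H X x"
      by (auto simp: biset_stab_def inv_DirProd[OF G.group_axioms H.group_axioms] inverse)
  next
    fix u v assume "u \<in> biset_stab G H X x" "v \<in> biset_stab G H X x"
    then show "u \<otimes>\<^bsub>G \<times>\<times> H\<^esub> v \<in> biset_stab G H X x"
      by (auto simp: biset_stab_def mult)
  qed
  then show ?thesis
    by (intro subgroup_DirProd.intro subgroup_DirProd_axioms.intro G.group_axioms H.group_axioms)
qed

lemma stab_move:
  assumes x: "x \<in> carrier X" and c: "c \<in> carrier G" and g: "g \<in> carrier H"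
  shows "biset_stab G H X (lact X c (ract X x g)) = conj_subgroup G H c g (biset_stab G H X x)"
proof -
  have "lact X a (lact X c (ract X x g)) = ract X (lact X c (ract X x g)) b \<longleftrightarrow>
      lact X (inv\<^bsub>G\<^esub> c \<otimes>\<^bsub>G\<^esub> a \<otimes>\<^bsub>G\<^esub> c) x = ract X x (g \<otimes>\<^bsub>H\<^esub> b \<otimes>\<^bsub>H\<^esub> inv\<^bsub>H\<^esub> g)" (is "?l = ?r \<longleftrightarrow> ?l' = ?r'")
    if a: "a \<in> carrier G" and b: "b \<in> carrier H" for a b
  proof -
    \<comment> \<open>Both sides are rewritten as the image of a point under the same invertible map
      y -> c y g; the desired equivalence then follows by undoing this map.\<close>
    have l: "?l = lact X c (ract X ?l' g)"
      using x c g a by (simp add: lact_closed ract_closed act_commute lact_cancel_inv flip: lact_mult)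
        (simp add: lact_mult lact_closed ract_closed act_commute lact_cancel_inv)
    have r: "?r = lact X c (ract X ?r' g)"
      using x c g b by (simp add: lact_closed ract_closed act_commute ract_mult ract_inv_cancel)
    have "?l' = lact X (inv\<^bsub>G\<^esub> c) (ract X ?l (inv\<^bsub>H\<^esub> g))" "?r' = lact X (inv\<^bsub>G\<^esub> c) (ract X ?r (inv\<^bsub>H\<^esub> g))"
      unfolding l r using x c g a b
      by (simp_all add: lact_closed ract_closed act_commute ract_cancel_inv lact_inv_cancel)
    with l r show ?thesis by metis
  qed
  then show ?thesis
    using c g by (auto simp: biset_stab_def conj_subgroup_def)
qed

end

section \<open>Isomorphisms of bisets\<close>

lemma biset_isomorphicE:
  assumes "biset_isomorphic G H X Y"
  obtains f where "bij_betw f (carrier X) (carrier Y)"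
    "\<And>a x. a \<in> carrier G \<Longrightarrow> x \<in> carrier X \<Longrightarrow> f (lact X a x) = lact Y a (f x)"
    "\<And>x b. x \<in> carrier X \<Longrightarrow> b \<in> carrier H \<Longrightarrow> f (ract X x b) = ract Y (f x) b"
  using assms unfolding biset_isomorphic_def by blast

lemma biset_isomorphicI:
  assumes "bij_betw f (carrier X) (carrier Y)"
    "\<And>a x. a \<in> carrier G \<Longrightarrow> x \<in> carrier X \<Longrightarrow> f (lact X a x) = lact Y a (f x)"
    "\<And>x b. x \<in> carrier X \<Longrightarrow> b \<in> carrier H \<Longrightarrow> f (ract X x b) = ract Y (f x) b"
  shows "biset_isomorphic G H X Y"
  using assms unfolding biset_isomorphic_def by blast

lemma biset_isomorphic_refl: "biset_isomorphic G H X X"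
  by (rule biset_isomorphicI[of id]) auto

lemma biset_isomorphic_trans:
  assumes "biset_isomorphic G H X Y" "biset_isomorphic G H Y Z"
  shows "biset_isomorphic G H X Z"
proof -
  obtain f where f: "bij_betw f (carrier X) (carrier Y)"
    "\<And>a x. a \<in> carrier G \<Longrightarrow> x \<in> carrier X \<Longrightarrow> f (lact X a x) = lact Y a (f x)"
    "\<And>x b. x \<in> carrier X \<Longrightarrow> b \<in> carrier H \<Longrightarrow> f (ract X x b) = ract Y (f x) b"
    using assms(1) by (rule biset_isomorphicE) blast
  obtain h where h: "bij_betw h (carrier Y) (carrier Z)"
    "\<And>a x. a \<in> carrier G \<Longrightarrow> x \<in> carrier Y \<Longrightarrow> h (lact Y a x) = lact Z a (h x)"
    "\<And>x b. x \<in> carrier Y \<Longrightarrow> b \<in> carrier H \<Longrightarrow> h (ract Y x b) = ract Z (h x) b"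
    using assms(2) by (rule biset_isomorphicE) blast
  show ?thesis
    using f h bij_betwE[OF f(1)] by (intro biset_isomorphicI[of "h \<circ> f"] bij_betw_trans[OF f(1) h(1)]) auto
qed

lemma (in finite_biset) biset_isomorphic_sym:
  assumes "biset_isomorphic G H X Y"
  shows "biset_isomorphic G H Y X"
proof -
  obtain f where f: "bij_betw f (carrier X) (carrier Y)"
    "\<And>a x. a \<in> carrier G \<Longrightarrow> x \<in> carrier X \<Longrightarrow> f (lact X a x) = lact Y a (f x)"
    "\<And>x b. x \<in> carrier X \<Longrightarrow> b \<in> carrier H \<Longrightarrow> f (ract X x b) = ract Y (f x) b"
    using assms by (rule biset_isomorphicE) blast
  define k where "k = inv_into (carrier X) f"
  have k: "k y \<in> carrier X" "f (k y) = y" if "y \<in> carrier Y" for y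
    using that f(1) unfolding k_def by (auto simp: bij_betw_def inv_into_into f_inv_into_f)
  have kf: "k (f x) = x" if "x \<in> carrier X" for x
    using that f(1) unfolding k_def by (simp add: bij_betw_def)
  show ?thesis
  proof (rule biset_isomorphicI[of k])
    show "bij_betw k (carrier Y) (carrier X)"
      unfolding k_def using f(1) by (rule bij_betw_inv_into)
    show "k (lact Y a y) = lact X a (k y)" if "a \<in> carrier G" "y \<in> carrier Y" for a y
      using that k[OF that(2)] f(2)[of a "k y"] kf[of "lact X a (k y)"] by (simp add: lact_closed)
    show "k (ract Y y b) = ract X (k y) b" if "y \<in> carrier Y" "b \<in> carrier H" for y b
      using that k[OF that(1)] f(3)[of "k y" b] kf[of "ract X (k y) b"] by (simp add: ract_closed)
  qed
qed

lemma (in finite_biset) finite_biset_transport: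
  assumes f: "bij_betw f (carrier X) (carrier Y)"
    and l: "\<And>a x. a \<in> carrier G \<Longrightarrow> x \<in> carrier X \<Longrightarrow> f (lact X a x) = lact Y a (f x)"
    and r: "\<And>x b. x \<in> carrier X \<Longrightarrow> b \<in> carrier H \<Longrightarrow> f (ract X x b) = ract Y (f x) b"
  shows "finite_biset G H Y"
proof -
  have Y: "carrier Y = f ` carrier X" using f by (simp add: bij_betw_def)
  show ?thesis
    by unfold_locales
      (auto simp: Y finite_carrier lact_closed ract_closed lact_one ract_one lact_mult ract_mult
        act_commute simp flip: l r)
qed

lemma (in finite_biset) biset_class_eq:
  assumes "biset_isomorphic G H X Y"
  shows "biset_class G H X = biset_class G H Y"
  unfolding biset_class_def
  using biset_isomorphic_trans[OF biset_isomorphic_sym[OF assms]] biset_isomorphic_trans[OF assms] by blast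

text \<open>This makes \<open>biset_class\<close> nonempty for bisets over any type of points, in
  particular for coset bisets and tensor products, whose points are sets.\<close>

lemma (in finite_biset) nat_copy:
  obtains Y :: "('g, 'h, nat) biset" where "finite_biset G H Y" "biset_isomorphic G H X Y"
proof -
  obtain f where f: "bij_betw f (carrier X) {0..<card (carrier X)}"
    using finite_carrier ex_bij_betw_finite_nat by blast
  define k where "k = inv_into (carrier X) f"
  have kf: "k (f x) = x" if "x \<in> carrier X" for x
    using that f unfolding k_def by (simp add: bij_betw_def)
  define Y :: "('g, 'h, nat) biset" where
    "Y = \<lparr>carrier = {0..<card (carrier X)}, lact = (\<lambda>a n. f (lact X a (k n))), ract = (\<lambda>n b. f (ract X (k n) b))\<rparr>"
  have *: "bij_betw f (carrier X) (carrier Y)"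
    "\<And>a x. a \<in> carrier G \<Longrightarrow> x \<in> carrier X \<Longrightarrow> f (lact X a x) = lact Y a (f x)"
    "\<And>x b. x \<in> carrier X \<Longrightarrow> b \<in> carrier H \<Longrightarrow> f (ract X x b) = ract Y (f x) b"
    using f by (simp_all add: Y_def kf)
  show thesis
    by (rule that[OF finite_biset_transport[OF *] biset_isomorphicI[OF *]])
qed

lemma (in finite_biset) biset_class_in: "biset_class G H X \<in> biset_classes G H"
proof -
  obtain Y :: "('g, 'h, nat) biset" where "finite_biset G H Y" "biset_isomorphic G H X Y"
    by (rule nat_copy)
  then show ?thesis
    unfolding biset_classes_def using biset_class_eq by blast
qed

lemma (in finite_biset) stab_iso:
  assumes f: "bij_betw f (carrier X) (carrier Y)"
    and l: "\<And>a x. a \<in> carrier G \<Longrightarrow> x \<in> carrier X \<Longrightarrow> f (lact X a x) = lact Y a (f x)"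
    and r: "\<And>x b. x \<in> carrier X \<Longrightarrow> b \<in> carrier H \<Longrightarrow> f (ract X x b) = ract Y (f x) b"
    and x: "x \<in> carrier X"
  shows "biset_stab G H Y (f x) = biset_stab G H X x"
proof -
  have "f (lact X a x) = f (ract X x b) \<longleftrightarrow> lact X a x = ract X x b"
    if "a \<in> carrier G" "b \<in> carrier H" for a b
    using that f x lact_closed ract_closed by (intro inj_on_eq_iff[of f "carrier X"]) (auto simp: bij_betw_def)
  then show ?thesis
    using x by (auto simp: biset_stab_def l r)
qed

text \<open>Every weight on subgroups yields an additive invariant of isomorphism classes;
  coordinates are later obtained with one weight for each index.\<close>

definition biset_sum ::
  "('g, 'm) monoid_scheme \<Rightarrow> ('h, 'n) monoid_scheme \<Rightarrow> (('g \<times> 'h) set \<Rightarrow> rat) \<Rightarrow> ('g, 'h, 'x) biset \<Rightarrow> rat" where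
  "biset_sum G H w X = (\<Sum>x\<in>carrier X. w (biset_stab G H X x))"

lemma (in finite_biset) biset_sum_iso:
  assumes "biset_isomorphic G H X Y"
  shows "biset_sum G H w X = biset_sum G H w Y"
proof -
  obtain f where f: "bij_betw f (carrier X) (carrier Y)"
    "\<And>a x. a \<in> carrier G \<Longrightarrow> x \<in> carrier X \<Longrightarrow> f (lact X a x) = lact Y a (f x)"
    "\<And>x b. x \<in> carrier X \<Longrightarrow> b \<in> carrier H \<Longrightarrow> f (ract X x b) = ract Y (f x) b"
    using assms by (rule biset_isomorphicE) blast
  show ?thesis
    unfolding biset_sum_def sum.reindex_bij_betw[OF f(1), symmetric]
    by (simp add: stab_iso[OF f])
qed

section \<open>Disjoint unions and orbits\<close>

lemma finite_biset_union:
  assumes "finite_biset G H X" "finite_biset G H Y"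
  shows "finite_biset G H (biset_union X Y)"
proof -
  interpret X: finite_biset G H X by fact
  interpret Y: finite_biset G H Y by fact
  show ?thesis
    by unfold_locales
      (auto simp: biset_union_def X.finite_carrier Y.finite_carrier X.lact_closed Y.lact_closed X.ract_closed
        Y.ract_closed X.lact_one Y.lact_one X.ract_one Y.ract_one X.lact_mult Y.lact_mult X.ract_mult
        Y.ract_mult X.act_commute Y.act_commute)
qed

lemma biset_sum_union:
  assumes "finite_biset G H X" "finite_biset G H Y"
  shows "biset_sum G H w (biset_union X Y) = biset_sum G H w X + biset_sum G H w Y"
proof -
  have "biset_stab G H (biset_union X Y) (Inl x) = biset_stab G H X x"
    "biset_stab G H (biset_union X Y) (Inr y) = biset_stab G H Y y" for x y
    by (simp_all add: biset_stab_def biset_union_def)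
  then show ?thesis
    using finite_biset.finite_carrier[OF assms(1)] finite_biset.finite_carrier[OF assms(2)]
    unfolding biset_sum_def by (simp add: biset_union_def sum.Plus)
qed

lemma (in finite_biset) finite_biset_restrict:
  assumes "A \<subseteq> carrier X" "\<And>a x. a \<in> carrier G \<Longrightarrow> x \<in> A \<Longrightarrow> lact X a x \<in> A"
    "\<And>x b. x \<in> A \<Longrightarrow> b \<in> carrier H \<Longrightarrow> ract X x b \<in> A"
  shows "finite_biset G H (X\<lparr>carrier := A\<rparr>)"
  using assms finite_subset[OF assms(1) finite_carrier]
  by unfold_locales (auto simp: subset_iff lact_one ract_one lact_mult ract_mult act_commute)

text \<open>Used to peel an orbit off a biset: invariance in both directions makes the complement
  invariant as well.\<close>

lemma biset_isomorphic_split: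
  assumes "A \<subseteq> carrier X"
    and "\<And>a x. a \<in> carrier G \<Longrightarrow> x \<in> carrier X \<Longrightarrow> lact X a x \<in> A \<longleftrightarrow> x \<in> A"
    and "\<And>x b. x \<in> carrier X \<Longrightarrow> b \<in> carrier H \<Longrightarrow> ract X x b \<in> A \<longleftrightarrow> x \<in> A"
  shows "biset_isomorphic G H (biset_union (X\<lparr>carrier := A\<rparr>) (X\<lparr>carrier := carrier X - A\<rparr>)) X"
proof (rule biset_isomorphicI[of "case_sum id id"])
  show "bij_betw (case_sum id id) (carrier (biset_union (X\<lparr>carrier := A\<rparr>) (X\<lparr>carrier := carrier X - A\<rparr>))) (carrier X)"
    using assms(1) by (auto simp: biset_union_def bij_betw_def inj_on_def Plus_def image_Un image_image)
qed (auto simp: biset_union_def)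

definition biset_orbit ::
  "('g, 'm) monoid_scheme \<Rightarrow> ('h, 'n) monoid_scheme \<Rightarrow> ('g, 'h, 'x) biset \<Rightarrow> 'x \<Rightarrow> 'x set" where
  "biset_orbit G H X x = (\<lambda>(a, b). lact X a (ract X x b)) ` (carrier G \<times> carrier H)"

context finite_biset
begin

lemma orbit_subset: "x \<in> carrier X \<Longrightarrow> biset_orbit G H X x \<subseteq> carrier X"
  by (auto simp: biset_orbit_def lact_closed ract_closed)

lemma orbit_self: "x \<in> carrier X \<Longrightarrow> x \<in> biset_orbit G H X x"
  unfolding biset_orbit_def by (rule image_eqI[of _ _ "(\<one>\<^bsub>G\<^esub>, \<one>\<^bsub>H\<^esub>)"]) (auto simp: lact_one ract_one)

lemma orbit_lact:
  assumes "x \<in> carrier X" "y \<in> biset_orbit G H X x" "a \<in> carrier G"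
  shows "lact X a y \<in> biset_orbit G H X x"
proof -
  obtain c b where "c \<in> carrier G" "b \<in> carrier H" "y = lact X c (ract X x b)"
    using assms(2) by (auto simp: biset_orbit_def)
  then show ?thesis
    unfolding biset_orbit_def using assms(1,3)
    by (intro image_eqI[of _ _ "(a \<otimes>\<^bsub>G\<^esub> c, b)"]) (auto simp: lact_mult ract_closed)
qed

lemma orbit_ract:
  assumes "x \<in> carrier X" "y \<in> biset_orbit G H X x" "b \<in> carrier H"
  shows "ract X y b \<in> biset_orbit G H X x"
proof -
  obtain c d where "c \<in> carrier G" "d \<in> carrier H" "y = lact X c (ract X x d)"
    using assms(2) by (auto simp: biset_orbit_def)
  then show ?thesis
    unfolding biset_orbit_def using assms(1,3)
    by (intro image_eqI[of _ _ "(c, d \<otimes>\<^bsub>H\<^esub> b)"]) (auto simp: ract_mult ract_closed act_commute)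
qed

lemma orbit_lact_iff:
  assumes "x \<in> carrier X" "y \<in> carrier X" "a \<in> carrier G"
  shows "lact X a y \<in> biset_orbit G H X x \<longleftrightarrow> y \<in> biset_orbit G H X x"
  using assms orbit_lact[of x y a] orbit_lact[of x "lact X a y" "inv\<^bsub>G\<^esub> a"] by (auto simp: lact_inv_cancel)

lemma orbit_ract_iff:
  assumes "x \<in> carrier X" "y \<in> carrier X" "b \<in> carrier H"
  shows "ract X y b \<in> biset_orbit G H X x \<longleftrightarrow> y \<in> biset_orbit G H X x"
  using assms orbit_ract[of x y b] orbit_ract[of x "ract X y b" "inv\<^bsub>H\<^esub> b"] by (auto simp: ract_cancel_inv)

end

section \<open>Conjugation and the invariance of types\<close>

lemma (in group) conjugation_cancel:
  assumes "g \<in> carrier G" "b \<in> carrier G"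
  shows "g \<otimes> (inv g \<otimes> b \<otimes> g) \<otimes> inv g = b" and "inv g \<otimes> (g \<otimes> b \<otimes> inv g) \<otimes> g = b"
proof -
  have "g \<otimes> (inv g \<otimes> b \<otimes> g) \<otimes> inv g = (g \<otimes> inv g) \<otimes> b \<otimes> (g \<otimes> inv g)"
    using assms by (simp only: m_assoc inv_closed m_closed)
  then show "g \<otimes> (inv g \<otimes> b \<otimes> g) \<otimes> inv g = b" using assms by simp
  have "inv g \<otimes> (g \<otimes> b \<otimes> inv g) \<otimes> g = (inv g \<otimes> g) \<otimes> b \<otimes> (inv g \<otimes> g)"
    using assms by (simp only: m_assoc inv_closed m_closed)
  then show "inv g \<otimes> (g \<otimes> b \<otimes> inv g) \<otimes> g = b" using assms by simp
qed

lemma (in group) card_conjugation_vimage: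
  assumes g: "g \<in> carrier G" and A: "A \<subseteq> carrier G"
  shows "card {b \<in> carrier G. g \<otimes> b \<otimes> inv g \<in> A} = card A"
proof -
  have "bij_betw (\<lambda>b. g \<otimes> b \<otimes> inv g) {b \<in> carrier G. g \<otimes> b \<otimes> inv g \<in> A} A"
  proof (rule bij_betw_byWitness[where f' = "\<lambda>b. inv g \<otimes> b \<otimes> g"])
    show "\<forall>b\<in>{b \<in> carrier G. g \<otimes> b \<otimes> inv g \<in> A}. inv g \<otimes> (g \<otimes> b \<otimes> inv g) \<otimes> g = b"
      using g conjugation_cancel(2) by blast
    show "\<forall>b\<in>A. g \<otimes> (inv g \<otimes> b \<otimes> g) \<otimes> inv g = b"
      using g A conjugation_cancel(1) by blast
    show "(\<lambda>b. g \<otimes> b \<otimes> inv g) ` {b \<in> carrier G. g \<otimes> b \<otimes> inv g \<in> A} \<subseteq> A" by blast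
    show "(\<lambda>b. inv g \<otimes> b \<otimes> g) ` A \<subseteq> {b \<in> carrier G. g \<otimes> b \<otimes> inv g \<in> A}"
    proof
      fix x assume "x \<in> (\<lambda>b. inv g \<otimes> b \<otimes> g) ` A"
      then obtain b where b: "b \<in> A" "x = inv g \<otimes> b \<otimes> g" by blast
      then have "b \<in> carrier G" using A by blast
      with b g show "x \<in> {b \<in> carrier G. g \<otimes> b \<otimes> inv g \<in> A}"
        by (simp only: mem_Collect_eq conjugation_cancel m_closed inv_closed simp_thms)
    qed
  qed
  then show ?thesis by (rule bij_betw_same_card)
qed

context subgroup_DirProd
begin

text \<open>An element admissible in one slot is completed to a pair by conjugating its partner in
  the other slot, which gives the nontrivial inclusions for the projections.\<close>

lemma conj_subgroup_projections:
  assumes c: "c \<in> carrier G" and g: "g \<in> carrier H"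
  shows "fst ` conj_subgroup G H c g D = {a \<in> carrier G. inv\<^bsub>G\<^esub> c \<otimes>\<^bsub>G\<^esub> a \<otimes>\<^bsub>G\<^esub> c \<in> fst ` D}"
    and "snd ` conj_subgroup G H c g D = {b \<in> carrier H. g \<otimes>\<^bsub>H\<^esub> b \<otimes>\<^bsub>H\<^esub> inv\<^bsub>H\<^esub> g \<in> snd ` D}"
    and "left_kernel H (conj_subgroup G H c g D) = {a \<in> carrier G. inv\<^bsub>G\<^esub> c \<otimes>\<^bsub>G\<^esub> a \<otimes>\<^bsub>G\<^esub> c \<in> left_kernel H D}"
    and "right_kernel G (conj_subgroup G H c g D) = {b \<in> carrier H. g \<otimes>\<^bsub>H\<^esub> b \<otimes>\<^bsub>H\<^esub> inv\<^bsub>H\<^esub> g \<in> right_kernel G D}"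
proof -
  show "fst ` conj_subgroup G H c g D = {a \<in> carrier G. inv\<^bsub>G\<^esub> c \<otimes>\<^bsub>G\<^esub> a \<otimes>\<^bsub>G\<^esub> c \<in> fst ` D}" (is "_ = ?R")
  proof
    show "?R \<subseteq> fst ` conj_subgroup G H c g D"
    proof
      fix a assume "a \<in> ?R"
      then obtain b where b: "a \<in> carrier G" "(inv\<^bsub>G\<^esub> c \<otimes>\<^bsub>G\<^esub> a \<otimes>\<^bsub>G\<^esub> c, b) \<in> D"
        unfolding fst_eq_Domain by blast
      moreover have "g \<otimes>\<^bsub>H\<^esub> (inv\<^bsub>H\<^esub> g \<otimes>\<^bsub>H\<^esub> b \<otimes>\<^bsub>H\<^esub> g) \<otimes>\<^bsub>H\<^esub> inv\<^bsub>H\<^esub> g = b"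
        using g carrierD(2)[OF b(2)] by (rule H.conjugation_cancel)
      ultimately have "(a, inv\<^bsub>H\<^esub> g \<otimes>\<^bsub>H\<^esub> b \<otimes>\<^bsub>H\<^esub> g) \<in> conj_subgroup G H c g D"
        using g carrierD(2)[OF b(2)] by (simp add: conj_subgroup_def)
      then show "a \<in> fst ` conj_subgroup G H c g D" by force
    qed
  qed (force simp: conj_subgroup_def)
  show "snd ` conj_subgroup G H c g D = {b \<in> carrier H. g \<otimes>\<^bsub>H\<^esub> b \<otimes>\<^bsub>H\<^esub> inv\<^bsub>H\<^esub> g \<in> snd ` D}" (is "_ = ?R")
  proof
    show "?R \<subseteq> snd ` conj_subgroup G H c g D"
    proof
      fix b assume "b \<in> ?R"
      then obtain a where a: "b \<in> carrier H" "(a, g \<otimes>\<^bsub>H\<^esub> b \<otimes>\<^bsub>H\<^esub> inv\<^bsub>H\<^esub> g) \<in> D"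
        unfolding snd_eq_Range by blast
      moreover have "inv\<^bsub>G\<^esub> c \<otimes>\<^bsub>G\<^esub> (c \<otimes>\<^bsub>G\<^esub> a \<otimes>\<^bsub>G\<^esub> inv\<^bsub>G\<^esub> c) \<otimes>\<^bsub>G\<^esub> c = a"
        using c carrierD(1)[OF a(2)] by (rule G.conjugation_cancel)
      ultimately have "(c \<otimes>\<^bsub>G\<^esub> a \<otimes>\<^bsub>G\<^esub> inv\<^bsub>G\<^esub> c, b) \<in> conj_subgroup G H c g D"
        using c carrierD(1)[OF a(2)] by (simp add: conj_subgroup_def)
      then show "b \<in> snd ` conj_subgroup G H c g D" by force
    qed
  qed (force simp: conj_subgroup_def)
  show "left_kernel H (conj_subgroup G H c g D) = {a \<in> carrier G. inv\<^bsub>G\<^esub> c \<otimes>\<^bsub>G\<^esub> a \<otimes>\<^bsub>G\<^esub> c \<in> left_kernel H D}"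
    and "right_kernel G (conj_subgroup G H c g D) = {b \<in> carrier H. g \<otimes>\<^bsub>H\<^esub> b \<otimes>\<^bsub>H\<^esub> inv\<^bsub>H\<^esub> g \<in> right_kernel G D}"
    using c g by (auto simp: conj_subgroup_def left_kernel_def right_kernel_def)
qed

lemma conj_subgroup_cards:
  assumes c: "c \<in> carrier G" and g: "g \<in> carrier H"
  shows "card (fst ` conj_subgroup G H c g D) = card (fst ` D)"
    and "card (snd ` conj_subgroup G H c g D) = card (snd ` D)"
    and "card (left_kernel H (conj_subgroup G H c g D)) = card (left_kernel H D)"
    and "card (right_kernel G (conj_subgroup G H c g D)) = card (right_kernel G D)"
  unfolding conj_subgroup_projections[OF assms]
  using G.card_conjugation_vimage[of "inv\<^bsub>G\<^esub> c"] H.card_conjugation_vimage[OF g] c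
    subgroup.subset[OF subgroup_fst] subgroup.subset[OF subgroup_snd]
    subgroup.subset[OF subgroup_left_kernel] subgroup.subset[OF subgroup_right_kernel] by simp_all

end

lemma (in S3_subgroup) type_conj_subgroup:
  assumes "c \<in> carrier S3" "g \<in> carrier S3"
  shows "subgroup_type (conj_subgroup S3 S3 c g D) = subgroup_type D"
  unfolding subgroup_type_def conj_subgroup_cards[OF assms] ..

lemma S3_subgroup_iff: "S3_subgroup D \<longleftrightarrow> subgroup D (S3 \<times>\<times> S3)"
  by (simp add: S3_subgroup_def subgroup_DirProd_def subgroup_DirProd_axioms_def S3.group_axioms)

text \<open>
  The multiplication rule for the vectors \<open>type_weight\<close> holds only after averaging over the conjugates of the left factor.
\<close>

lemma weight_average:
  assumes L: "S3_subgroup L" and M: "S3_subgroup M"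
    and conj: "\<And>g. g \<in> carrier S3 \<Longrightarrow> S3_subgroup (conj_subgroup S3 S3 id g L)"
  shows "(\<Sum>g\<in>carrier S3. of_nat (card (right_kernel S3 (conj_subgroup S3 S3 id g L) \<inter> left_kernel S3 M))
      * type_weight (subgroup_type (conj_subgroup S3 S3 id g L O M)) k)
    = 36 * coeff_product (type_weight (subgroup_type L)) (type_weight (subgroup_type M)) k"
proof -
  interpret L: S3_subgroup L by fact
  interpret M: S3_subgroup M by fact
  define t u where "t = subgroup_type L" and "u = subgroup_type M"
  define F where "F e = of_nat (middle_card e t u) * type_weight (composed_type e t u) k" for e
  define E where "E g \<longleftrightarrow> snd ` conj_subgroup S3 S3 id g L = fst ` M" for g
  have F: "of_nat (card (right_kernel S3 (conj_subgroup S3 S3 id g L) \<inter> left_kernel S3 M))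
      * type_weight (subgroup_type (conj_subgroup S3 S3 id g L O M)) k = F (E g)" if g: "g \<in> carrier S3" for g
  proof -
    interpret P: S3_subgroups "conj_subgroup S3 S3 id g L" M
      using conj[OF g] M by (rule S3_subgroups.intro)
    show ?thesis
      unfolding P.type_relcomp F_def E_def t_def u_def
      using L.type_conj_subgroup[OF S3.one_closed[unfolded S3_simps] g] by simp
  qed
  \<comment> \<open>The summand depends on \<open>g\<close> only through the coincidence of the
    middle projections. If both have order 2, it occurs for 2 of the 6 elements; otherwise
    \<open>F\<close> is constant.\<close>
  have "(\<Sum>g\<in>carrier S3. F (E g)) = 2 * F True + 4 * F False"
  proof (cases "card (snd ` L) = 2 \<and> card (fst ` M) = 2")
    case True
    have "{g \<in> carrier S3. E g} = {g \<in> carrier S3. {b \<in> carrier S3. g \<circ> b \<circ> inv\<^bsub>S3\<^esub> g \<in> snd ` L} = fst ` M}"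
      unfolding E_def
      using L.conj_subgroup_projections(2)[OF S3.one_closed[unfolded S3_simps]] by (simp cong: conj_cong)
    then have "card {g \<in> carrier S3. E g} = 2"
      using card_conjugators_S3[OF L.subgroup_snd M.subgroup_fst] True by simp
    moreover have "card {g \<in> carrier S3. E g} + card {g \<in> carrier S3. \<not> E g} = 6"
    proof -
      have "card {g \<in> carrier S3. E g} + card {g \<in> carrier S3. \<not> E g}
          = card ({g \<in> carrier S3. E g} \<union> {g \<in> carrier S3. \<not> E g})"
        by (rule card_Un_disjoint[symmetric]) (auto simp: carrier_S3)
      also have "{g \<in> carrier S3. E g} \<union> {g \<in> carrier S3. \<not> E g} = carrier S3" by blast
      finally show ?thesis by (simp add: carrier_S3)
    qed
    ultimately have cards: "card {g \<in> carrier S3. E g} = 2" "card {g \<in> carrier S3. \<not> E g} = 4" by linarith+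
    have "(\<Sum>g\<in>carrier S3. F (E g))
        = (\<Sum>g\<in>carrier S3. if E g then F True else 0) + (\<Sum>g\<in>carrier S3. if \<not> E g then F False else 0)"
      unfolding sum.distrib[symmetric] by (rule sum.cong) auto
    also have "\<dots> = (\<Sum>g\<in>{g \<in> carrier S3. E g}. F True) + (\<Sum>g\<in>{g \<in> carrier S3. \<not> E g}. F False)"
      by (subst (1 2) sum.inter_filter) (simp_all add: carrier_S3)
    finally show ?thesis unfolding sum_constant cards by simp
  next
    case False
    \<comment> \<open>A kernel of order 2 would force a projection of order 2. Hence none of the
      four pairs of middle groups consists of two groups of order 2, and \<open>inter_card\<close>
      ignores its truth value.\<close>
    have "card (right_kernel S3 L) \<noteq> 2 \<or> card (snd ` L) = 2" "card (left_kernel S3 M) \<noteq> 2 \<or> card (fst ` M) = 2"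
      using L.sections(4) M.sections(2) by metis+
    with False have no: "\<not> (card (snd ` L) = 2 \<and> card (fst ` M) = 2)" "\<not> (card (right_kernel S3 L) = 2 \<and> card (fst ` M) = 2)"
      "\<not> (card (snd ` L) = 2 \<and> card (left_kernel S3 M) = 2)" "\<not> (card (right_kernel S3 L) = 2 \<and> card (left_kernel S3 M) = 2)"
      by blast+
    have "inter_card e a b = inter_card True a b" if "\<not> (a = 2 \<and> b = 2)" for e a b
      unfolding inter_card_def if_not_P[OF that] ..
    note * = this[OF no(1)] this[OF no(2)] this[OF no(3)] this[OF no(4)]
    have "F e = F True" for e
      unfolding F_def t_def u_def subgroup_type_def middle_card.simps composed_type.simps *[of e] ..
    then have "F (E g) = F True" "F False = F True" for g by blast+
    then show ?thesis by (simp add: carrier_S3)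
  qed
  also have "\<dots> = 36 * coeff_product (type_weight t) (type_weight u) k"
    using weight_product[OF L.type_in M.type_in, of k] unfolding F_def t_def u_def by simp
  finally show ?thesis
    unfolding t_def u_def using sum.cong[OF refl F] by (rule trans[rotated])
qed

section \<open>The tensor product of bisets\<close>

lemma finite_biset_coset:
  assumes "group G" "group H" "finite (carrier G)" "finite (carrier H)" and L: "subgroup L (G \<times>\<times> H)"
  shows "finite_biset G H (coset_biset G H L)"
proof -
  interpret G: group G by fact
  interpret H: group H by fact
  interpret P: group "G \<times>\<times> H" by (rule DirProd_group) unfold_locales
  have L': "L \<subseteq> carrier (G \<times>\<times> H)" using L by (rule subgroup.subset)
  have mem: "u <#\<^bsub>G \<times>\<times> H\<^esub> C \<in> lcosets\<^bsub>G \<times>\<times> H\<^esub> L"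
    if "u \<in> carrier (G \<times>\<times> H)" "C \<in> lcosets\<^bsub>G \<times>\<times> H\<^esub> L" for u C
    using that P.lcos_m_assoc[OF L'] P.m_closed by (force simp: LCOSETS_def)
  have assoc: "u <#\<^bsub>G \<times>\<times> H\<^esub> (v <#\<^bsub>G \<times>\<times> H\<^esub> C) = (u \<otimes>\<^bsub>G \<times>\<times> H\<^esub> v) <#\<^bsub>G \<times>\<times> H\<^esub> C"
    if "u \<in> carrier (G \<times>\<times> H)" "v \<in> carrier (G \<times>\<times> H)" "C \<in> lcosets\<^bsub>G \<times>\<times> H\<^esub> L" for u v C
    using that P.lcosets_subset_PowG[OF L] by (intro P.lcos_m_assoc) auto
  have one: "\<one>\<^bsub>G \<times>\<times> H\<^esub> <#\<^bsub>G \<times>\<times> H\<^esub> C = C" if "C \<in> lcosets\<^bsub>G \<times>\<times> H\<^esub> L" for C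
    using that P.lcosets_subset_PowG[OF L] by (intro P.lcos_mult_one) auto
  have "finite (lcosets\<^bsub>G \<times>\<times> H\<^esub> L)"
    unfolding LCOSETS_def using assms(3,4) by auto
  then show ?thesis
    by unfold_locales
      (use mem assoc one in \<open>auto simp: coset_biset_def H.inv_mult_group\<close>)
qed

locale composable_bisets = X: finite_biset G K X + Y: finite_biset K H Y
  for G :: "('g, 'm) monoid_scheme" and K :: "('k, 'o) monoid_scheme"
    and H :: "('h, 'n) monoid_scheme" and X :: "('g, 'k, 'x) biset" and Y :: "('k, 'h, 'y) biset" +
  assumes finite_middle: "finite (carrier K)"
begin

definition act :: "'x \<times> 'y \<Rightarrow> 'k \<Rightarrow> 'x \<times> 'y" where
  "act p g = (ract X (fst p) g, lact Y (inv\<^bsub>K\<^esub> g) (snd p))"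

definition orb :: "'x \<times> 'y \<Rightarrow> ('x \<times> 'y) set" where
  "orb p = act p ` carrier K"

abbreviation pairs :: "('x \<times> 'y) set" where
  "pairs \<equiv> carrier X \<times> carrier Y"

lemma act_closed: "p \<in> pairs \<Longrightarrow> g \<in> carrier K \<Longrightarrow> act p g \<in> pairs"
  by (auto simp: act_def X.ract_closed Y.lact_closed)

lemma act_one: "p \<in> pairs \<Longrightarrow> act p \<one>\<^bsub>K\<^esub> = p"
  by (auto simp: act_def X.ract_one Y.lact_one)

lemma act_mult: "p \<in> pairs \<Longrightarrow> g \<in> carrier K \<Longrightarrow> h \<in> carrier K \<Longrightarrow> act p (g \<otimes>\<^bsub>K\<^esub> h) = act (act p g) h"
  by (auto simp: act_def X.ract_mult Y.lact_mult X.H.inv_mult_group)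

lemma orb_self: "p \<in> pairs \<Longrightarrow> p \<in> orb p"
  unfolding orb_def by (rule image_eqI[of _ _ "\<one>\<^bsub>K\<^esub>"]) (simp_all add: act_one)

lemma orb_subset: "p \<in> pairs \<Longrightarrow> orb p \<subseteq> pairs"
  unfolding orb_def using act_closed by blast

lemma orb_act:
  assumes p: "p \<in> pairs" and g: "g \<in> carrier K"
  shows "orb (act p g) = orb p"
proof
  show "orb (act p g) \<subseteq> orb p"
  proof
    fix q assume "q \<in> orb (act p g)"
    then obtain h where "h \<in> carrier K" "q = act (act p g) h" unfolding orb_def by blast
    then show "q \<in> orb p"
      unfolding orb_def using p g by (intro image_eqI[of _ _ "g \<otimes>\<^bsub>K\<^esub> h"]) (auto simp: act_mult)
  qed
  show "orb p \<subseteq> orb (act p g)"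
  proof
    fix q assume "q \<in> orb p"
    then obtain h where h: "h \<in> carrier K" "q = act p h" unfolding orb_def by blast
    have "act (act p g) (inv\<^bsub>K\<^esub> g \<otimes>\<^bsub>K\<^esub> h) = act p (g \<otimes>\<^bsub>K\<^esub> (inv\<^bsub>K\<^esub> g \<otimes>\<^bsub>K\<^esub> h))"
      using p g h(1) by (simp add: act_mult)
    also have "g \<otimes>\<^bsub>K\<^esub> (inv\<^bsub>K\<^esub> g \<otimes>\<^bsub>K\<^esub> h) = h"
      using g h(1) by (simp flip: X.H.m_assoc)
    finally show "q \<in> orb (act p g)"
      unfolding orb_def using g h by (intro image_eqI[of _ _ "inv\<^bsub>K\<^esub> g \<otimes>\<^bsub>K\<^esub> h"]) auto
  qed
qed

lemma orb_eq: "p \<in> pairs \<Longrightarrow> q \<in> orb p \<Longrightarrow> orb q = orb p"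
  using orb_act unfolding orb_def by blast

lemma orb_eq_iff: "p \<in> pairs \<Longrightarrow> q \<in> pairs \<Longrightarrow> orb q = orb p \<longleftrightarrow> q \<in> orb p"
  using orb_eq orb_self by blast

lemma finite_orb: "finite (orb p)"
  unfolding orb_def using finite_middle by simp

lemma card_orb_pos: "p \<in> pairs \<Longrightarrow> card (orb p) > 0"
  using orb_self[of p] finite_orb[of p] by (metis card_gt_0_iff empty_iff)

lemma carrier_tensor: "carrier (biset_tensor K X Y) = orb ` pairs"
  by (auto simp: biset_tensor_def orb_def act_def image_def)

lemma lact_tensor:
  assumes "a \<in> carrier G" "x \<in> carrier X" "y \<in> carrier Y"
  shows "lact (biset_tensor K X Y) a (orb (x, y)) = orb (lact X a x, y)"
  using assms by (simp add: biset_tensor_def orb_def act_def image_image X.act_commute)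

lemma ract_tensor:
  assumes "b \<in> carrier H" "x \<in> carrier X" "y \<in> carrier Y"
  shows "ract (biset_tensor K X Y) (orb (x, y)) b = orb (x, ract Y y b)"
  using assms by (simp add: biset_tensor_def orb_def act_def image_image Y.act_commute)

lemma finite_biset_tensor: "finite_biset G H (biset_tensor K X Y)"
proof -
  have fin: "finite (carrier (biset_tensor K X Y))"
    unfolding carrier_tensor using X.finite_carrier Y.finite_carrier by simp
  show ?thesis
    by unfold_locales
      (use fin in \<open>auto simp: carrier_tensor lact_tensor ract_tensor X.lact_closed Y.ract_closed X.lact_one
        Y.ract_one X.lact_mult Y.ract_mult\<close>)
qed

text \<open>The orbits of (a x, y) and (x, y b) coincide precisely when some g in the middle group
  satisfies a x = x g and g y = y b, which is membership of (a, b) in the relational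
  composite.\<close>

lemma stab_tensor:
  assumes x: "x \<in> carrier X" and y: "y \<in> carrier Y"
  shows "biset_stab G H (biset_tensor K X Y) (orb (x, y)) = biset_stab G K X x O biset_stab K H Y y"
proof -
  have *: "orb (lact X a x, y) = orb (x, ract Y y b) \<longleftrightarrow>
      (\<exists>g\<in>carrier K. lact X a x = ract X x g \<and> lact Y g y = ract Y y b)"
    if "a \<in> carrier G" "b \<in> carrier H" for a b
  proof -
    have "orb (lact X a x, y) = orb (x, ract Y y b) \<longleftrightarrow> (lact X a x, y) \<in> orb (x, ract Y y b)"
      using that x y by (intro orb_eq_iff) (auto simp: X.lact_closed Y.ract_closed)
    also have "\<dots> \<longleftrightarrow> (\<exists>g\<in>carrier K. lact X a x = ract X x g \<and> y = lact Y (inv\<^bsub>K\<^esub> g) (ract Y y b))"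
      unfolding orb_def act_def by auto
    also have "\<dots> \<longleftrightarrow> (\<exists>g\<in>carrier K. lact X a x = ract X x g \<and> lact Y g y = ract Y y b)"
      using that y by (intro bex_cong refl conj_cong Y.lact_eq_iff[symmetric]) (auto simp: Y.ract_closed)
    finally show ?thesis .
  qed
  have "(a, b) \<in> biset_stab G H (biset_tensor K X Y) (orb (x, y))
      \<longleftrightarrow> (a, b) \<in> biset_stab G K X x O biset_stab K H Y y" for a b
  proof (cases "a \<in> carrier G \<and> b \<in> carrier H")
    case True
    note ab = conjunct1[OF True] conjunct2[OF True]
    have "(a, b) \<in> biset_stab G H (biset_tensor K X Y) (orb (x, y)) \<longleftrightarrow> orb (lact X a x, y) = orb (x, ract Y y b)"
      using ab by (simp add: biset_stab_def lact_tensor[OF ab(1) x y] ract_tensor[OF ab(2) x y])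
    also have "\<dots> \<longleftrightarrow> (a, b) \<in> biset_stab G K X x O biset_stab K H Y y"
      unfolding *[OF ab] using ab by (auto simp: biset_stab_def)
    finally show ?thesis .
  qed (auto simp: biset_stab_def)
  then show ?thesis by (intro equalityI subrelI) blast+
qed

text \<open>Orbit-stabiliser for the middle group: g fixes the pair when x g = x and g y = y, so the
  stabiliser is the intersection of the inner kernels.\<close>

lemma card_orb:
  assumes x: "x \<in> carrier X" and y: "y \<in> carrier Y"
  shows "card (orb (x, y)) * card (right_kernel G (biset_stab G K X x) \<inter> left_kernel H (biset_stab K H Y y))
    = card (carrier K)"
proof -
  let ?p = "(x, y)"
  have p: "?p \<in> pairs" using x y by simp
  define S where "S = {s \<in> carrier K. act ?p s = ?p}"
  have "lact Y (inv\<^bsub>K\<^esub> s) y = y \<longleftrightarrow> lact Y s y = y" if "s \<in> carrier K" for s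
    using that y Y.lact_eq_iff[of s y y] by auto
  then have S: "right_kernel G (biset_stab G K X x) \<inter> left_kernel H (biset_stab K H Y y) = S"
    using x y by (auto simp: S_def right_kernel_def left_kernel_def biset_stab_def act_def X.lact_one Y.ract_one)
  have "card {g \<in> carrier K. act ?p g = q} = card S" if "q \<in> orb ?p" for q
  proof -
    obtain h where h: "h \<in> carrier K" "q = act ?p h" using \<open>q \<in> orb ?p\<close> unfolding orb_def by blast
    have "bij_betw (\<lambda>s. s \<otimes>\<^bsub>K\<^esub> h) S {g \<in> carrier K. act ?p g = q}"
    proof (rule bij_betw_byWitness[where f' = "\<lambda>g. g \<otimes>\<^bsub>K\<^esub> inv\<^bsub>K\<^esub> h"])
      show "\<forall>s\<in>S. s \<otimes>\<^bsub>K\<^esub> h \<otimes>\<^bsub>K\<^esub> inv\<^bsub>K\<^esub> h = s"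
        using h by (auto simp: S_def X.H.m_assoc)
      show "\<forall>g\<in>{g \<in> carrier K. act ?p g = q}. g \<otimes>\<^bsub>K\<^esub> inv\<^bsub>K\<^esub> h \<otimes>\<^bsub>K\<^esub> h = g"
        using h by (auto simp: X.H.m_assoc)
      show "(\<lambda>s. s \<otimes>\<^bsub>K\<^esub> h) ` S \<subseteq> {g \<in> carrier K. act ?p g = q}"
        using h p by (auto simp: S_def act_mult)
      show "(\<lambda>g. g \<otimes>\<^bsub>K\<^esub> inv\<^bsub>K\<^esub> h) ` {g \<in> carrier K. act ?p g = q} \<subseteq> S"
      proof
        fix s assume "s \<in> (\<lambda>g. g \<otimes>\<^bsub>K\<^esub> inv\<^bsub>K\<^esub> h) ` {g \<in> carrier K. act ?p g = q}"
        then obtain g where g: "g \<in> carrier K" "act ?p g = q" "s = g \<otimes>\<^bsub>K\<^esub> inv\<^bsub>K\<^esub> h" by blast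
        then have "act ?p s = act (act ?p h) (inv\<^bsub>K\<^esub> h)" using h p by (simp add: act_mult)
        also have "\<dots> = ?p" using h p by (simp add: act_one flip: act_mult)
        finally show "s \<in> S" using g h by (simp add: S_def)
      qed
    qed
    then show ?thesis by (metis bij_betw_same_card)
  qed
  moreover have "card (carrier K) = (\<Sum>q\<in>orb ?p. card {g \<in> carrier K. act ?p g = q})"
    using sum.image_gen[OF finite_middle, of "\<lambda>_. 1::nat" "act ?p"] by (simp add: orb_def)
  ultimately show ?thesis unfolding S by simp
qed

text \<open>Each orbit is met once for every pair in it, which the factor 1 / |orbit| compensates.
  No representatives of orbits have to be chosen.\<close>

lemma sum_tensor:
  fixes f :: "('x \<times> 'y) set \<Rightarrow> rat"
  shows "(\<Sum>T\<in>carrier (biset_tensor K X Y). f T) = (\<Sum>p\<in>pairs. f (orb p) / of_nat (card (orb p)))"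
proof -
  have fin: "finite pairs" using X.finite_carrier Y.finite_carrier by simp
  have "(\<Sum>q\<in>{q \<in> pairs. orb q = T}. f (orb q) / of_nat (card (orb q))) = f T" if T: "T \<in> orb ` pairs" for T
  proof -
    obtain p where p: "p \<in> pairs" "T = orb p" using T by blast
    have "{q \<in> pairs. orb q = T} = T"
      unfolding p(2) using p(1) orb_eq_iff orb_subset by blast
    moreover have "(\<Sum>q\<in>{q \<in> pairs. orb q = T}. f (orb q) / of_nat (card (orb q)))
        = (\<Sum>q\<in>{q \<in> pairs. orb q = T}. f T / of_nat (card T))"
      by (rule sum.cong) auto
    ultimately show ?thesis using card_orb_pos[OF p(1)] p(2) by simp
  qed
  then show ?thesis
    unfolding carrier_tensor
    by (subst sum.image_gen[OF fin, of _ orb]) simp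
qed

text \<open>By \<open>card_orb\<close> the inverse orbit length is the order of the intersection of
  the inner kernels divided by the order of the middle group.\<close>

lemma biset_sum_tensor:
  "biset_sum G H w (biset_tensor K X Y) = (\<Sum>x\<in>carrier X. \<Sum>y\<in>carrier Y.
    of_nat (card (right_kernel G (biset_stab G K X x) \<inter> left_kernel H (biset_stab K H Y y)))
      * w (biset_stab G K X x O biset_stab K H Y y)) / of_nat (card (carrier K))"
proof -
  have *: "w (biset_stab G H (biset_tensor K X Y) (orb (x, y))) / of_nat (card (orb (x, y)))
      = of_nat (card (right_kernel G (biset_stab G K X x) \<inter> left_kernel H (biset_stab K H Y y)))
        * w (biset_stab G K X x O biset_stab K H Y y) / of_nat (card (carrier K))"
    if "x \<in> carrier X" "y \<in> carrier Y" for x y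
  proof -
    have "card (carrier K) > 0" using finite_middle by (auto simp: card_gt_0_iff)
    then show ?thesis
      unfolding stab_tensor[OF that] card_orb[OF that, symmetric]
      by (auto simp: field_simps)
  qed
  show ?thesis
    unfolding biset_sum_def sum_tensor sum_divide_distrib sum.cartesian_product
    by (rule sum.cong) (auto simp: *)
qed

text \<open>Right translation by a fixed element permutes the points, so a sum over them equals its
  average over all translations. This creates the average over conjugates that the product formula
  for weights requires.\<close>

lemma sum_average:
  fixes f :: "'x \<Rightarrow> rat"
  shows "(\<Sum>x\<in>carrier X. f x) = (\<Sum>x\<in>carrier X. \<Sum>g\<in>carrier K. f (ract X x g)) / of_nat (card (carrier K))"
proof -
  have "(\<Sum>x\<in>carrier X. f (ract X x g)) = (\<Sum>x\<in>carrier X. f x)" if g: "g \<in> carrier K" for g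
  proof (rule sum.reindex_bij_betw)
    show "bij_betw (\<lambda>x. ract X x g) (carrier X) (carrier X)"
      by (rule bij_betw_byWitness[where f' = "\<lambda>x. ract X x (inv\<^bsub>K\<^esub> g)"])
        (use g in \<open>auto simp: X.ract_cancel_inv X.ract_inv_cancel X.ract_closed\<close>)
  qed
  then have "(\<Sum>g\<in>carrier K. \<Sum>x\<in>carrier X. f (ract X x g)) = of_nat (card (carrier K)) * (\<Sum>x\<in>carrier X. f x)"
    by simp
  moreover have "card (carrier K) > 0" using finite_middle by (auto simp: card_gt_0_iff)
  ultimately show ?thesis by (subst sum.swap) simp
qed

end

text \<open>The product of the two isomorphisms commutes with the action of the middle group, so
  taking images maps orbits to orbits. This makes the tensor product well defined on
  classes.\<close>

lemma biset_tensor_isomorphic: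
  assumes "finite_biset G K X" "finite_biset K H Y"
    and "biset_isomorphic G K X X'" "biset_isomorphic K H Y Y'"
  shows "biset_isomorphic G H (biset_tensor K X Y) (biset_tensor K X' Y')"
proof -
  interpret X: finite_biset G K X by fact
  interpret Y: finite_biset K H Y by fact
  obtain f where f: "bij_betw f (carrier X) (carrier X')"
    "\<And>a x. a \<in> carrier G \<Longrightarrow> x \<in> carrier X \<Longrightarrow> f (lact X a x) = lact X' a (f x)"
    "\<And>x b. x \<in> carrier X \<Longrightarrow> b \<in> carrier K \<Longrightarrow> f (ract X x b) = ract X' (f x) b"
    using assms(3) by (rule biset_isomorphicE) blast
  obtain h where h: "bij_betw h (carrier Y) (carrier Y')"
    "\<And>a x. a \<in> carrier K \<Longrightarrow> x \<in> carrier Y \<Longrightarrow> h (lact Y a x) = lact Y' a (h x)"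
    "\<And>x b. x \<in> carrier Y \<Longrightarrow> b \<in> carrier H \<Longrightarrow> h (ract Y x b) = ract Y' (h x) b"
    using assms(4) by (rule biset_isomorphicE) blast
  have img: "carrier X' = f ` carrier X" "carrier Y' = h ` carrier Y"
    using f(1) h(1) by (auto simp: bij_betw_def)
  let ?o = "\<lambda>X Y (x, y). (\<lambda>g. (ract X x g, lact Y (inv\<^bsub>K\<^esub> g) y)) ` carrier K"
  have o: "?o X' Y' (f x, h y) = map_prod f h ` ?o X Y (x, y)" if "x \<in> carrier X" "y \<in> carrier Y" for x y
    using that by (auto simp: image_image f h)
  have sub: "?o X Y (x, y) \<subseteq> carrier X \<times> carrier Y" if "x \<in> carrier X" "y \<in> carrier Y" for x y
    using that by (auto simp: X.ract_closed Y.lact_closed)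
  have inj: "inj_on (map_prod f h) (carrier X \<times> carrier Y)"
    using f(1) h(1) by (auto simp: bij_betw_def intro: map_prod_inj_on)
  show ?thesis
  proof (rule biset_isomorphicI[of "(`) (map_prod f h)"])
    have "inj_on ((`) (map_prod f h)) (carrier (biset_tensor K X Y))"
      by (rule inj_on_subset[OF inj_on_image_Pow[OF inj]]) (use sub in \<open>auto simp: biset_tensor_def\<close>)
    moreover have "(`) (map_prod f h) ` carrier (biset_tensor K X Y) = carrier (biset_tensor K X' Y')"
    proof -
      have "(`) (map_prod f h) ` carrier (biset_tensor K X Y)
          = (\<lambda>p. map_prod f h ` ?o X Y p) ` (carrier X \<times> carrier Y)"
        by (simp add: biset_tensor_def image_image)
      also have "\<dots> = (\<lambda>p. ?o X' Y' (map_prod f h p)) ` (carrier X \<times> carrier Y)"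
        by (rule image_cong[OF refl]) (use o in \<open>auto simp only: map_prod_simp mem_Times_iff split_paired_all fst_conv snd_conv\<close>)
      also have "\<dots> = ?o X' Y' ` (map_prod f h ` (carrier X \<times> carrier Y))"
        by (simp only: image_image)
      also have "map_prod f h ` (carrier X \<times> carrier Y) = carrier X' \<times> carrier Y'"
        unfolding img by (rule map_prod_surj_on) (rule refl)+
      finally show ?thesis by (simp add: biset_tensor_def)
    qed
    ultimately show "bij_betw ((`) (map_prod f h)) (carrier (biset_tensor K X Y)) (carrier (biset_tensor K X' Y'))"
      by (simp add: bij_betw_def)
    show "map_prod f h ` lact (biset_tensor K X Y) a T = lact (biset_tensor K X' Y') a (map_prod f h ` T)"
      if "a \<in> carrier G" "T \<in> carrier (biset_tensor K X Y)" for a T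
    proof -
      have "T \<subseteq> carrier X \<times> carrier Y" using that(2) sub by (auto simp: biset_tensor_def)
      then show ?thesis using that(1) by (force simp: biset_tensor_def image_image f h)
    qed
    show "map_prod f h ` ract (biset_tensor K X Y) T b = ract (biset_tensor K X' Y') (map_prod f h ` T) b"
      if "T \<in> carrier (biset_tensor K X Y)" "b \<in> carrier H" for b T
    proof -
      have "T \<subseteq> carrier X \<times> carrier Y" using that(1) sub by (auto simp: biset_tensor_def)
      then show ?thesis using that(2) by (force simp: biset_tensor_def image_image f h)
    qed
  qed
qed

section \<open>Transitive bisets\<close>

lemma (in finite_biset) orbit_isomorphic_coset:
  assumes x: "x \<in> carrier X"
  shows "biset_isomorphic G H (X\<lparr>carrier := biset_orbit G H X x\<rparr>) (coset_biset G H (biset_stab G H X x))"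
proof -
  \<comment> \<open>The isomorphism sends y to the set of all (a, b) that carry x to y under x -> a
    x b^-1, which for y in the orbit is a left coset of the stabiliser.\<close>
  define k where "k y = {(a, b) \<in> carrier G \<times> carrier H. lact X a x = ract X y b}" for y
  let ?L = "biset_stab G H X x"
  interpret S: subgroup_DirProd G H ?L using x by (rule stab_subgroup)
  interpret P: group "G \<times>\<times> H" by (rule DirProd_group) unfold_locales
  have mem: "u \<in> v <#\<^bsub>G \<times>\<times> H\<^esub> C \<longleftrightarrow> inv\<^bsub>G \<times>\<times> H\<^esub> v \<otimes>\<^bsub>G \<times>\<times> H\<^esub> u \<in> C"
    if "u \<in> carrier (G \<times>\<times> H)" "v \<in> carrier (G \<times>\<times> H)" "C \<subseteq> carrier (G \<times>\<times> H)" for u v C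
  proof
    assume "u \<in> v <#\<^bsub>G \<times>\<times> H\<^esub> C"
    then obtain c where c: "c \<in> C" "u = v \<otimes>\<^bsub>G \<times>\<times> H\<^esub> c" by (auto simp: l_coset_def)
    then have "c \<in> carrier (G \<times>\<times> H)" using that by blast
    then have "inv\<^bsub>G \<times>\<times> H\<^esub> v \<otimes>\<^bsub>G \<times>\<times> H\<^esub> u = c"
      unfolding c(2) using that by (simp only: P.m_assoc[symmetric] P.l_inv P.l_one P.inv_closed)
    then show "inv\<^bsub>G \<times>\<times> H\<^esub> v \<otimes>\<^bsub>G \<times>\<times> H\<^esub> u \<in> C" using c by simp
  next
    assume c: "inv\<^bsub>G \<times>\<times> H\<^esub> v \<otimes>\<^bsub>G \<times>\<times> H\<^esub> u \<in> C"
    have "u = v \<otimes>\<^bsub>G \<times>\<times> H\<^esub> (inv\<^bsub>G \<times>\<times> H\<^esub> v \<otimes>\<^bsub>G \<times>\<times> H\<^esub> u)"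
      using that by (simp only: P.m_assoc[symmetric] P.r_inv P.l_one P.inv_closed)
    then show "u \<in> v <#\<^bsub>G \<times>\<times> H\<^esub> C" unfolding l_coset_def using c by blast
  qed
  have k_sub: "k y \<subseteq> carrier (G \<times>\<times> H)" for y by (auto simp: k_def)
  have k_lact: "k (lact X c y) = (c, \<one>\<^bsub>H\<^esub>) <#\<^bsub>G \<times>\<times> H\<^esub> k y" if cy: "c \<in> carrier G" "y \<in> carrier X" for c y
  proof -
    have "(a, b) \<in> k (lact X c y) \<longleftrightarrow> (a, b) \<in> (c, \<one>\<^bsub>H\<^esub>) <#\<^bsub>G \<times>\<times> H\<^esub> k y"
      if ab: "a \<in> carrier G" "b \<in> carrier H" for a b
    proof -
      have "lact X a x = lact X c (ract X y b) \<longleftrightarrow> lact X (inv\<^bsub>G\<^esub> c) (lact X a x) = ract X y b"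
        using ab cy x lact_eq_iff[of "inv\<^bsub>G\<^esub> c" "lact X a x" "ract X y b"]
        by (simp add: lact_closed ract_closed)
      then show ?thesis
        using ab cy x k_sub[of y]
        by (subst mem) (auto simp: k_def inv_DirProd[OF G.group_axioms H.group_axioms] act_commute lact_mult)
    qed
    moreover have "(c, \<one>\<^bsub>H\<^esub>) <#\<^bsub>G \<times>\<times> H\<^esub> k y \<subseteq> carrier (G \<times>\<times> H)"
      using cy k_sub by (intro P.l_coset_subset_G) auto
    ultimately show ?thesis using k_sub[of "lact X c y"] by auto
  qed
  have k_ract: "k (ract X y d) = (\<one>\<^bsub>G\<^esub>, inv\<^bsub>H\<^esub> d) <#\<^bsub>G \<times>\<times> H\<^esub> k y" if "d \<in> carrier H" "y \<in> carrier X" for d y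
  proof -
    have "(a, b) \<in> k (ract X y d) \<longleftrightarrow> (a, b) \<in> (\<one>\<^bsub>G\<^esub>, inv\<^bsub>H\<^esub> d) <#\<^bsub>G \<times>\<times> H\<^esub> k y"
      if ab: "a \<in> carrier G" "b \<in> carrier H" for a b
      using ab that x k_sub[of y] \<open>d \<in> carrier H\<close> \<open>y \<in> carrier X\<close>
      by (subst mem) (auto simp: k_def inv_DirProd[OF G.group_axioms H.group_axioms] ract_mult)
    moreover have "(\<one>\<^bsub>G\<^esub>, inv\<^bsub>H\<^esub> d) <#\<^bsub>G \<times>\<times> H\<^esub> k y \<subseteq> carrier (G \<times>\<times> H)"
      using that k_sub by (intro P.l_coset_subset_G) auto
    ultimately show ?thesis using k_sub[of "ract X y d"] by auto
  qed
  have kx: "k x = ?L" by (simp add: k_def biset_stab_def)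
  have k_orbit: "k (lact X c (ract X x d)) = (c, inv\<^bsub>H\<^esub> d) <#\<^bsub>G \<times>\<times> H\<^esub> ?L"
    if "c \<in> carrier G" "d \<in> carrier H" for c d
    using that x P.lcos_m_assoc[of ?L "(c, \<one>\<^bsub>H\<^esub>)" "(\<one>\<^bsub>G\<^esub>, inv\<^bsub>H\<^esub> d)"] S.subset
    by (simp add: k_lact k_ract kx ract_closed)
  show ?thesis
  proof (rule biset_isomorphicI[of k])
    have "inj_on k (biset_orbit G H X x)"
    proof (rule inj_onI)
      fix y z assume y: "y \<in> biset_orbit G H X x" and z: "z \<in> biset_orbit G H X x" and eq: "k y = k z"
      then obtain c d where cd: "c \<in> carrier G" "d \<in> carrier H" "y = lact X c (ract X x d)"
        by (auto simp: biset_orbit_def)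
      have yz: "y \<in> carrier X" "z \<in> carrier X" using y z orbit_subset[OF x] by blast+
      have cx: "lact X c x = ract X y (inv\<^bsub>H\<^esub> d)"
        using cd x by (simp add: act_commute ract_closed lact_closed ract_cancel_inv)
      then have "(c, inv\<^bsub>H\<^esub> d) \<in> k y" using cd by (simp add: k_def)
      then have "lact X c x = ract X z (inv\<^bsub>H\<^esub> d)" unfolding eq by (simp add: k_def)
      with cx have "ract X y (inv\<^bsub>H\<^esub> d) = ract X z (inv\<^bsub>H\<^esub> d)" by simp
      then show "y = z" using cd yz ract_inv_cancel by metis
    qed
    moreover have "k ` biset_orbit G H X x = lcosets\<^bsub>G \<times>\<times> H\<^esub> ?L"
    proof
      show "k ` biset_orbit G H X x \<subseteq> lcosets\<^bsub>G \<times>\<times> H\<^esub> ?L"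
      proof
        fix C assume "C \<in> k ` biset_orbit G H X x"
        then obtain c d where cd: "c \<in> carrier G" "d \<in> carrier H" "C = k (lact X c (ract X x d))"
          by (auto simp: biset_orbit_def)
        then have "(c, inv\<^bsub>H\<^esub> d) \<in> carrier (G \<times>\<times> H)" "C = (c, inv\<^bsub>H\<^esub> d) <#\<^bsub>G \<times>\<times> H\<^esub> ?L"
          by (simp_all add: k_orbit)
        then show "C \<in> lcosets\<^bsub>G \<times>\<times> H\<^esub> ?L" unfolding LCOSETS_def by blast
      qed
      show "lcosets\<^bsub>G \<times>\<times> H\<^esub> ?L \<subseteq> k ` biset_orbit G H X x"
      proof
        fix C assume "C \<in> lcosets\<^bsub>G \<times>\<times> H\<^esub> ?L"
        then obtain c d where cd: "c \<in> carrier G" "d \<in> carrier H" "C = (c, d) <#\<^bsub>G \<times>\<times> H\<^esub> ?L"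
          by (auto simp: LCOSETS_def)
        then have "C = k (lact X c (ract X x (inv\<^bsub>H\<^esub> d)))" by (simp add: k_orbit)
        moreover have "lact X c (ract X x (inv\<^bsub>H\<^esub> d)) \<in> biset_orbit G H X x"
          unfolding biset_orbit_def using cd by (intro image_eqI[of _ _ "(c, inv\<^bsub>H\<^esub> d)"]) auto
        ultimately show "C \<in> k ` biset_orbit G H X x" by (simp only: imageI)
      qed
    qed
    ultimately show "bij_betw k (carrier (X\<lparr>carrier := biset_orbit G H X x\<rparr>)) (carrier (coset_biset G H ?L))"
      by (simp add: bij_betw_def coset_biset_def)
  qed (use orbit_subset[OF x] in \<open>auto simp: coset_biset_def k_lact k_ract\<close>)
qed

lemma biset_stab_coset:
  assumes "group G" "group H" and L: "subgroup L (G \<times>\<times> H)"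
  shows "biset_stab G H (coset_biset G H L) L = L"
proof -
  interpret G: group G by fact
  interpret H: group H by fact
  interpret P: group "G \<times>\<times> H" by (rule DirProd_group) unfold_locales
  have L': "L \<subseteq> carrier (G \<times>\<times> H)" using L by (rule subgroup.subset)
  have "(a, \<one>\<^bsub>H\<^esub>) <#\<^bsub>G \<times>\<times> H\<^esub> L = (\<one>\<^bsub>G\<^esub>, inv\<^bsub>H\<^esub> b) <#\<^bsub>G \<times>\<times> H\<^esub> L \<longleftrightarrow> (a, b) \<in> L"
    if "a \<in> carrier G" "b \<in> carrier H" for a b
  proof
    assume eq: "(a, \<one>\<^bsub>H\<^esub>) <#\<^bsub>G \<times>\<times> H\<^esub> L = (\<one>\<^bsub>G\<^esub>, inv\<^bsub>H\<^esub> b) <#\<^bsub>G \<times>\<times> H\<^esub> L"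
    have "(a, \<one>\<^bsub>H\<^esub>) \<in> (a, \<one>\<^bsub>H\<^esub>) <#\<^bsub>G \<times>\<times> H\<^esub> L"
      using that L by (intro P.lcos_self) auto
    then obtain l m where "(l, m) \<in> L" "a = \<one>\<^bsub>G\<^esub> \<otimes>\<^bsub>G\<^esub> l" "\<one>\<^bsub>H\<^esub> = inv\<^bsub>H\<^esub> b \<otimes>\<^bsub>H\<^esub> m"
      unfolding eq by (auto simp: l_coset_def)
    moreover from this have "l \<in> carrier G" "m \<in> carrier H" using L' by auto
    moreover from calculation have "m = b" using that by (metis H.inv_closed H.inv_equality H.inv_inv H.inv_comm)
    ultimately show "(a, b) \<in> L" by simp
  next
    assume ab: "(a, b) \<in> L"
    have "(a, \<one>\<^bsub>H\<^esub>) = (\<one>\<^bsub>G\<^esub>, inv\<^bsub>H\<^esub> b) \<otimes>\<^bsub>G \<times>\<times> H\<^esub> (a, b)" using that by simp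
    then have "(a, \<one>\<^bsub>H\<^esub>) <#\<^bsub>G \<times>\<times> H\<^esub> L = (\<one>\<^bsub>G\<^esub>, inv\<^bsub>H\<^esub> b) <#\<^bsub>G \<times>\<times> H\<^esub> ((a, b) <#\<^bsub>G \<times>\<times> H\<^esub> L)"
      using that L' by (subst P.lcos_m_assoc) auto
    also have "(a, b) <#\<^bsub>G \<times>\<times> H\<^esub> L = L"
      using ab L subgroup.subset[OF L] by (intro P.coset_join3) auto
    finally show "(a, \<one>\<^bsub>H\<^esub>) <#\<^bsub>G \<times>\<times> H\<^esub> L = (\<one>\<^bsub>G\<^esub>, inv\<^bsub>H\<^esub> b) <#\<^bsub>G \<times>\<times> H\<^esub> L" .
  qed
  then show ?thesis
    using L' by (auto simp: biset_stab_def coset_biset_def)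
qed

text \<open>All points have conjugate stabilisers, hence equal weight, and Lagrange gives their
  number as |G| |H| / |L|; the equation is kept free of division.\<close>

lemma biset_sum_coset:
  assumes "group G" "group H" "finite (carrier G)" "finite (carrier H)" and L: "subgroup L (G \<times>\<times> H)"
    and inv: "\<And>c g. c \<in> carrier G \<Longrightarrow> g \<in> carrier H \<Longrightarrow> w (conj_subgroup G H c g L) = w L"
  shows "of_nat (card L) * biset_sum G H w (coset_biset G H L) = of_nat (card (carrier G) * card (carrier H)) * w L"
proof -
  interpret G: group G by fact
  interpret H: group H by fact
  interpret P: group "G \<times>\<times> H" by (rule DirProd_group) unfold_locales
  interpret C: finite_biset G H "coset_biset G H L" using assms(1-5) by (rule finite_biset_coset)
  have L': "L \<subseteq> carrier (G \<times>\<times> H)" using L by (rule subgroup.subset)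
  have L_in: "L \<in> carrier (coset_biset G H L)"
    unfolding coset_biset_def LCOSETS_def
    using P.lcos_mult_one[OF L'] P.one_closed by (auto intro!: bexI[of _ "\<one>\<^bsub>G\<^esub>"] bexI[of _ "\<one>\<^bsub>H\<^esub>"])
  have "w (biset_stab G H (coset_biset G H L) C) = w L" if C: "C \<in> carrier (coset_biset G H L)" for C
  proof -
    obtain c d where cd: "c \<in> carrier G" "d \<in> carrier H" "C = (c, d) <#\<^bsub>G \<times>\<times> H\<^esub> L"
      using C by (auto simp: coset_biset_def LCOSETS_def)
    then have "C = lact (coset_biset G H L) c (ract (coset_biset G H L) L (inv\<^bsub>H\<^esub> d))"
      using L' by (simp add: coset_biset_def P.lcos_m_assoc)
    then show ?thesis
      using C.stab_move[OF L_in, of c "inv\<^bsub>H\<^esub> d"] cd inv by (simp add: biset_stab_coset[OF assms(1,2) L])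
  qed
  then have "biset_sum G H w (coset_biset G H L) = of_nat (card (lcosets\<^bsub>G \<times>\<times> H\<^esub> L)) * w L"
    unfolding biset_sum_def by (simp add: coset_biset_def)
  moreover have "card (lcosets\<^bsub>G \<times>\<times> H\<^esub> L) * card L = card (carrier G) * card (carrier H)"
    using P.l_lagrange[OF _ L] assms(3,4) by (simp add: Coset.order_def card_cartesian_product)
  ultimately show ?thesis by (metis (no_types) mult.assoc mult.commute of_nat_mult)
qed

section \<open>Subgroups of the same type are conjugate\<close>

text \<open>The conjugate is the stabiliser of a translate of the base point of the coset biset, and
  stabilisers are subgroups.\<close>

lemma subgroup_conj_subgroup:
  assumes "group G" "group H" "finite (carrier G)" "finite (carrier H)" and L: "subgroup L (G \<times>\<times> H)"
    and "c \<in> carrier G" "g \<in> carrier H"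
  shows "subgroup (conj_subgroup G H c g L) (G \<times>\<times> H)"
proof -
  interpret G: group G by fact
  interpret H: group H by fact
  interpret P: group "G \<times>\<times> H" by (rule DirProd_group) unfold_locales
  interpret C: finite_biset G H "coset_biset G H L" using assms(1-5) by (rule finite_biset_coset)
  have "L \<subseteq> carrier (G \<times>\<times> H)" using L by (rule subgroup.subset)
  then have L_in: "L \<in> carrier (coset_biset G H L)"
    unfolding coset_biset_def LCOSETS_def
    using P.lcos_mult_one P.one_closed by (auto intro!: bexI[of _ "\<one>\<^bsub>G\<^esub>"] bexI[of _ "\<one>\<^bsub>H\<^esub>"])
  show ?thesis
    using C.stab_move[OF L_in assms(6,7)] C.stab_subgroup[OF C.lact_closed[OF assms(6) C.ract_closed[OF L_in assms(7)]]]
    by (simp add: biset_stab_coset[OF assms(1,2) L] subgroup_DirProd_def subgroup_DirProd_axioms_def)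
qed

lemma finite_S3: "finite (carrier S3)"
  by (simp add: carrier_S3)

lemma S3_conj_subgroup:
  "S3_subgroup D \<Longrightarrow> c \<in> carrier S3 \<Longrightarrow> g \<in> carrier S3 \<Longrightarrow> S3_subgroup (conj_subgroup S3 S3 c g D)"
  unfolding S3_subgroup_iff
  by (rule subgroup_conj_subgroup[OF S3.group_axioms S3.group_axioms finite_S3 finite_S3])

text \<open>The factors appear in opposite orders in the two slots because one action is on the left
  and the other on the right.\<close>

lemma conj_subgroup_comp:
  assumes "group G" "group H" "c \<in> carrier G" "c' \<in> carrier G" "g \<in> carrier H" "g' \<in> carrier H"
  shows "conj_subgroup G H c' g' (conj_subgroup G H c g D)
    = conj_subgroup G H (c' \<otimes>\<^bsub>G\<^esub> c) (g \<otimes>\<^bsub>H\<^esub> g') D"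
proof -
  interpret G: group G by fact
  interpret H: group H by fact
  show ?thesis
    using assms(3-) by (auto simp: conj_subgroup_def G.inv_mult_group H.inv_mult_group G.m_assoc H.m_assoc)
qed

text \<open>For order 2 the set of conjugating elements has two members; for every other order the
  subgroup is unique and the identity serves.\<close>

lemma S3_conj_eq:
  assumes A: "subgroup A S3" and B: "subgroup B S3" and card: "card A = card B"
  shows "\<exists>g\<in>carrier S3. {b \<in> carrier S3. g \<circ> b \<circ> inv\<^bsub>S3\<^esub> g \<in> A} = B"
proof (cases "card A = 2")
  case True
  have "card {g \<in> carrier S3. {b \<in> carrier S3. g \<circ> b \<circ> inv\<^bsub>S3\<^esub> g \<in> A} = B} \<noteq> 0"
    using card_conjugators_S3[OF A B True] True card by simp
  then show ?thesis by (metis (mono_tags, lifting) card.empty empty_Collect_eq)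
next
  case False
  then have "A = B"
    using S3_subgroup_cases[OF A] S3_subgroup_cases[OF B] card by (elim disjE) simp_all
  moreover have "{b \<in> carrier S3. id \<circ> b \<circ> inv\<^bsub>S3\<^esub> id \<in> A} = A"
    using subgroup.subset[OF A] by (simp add: Collect_conj_eq Int_absorb1)
  ultimately show ?thesis using S3.one_closed unfolding S3_simps by blast
qed

text \<open>Inside a common projection \<open>P\<close>, kernels of order 2 both equal
  \<open>P\<close>; subgroups of any other order are unique in S_3.\<close>

lemma S3_normal_unique:
  assumes "subgroup K S3" "subgroup K' S3" "card K = card K'" "card K = 2 \<Longrightarrow> K = P" "card K' = 2 \<Longrightarrow> K' = P"
  shows "K = K'"
proof (cases "card K = 2")
  case True
  then show ?thesis using assms(3-5) by simp
next
  case False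
  then show ?thesis
    using S3_subgroup_cases[OF assms(1)] S3_subgroup_cases[OF assms(2)] assms(3) by (elim disjE) simp_all
qed

context S3_subgroup
begin

lemma kernel_iff:
  assumes "(a, b) \<in> D"
  shows "a \<in> left_kernel S3 D \<longleftrightarrow> b \<in> right_kernel S3 D"
proof -
  note ab = carrierD[OF assms]
  have "(id, b) \<in> D" if "(a, id) \<in> D"
    using mult[OF inverse[OF that] assms] ab S3.l_inv[OF ab(1)] S3.inv_one unfolding S3_simps by simp
  moreover have "(a, id) \<in> D" if "(id, b) \<in> D"
    using mult[OF inverse[OF that] assms] ab S3.l_inv[OF ab(2)] S3.inv_one unfolding S3_simps by simp
  ultimately show ?thesis by (auto simp: left_kernel_def right_kernel_def)
qed

text \<open>A group of order at most 2 has only the trivial automorphism, so the sections determine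
  the subgroup. Formally \<open>D\<close> lies in the displayed set and both have |P_1| |K_2|
  elements, since index at most 2 gives |K_1| |K_2| + (|P_1| - |K_1|) (|P_2| - |K_2|) this
  value.\<close>

lemma eq_of_index_le_2:
  assumes idx: "card (fst ` D) \<le> 2 * card (left_kernel S3 D)"
  shows "D = {(a, b) \<in> fst ` D \<times> snd ` D. a \<in> left_kernel S3 D \<longleftrightarrow> b \<in> right_kernel S3 D}" (is "D = ?T")
proof (rule card_subset_eq)
  let ?P1 = "fst ` D" and ?K1 = "left_kernel S3 D" and ?P2 = "snd ` D" and ?K2 = "right_kernel S3 D"
  have fin: "finite ?P1" "finite ?P2" using finite by auto
  have finK: "finite ?K1" "finite ?K2"
    using fin left_kernel_subset[of S3 D] right_kernel_subset[of S3 D] finite_subset by blast+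
  have "?T = ?K1 \<times> ?K2 \<union> (?P1 - ?K1) \<times> (?P2 - ?K2)"
    using left_kernel_subset[of S3 D] right_kernel_subset[of S3 D] by auto
  moreover have "card (?K1 \<times> ?K2 \<union> (?P1 - ?K1) \<times> (?P2 - ?K2))
      = card ?K1 * card ?K2 + (card ?P1 - card ?K1) * (card ?P2 - card ?K2)"
    using fin finK left_kernel_subset[of S3 D] right_kernel_subset[of S3 D]
    by (subst card_Un_disjoint) (auto simp: card_cartesian_product card_Diff_subset)
  moreover have "card ?K1 * card ?K2 + (card ?P1 - card ?K1) * (card ?P2 - card ?K2) = card ?P1 * card ?K2"
  proof -
    have "card ?P1 * card ?K2 = card ?P2 * card ?K1" using card_fst card_snd finite by simp
    then show ?thesis
      using sections(1,3) idx by (elim insertE emptyE Pair_inject) simp_all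
  qed
  ultimately show "card D = card ?T" using card_fst finite by simp
  show "finite ?T" using fin by (intro finite_subset[of ?T "?P1 \<times> ?P2"]) auto
  show "D \<subseteq> ?T"
  proof
    fix z assume z: "z \<in> D"
    obtain a b where ab: "z = (a, b)" by (cases z)
    with z have "a \<in> ?P1" "b \<in> ?P2" by force+
    then show "z \<in> ?T" using kernel_iff z ab by blast
  qed
qed

lemma trivial_kernels:
  assumes "card (left_kernel S3 D) = 1" "card (right_kernel S3 D) = 1" "(a, b) \<in> D"
  shows "a = id \<longleftrightarrow> b = id"
proof -
  have "id \<in> left_kernel S3 D" "id \<in> right_kernel S3 D"
    using one unfolding S3_simps by (auto simp: left_kernel_def right_kernel_def)
  with assms(1,2) have "left_kernel S3 D = {id}" "right_kernel S3 D = {id}"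
    by (auto simp: card_1_singleton_iff)
  then show ?thesis using kernel_iff[OF assms(3)] by simp
qed

lemma comp: "(a, b) \<in> D \<Longrightarrow> (c, d) \<in> D \<Longrightarrow> (a \<circ> c, b \<circ> d) \<in> D"
  using mult unfolding S3_simps .

lemma id_in: "(id, id) \<in> D"
  using one unfolding S3_simps .

lemma order_3_eq:
  assumes "card (fst ` D) = 3" "card (right_kernel S3 D) = 1" "(r3, y) \<in> D"
  shows "D = {(id, id), (r3, y), (s3, y \<circ> y)}"
proof (rule card_subset_eq[symmetric])
  show "{(id, id), (r3, y), (s3, y \<circ> y)} \<subseteq> D"
    using comp[OF assms(3) assms(3)] id_in assms(3) by simp
  show "card {(id, id), (r3, y), (s3, y \<circ> y)} = card D"
    using card_fst[OF finite] assms(1,2) by simp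
qed (rule finite)

text \<open>Here \<open>D\<close> is the graph of a homomorphism on S_3, fixed by its values on the
  generators \<open>t12\<close> and \<open>t13\<close>: r_3 = t13 t12, s_3 = t12 t13 and t23 = t12
  r_3 give the remaining pairs.\<close>

lemma order_6_eq:
  assumes "card (fst ` D) = 6" "card (right_kernel S3 D) = 1" "(t12, y) \<in> D" "(t13, z) \<in> D"
  shows "D = {(id, id), (t12, y), (t13, z), (t23, y \<circ> (z \<circ> y)), (r3, z \<circ> y), (s3, y \<circ> z)}"
proof (rule card_subset_eq[symmetric])
  have "(r3, z \<circ> y) \<in> D" "(s3, y \<circ> z) \<in> D"
    using comp[OF assms(4,3)] comp[OF assms(3,4)] by simp_all
  moreover from this(1) have "(t23, y \<circ> (z \<circ> y)) \<in> D"
    using comp[OF assms(3)] by fastforce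
  ultimately show "{(id, id), (t12, y), (t13, z), (t23, y \<circ> (z \<circ> y)), (r3, z \<circ> y), (s3, y \<circ> z)} \<subseteq> D"
    using id_in assms(3,4) by simp
  show "card {(id, id), (t12, y), (t13, z), (t23, y \<circ> (z \<circ> y)), (r3, z \<circ> y), (s3, y \<circ> z)} = card D"
    using card_fst[OF finite] assms(1,2) by simp
qed (rule finite)

lemma order_3_image:
  assumes "card (fst ` D) = 3" "card (snd ` D) = 3" "card (left_kernel S3 D) = 1" "card (right_kernel S3 D) = 1"
  obtains y where "y \<in> {r3, s3}" "(r3, y) \<in> D"
proof -
  have P: "fst ` D = {id, r3, s3}" "snd ` D = {id, r3, s3}"
    using S3_subgroup_cases[OF subgroup_fst] S3_subgroup_cases[OF subgroup_snd] assms(1,2)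
    by (elim disjE; simp)+
  then obtain y where y: "(r3, y) \<in> D" unfolding fst_eq_Domain by blast
  then have "y \<in> snd ` D" by force
  moreover have "y \<noteq> id" using trivial_kernels[OF assms(3,4) y] by simp
  ultimately have "y \<in> {r3, s3}" unfolding P(2) by simp
  then show thesis using y by (rule that)
qed

lemma order_6_image:
  assumes "card (fst ` D) = 6" "card (left_kernel S3 D) = 1" "card (right_kernel S3 D) = 1"
  obtains y z where "y \<in> {t12, t13, t23}" "z \<in> {t12, t13, t23}" "y \<noteq> z" "(t12, y) \<in> D" "(t13, z) \<in> D"
proof -
  have P: "fst ` D = {id, t12, t13, t23, r3, s3}"
    using S3_subgroup_cases[OF subgroup_fst] assms(1) by (elim disjE) simp_all
  then obtain y z where yz: "(t12, y) \<in> D" "(t13, z) \<in> D" unfolding fst_eq_Domain by blast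
  have inv: "y \<in> {t12, t13, t23}" if "(x, y) \<in> D" "x \<circ> x = id" "x \<noteq> id" for x y
  proof -
    have "(id, y \<circ> y) \<in> D" using comp[OF that(1,1)] that(2) by simp
    then have "y \<circ> y = id" using trivial_kernels[OF assms(2,3)] by blast
    moreover have "y \<noteq> id" using trivial_kernels[OF assms(2,3) that(1)] that(3) by simp
    moreover have "y \<in> {id, t12, t13, t23, r3, s3}" using carrierD(2)[OF that(1)] unfolding carrier_S3 .
    ultimately show ?thesis by (elim insertE emptyE) simp_all
  qed
  \<comment> \<open>If both generators had the same image y, their product \<open>s3\<close> would
    be paired with y y = id, contrary to the trivial kernels.\<close>
  have "y \<noteq> z"
  proof
    assume "y = z"
    then have "(s3, y \<circ> y) \<in> D" using comp[OF yz] by simp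
    moreover have "y \<circ> y = id" using inv[OF yz(1)] by auto
    ultimately show False using trivial_kernels[OF assms(2,3)] by fastforce
  qed
  then show thesis using that yz inv[OF yz(1)] inv[OF yz(2)] by simp
qed

lemma conj_right_mem:
  assumes "h \<in> carrier S3" "a \<in> carrier S3" "b \<in> carrier S3" "(a, h \<circ> b \<circ> inv\<^bsub>S3\<^esub> h) \<in> D"
  shows "(a, b) \<in> conj_subgroup S3 S3 id h D"
  using assms by (simp add: conj_subgroup_def)

end

text \<open>Two isomorphisms between the same sections differ by an automorphism of the quotient,
  and each such automorphism comes from conjugation in S_3: there is none but the identity for index
  at most 2, inversion of the group of order 3 comes from a transposition, and all automorphisms of
  S_3 are inner.\<close>

lemma S3_conj_same_sections:
  assumes N: "S3_subgroup N" and M: "S3_subgroup M"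
    and P: "fst ` N = fst ` M" "snd ` N = snd ` M"
    and K: "left_kernel S3 N = left_kernel S3 M" "right_kernel S3 N = right_kernel S3 M"
  shows "\<exists>h\<in>carrier S3. conj_subgroup S3 S3 id h N = M"
proof -
  interpret N: S3_subgroup N by fact
  interpret M: S3_subgroup M by fact
  have conj: "card (fst ` conj_subgroup S3 S3 id h N) = card (fst ` N)"
      "card (right_kernel S3 (conj_subgroup S3 S3 id h N)) = card (right_kernel S3 N)"
      "S3_subgroup (conj_subgroup S3 S3 id h N)" if "h \<in> carrier S3" for h
    using N.conj_subgroup_cards(1,4)[OF S3.one_closed that] S3_conj_subgroup[OF N S3.one_closed that]
    unfolding S3_simps by simp_all
  have "card (fst ` N) * card (right_kernel S3 N) = card (snd ` N) * card (left_kernel S3 N)"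
    using N.card_fst N.card_snd N.finite by simp
  then consider "card (fst ` N) \<le> 2 * card (left_kernel S3 N)"
    | "card (fst ` N) = 3" "card (snd ` N) = 3" "card (left_kernel S3 N) = 1" "card (right_kernel S3 N) = 1"
    | "card (fst ` N) = 6" "card (left_kernel S3 N) = 1" "card (right_kernel S3 N) = 1"
    using N.sections(1,3) by (elim insertE emptyE Pair_inject) simp_all
  then show ?thesis
  proof cases
    case 1
    have "N = M"
      using N.eq_of_index_le_2[OF 1] M.eq_of_index_le_2 1 unfolding P K by simp
    moreover have "conj_subgroup S3 S3 id id N = N"
      using N.subset by (auto simp: conj_subgroup_def)
    ultimately show ?thesis using S3.one_closed unfolding S3_simps by metis
  next
    case 2
    obtain y where y: "y \<in> {r3, s3}" "(r3, y) \<in> N" using 2 by (rule N.order_3_image)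
    obtain y' where y': "y' \<in> {r3, s3}" "(r3, y') \<in> M"
      using 2 unfolding P K by (rule M.order_3_image)
    \<comment> \<open>The identity works if y = y'; otherwise every transposition interchanges the
      two 3-cycles.\<close>
    have "\<exists>h\<in>carrier S3. h \<circ> y' \<circ> inv\<^bsub>S3\<^esub> h = y"
      using y(1) y'(1) unfolding carrier_S3 by (elim insertE emptyE) simp_all
    then obtain h where h: "h \<in> carrier S3" "h \<circ> y' \<circ> inv\<^bsub>S3\<^esub> h = y" by blast
    have "y' \<in> carrier S3" using M.carrierD(2)[OF y'(2)] .
    then have mem: "(r3, y') \<in> conj_subgroup S3 S3 id h N"
      using h y(2) by (intro N.conj_right_mem) (simp_all add: carrier_S3)
    interpret C: S3_subgroup "conj_subgroup S3 S3 id h N" using h(1) by (rule conj)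
    have "conj_subgroup S3 S3 id h N = M"
      using C.order_3_eq[OF _ _ mem] M.order_3_eq[OF _ _ y'(2)] conj[OF h(1)] 2 P K by simp
    then show ?thesis using h(1) by blast
  next
    case 3
    obtain y z where y: "y \<in> {t12, t13, t23}" "z \<in> {t12, t13, t23}" "y \<noteq> z" "(t12, y) \<in> N" "(t13, z) \<in> N"
      using 3 by (rule N.order_6_image)
    obtain y' z' where y': "y' \<in> {t12, t13, t23}" "z' \<in> {t12, t13, t23}" "y' \<noteq> z'" "(t12, y') \<in> M" "(t13, z') \<in> M"
      using 3 unfolding P K by (rule M.order_6_image)
    \<comment> \<open>S_3 permutes its three transpositions by conjugation in all possible ways, so
      any ordered pair of distinct transpositions can be moved to any other.\<close>
    have "\<exists>h\<in>carrier S3. h \<circ> y' \<circ> inv\<^bsub>S3\<^esub> h = y \<and> h \<circ> z' \<circ> inv\<^bsub>S3\<^esub> h = z"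
      using y(1-3) y'(1-3) unfolding carrier_S3 by (elim insertE emptyE) simp_all
    then obtain h where h: "h \<in> carrier S3" "h \<circ> y' \<circ> inv\<^bsub>S3\<^esub> h = y" "h \<circ> z' \<circ> inv\<^bsub>S3\<^esub> h = z" by blast
    have t: "t12 \<in> carrier S3" "t13 \<in> carrier S3" by (simp_all add: carrier_S3)
    have mem: "(t12, y') \<in> conj_subgroup S3 S3 id h N" "(t13, z') \<in> conj_subgroup S3 S3 id h N"
      by (rule N.conj_right_mem[OF h(1) t(1) M.carrierD(2)[OF y'(4)]], simp only: h(2) y(4))
        (rule N.conj_right_mem[OF h(1) t(2) M.carrierD(2)[OF y'(5)]], simp only: h(3) y(5))
    interpret C: S3_subgroup "conj_subgroup S3 S3 id h N" using h(1) by (rule conj)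
    have "conj_subgroup S3 S3 id h N = M"
      using C.order_6_eq[OF _ _ mem] M.order_6_eq[OF _ _ y'(4,5)] conj[OF h(1)] 3 P K by simp
    then show ?thesis using h(1) by blast
  qed
qed

text \<open>The projections are aligned by independent conjugations of the two slots. Equal orders
  then force equal kernels, and a further conjugation of the second slot adjusts the
  isomorphism.\<close>

lemma S3_conjugate_of_same_type:
  assumes L: "S3_subgroup L" and M: "S3_subgroup M" and type: "subgroup_type L = subgroup_type M"
  shows "\<exists>c\<in>carrier S3. \<exists>g\<in>carrier S3. conj_subgroup S3 S3 c g L = M"
proof -
  interpret L: S3_subgroup L by fact
  interpret M: S3_subgroup M by fact
  have card: "card (fst ` L) = card (fst ` M)" "card (snd ` L) = card (snd ` M)"
    "card (left_kernel S3 L) = card (left_kernel S3 M)" "card (right_kernel S3 L) = card (right_kernel S3 M)"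
    using type by (simp_all add: subgroup_type_def)
  obtain c where c: "c \<in> carrier S3" "{b \<in> carrier S3. c \<circ> b \<circ> inv\<^bsub>S3\<^esub> c \<in> fst ` L} = fst ` M"
    using S3_conj_eq[OF L.subgroup_fst M.subgroup_fst card(1)] by blast
  obtain g where g: "g \<in> carrier S3" "{b \<in> carrier S3. g \<circ> b \<circ> inv\<^bsub>S3\<^esub> g \<in> snd ` L} = snd ` M"
    using S3_conj_eq[OF L.subgroup_snd M.subgroup_snd card(2)] by blast
  have ic: "inv\<^bsub>S3\<^esub> c \<in> carrier S3" using c(1) by (rule S3.inv_closed)
  \<comment> \<open>The inverse appears because \<open>conj_subgroup\<close> takes preimages under a
    -> c^-1 a c in the first slot, whereas \<open>c\<close> was obtained for a -> c a c^-1.\<close>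
  define N where "N = conj_subgroup S3 S3 (inv\<^bsub>S3\<^esub> c) g L"
  have SN: "S3_subgroup N" unfolding N_def using L ic g(1) by (rule S3_conj_subgroup)
  interpret N: S3_subgroup N by (rule SN)
  have P: "fst ` N = fst ` M" "snd ` N = snd ` M"
    using L.conj_subgroup_projections(1,2)[OF ic g(1)] c g unfolding N_def S3_simps S3.inv_inv[OF c(1)]
    by simp_all
  have cardN: "card (left_kernel S3 N) = card (left_kernel S3 M)" "card (right_kernel S3 N) = card (right_kernel S3 M)"
    using L.conj_subgroup_cards[OF ic g(1)] card unfolding N_def by simp_all
  have K: "left_kernel S3 N = left_kernel S3 M"
    using N.subgroup_left_kernel M.subgroup_left_kernel cardN(1) N.sections(2)[unfolded P] M.sections(2)
    by (rule S3_normal_unique)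
  have K': "right_kernel S3 N = right_kernel S3 M"
    using N.subgroup_right_kernel M.subgroup_right_kernel cardN(2) N.sections(4)[unfolded P] M.sections(4)
    by (rule S3_normal_unique)
  obtain h where h: "h \<in> carrier S3" "conj_subgroup S3 S3 id h N = M"
    using S3_conj_same_sections[OF SN M P K K'] by blast
  show ?thesis
  proof (intro bexI)
    show "conj_subgroup S3 S3 (\<one>\<^bsub>S3\<^esub> \<otimes>\<^bsub>S3\<^esub> inv\<^bsub>S3\<^esub> c) (g \<otimes>\<^bsub>S3\<^esub> h) L = M"
      using h(2)
      unfolding N_def conj_subgroup_comp[OF S3.group_axioms S3.group_axioms ic S3.one_closed g(1) h(1), symmetric]
      unfolding S3_simps .
  qed (intro S3.m_closed S3.one_closed ic g(1) h(1))+
qed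

section \<open>Quotients of free abelian groups with rational coordinates\<close>

text \<open>This is the additive extension of \<open>f\<close> from generators to the free abelian
  group, with rational values.\<close>

definition frag_value :: "('a \<Rightarrow> rat) \<Rightarrow> ('a \<Rightarrow>\<^sub>0 int) \<Rightarrow> rat" where
  "frag_value f u = (\<Sum>a\<in>Poly_Mapping.keys u. of_int (Poly_Mapping.lookup u a) * f a)"

lemma frag_value_superset:
  assumes "finite A" "Poly_Mapping.keys u \<subseteq> A"
  shows "frag_value f u = (\<Sum>a\<in>A. of_int (Poly_Mapping.lookup u a) * f a)"
  unfolding frag_value_def using assms by (intro sum.mono_neutral_left) (auto simp: in_keys_iff)

lemma frag_value_diff: "frag_value f (u - v) = frag_value f u - frag_value f v"
proof -
  let ?A = "Poly_Mapping.keys u \<union> Poly_Mapping.keys v"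
  have "frag_value f (u - v) = (\<Sum>a\<in>?A. of_int (Poly_Mapping.lookup (u - v) a) * f a)"
    using keys_diff[of u v] by (intro frag_value_superset) auto
  then show ?thesis
    using frag_value_superset[of ?A u f] frag_value_superset[of ?A v f]
    by (simp add: lookup_minus algebra_simps sum_subtractf)
qed

lemma frag_value_0 [simp]: "frag_value f 0 = 0"
  by (simp add: frag_value_def)

lemma frag_value_minus: "frag_value f (- u) = - frag_value f u"
  using frag_value_diff[of f 0 u] by simp

lemma frag_value_add: "frag_value f (u + v) = frag_value f u + frag_value f v"
  using frag_value_diff[of f u "- v"] by (simp add: frag_value_minus)

lemma frag_value_frag_of [simp]: "frag_value f (frag_of a) = f a"
  by (simp add: frag_value_def keys_frag_of)

lemma frag_value_sum: "frag_value f (sum g I) = (\<Sum>i\<in>I. frag_value f (g i))"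
  by (induction I rule: infinite_finite_induct) (auto simp: frag_value_add)

lemma frag_value_extend: "frag_value f (frag_extend g u) = frag_value (\<lambda>a. frag_value f (g a)) u"
proof -
  have "Poly_Mapping.keys u \<subseteq> UNIV" by simp
  then show ?thesis
    by (induction u rule: frag_induction) (simp_all add: frag_extend_diff frag_value_diff)
qed

lemma frag_value_cong:
  "(\<And>a. a \<in> Poly_Mapping.keys u \<Longrightarrow> f a = g a) \<Longrightarrow> frag_value f u = frag_value g u"
  by (simp add: frag_value_def)

lemma frag_value_linear:
  "frag_value (\<lambda>a. c * f a + d * g a) u = c * frag_value f u + d * frag_value g u"
  by (simp add: frag_value_def sum.distrib sum_distrib_left algebra_simps)

lemma frag_value_scale: "frag_value (\<lambda>a. c * f a) u = c * frag_value f u"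
  using frag_value_linear[of c f 0 f u] by simp

lemma keys_frag_extend_subset:
  assumes "Poly_Mapping.keys u \<subseteq> S" "\<And>a. a \<in> S \<Longrightarrow> Poly_Mapping.keys (g a) \<subseteq> T"
  shows "Poly_Mapping.keys (frag_extend g u) \<subseteq> T"
  using keys_frag_extend[of g u] assms by blast

lemma keys_diff_subset:
  "Poly_Mapping.keys u \<subseteq> S \<Longrightarrow> Poly_Mapping.keys v \<subseteq> S \<Longrightarrow> Poly_Mapping.keys (u - v) \<subseteq> S"
  using keys_diff[of u v] by blast

lemma keys_add_subset:
  "Poly_Mapping.keys u \<subseteq> S \<Longrightarrow> Poly_Mapping.keys v \<subseteq> S \<Longrightarrow> Poly_Mapping.keys (u + v) \<subseteq> S"
  using keys_add[of u v] by blast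

lemma keys_sum_subset:
  "(\<And>i. i \<in> I \<Longrightarrow> Poly_Mapping.keys (g i) \<subseteq> S) \<Longrightarrow> Poly_Mapping.keys (sum g I) \<subseteq> S"
  by (induction I rule: infinite_finite_induct) (simp_all add: keys_add_subset)

lemma subgroup_generate_free:
  assumes "Rels \<subseteq> carrier (free_Abelian_group S)"
  shows "subgroup (generate (free_Abelian_group S) Rels) (free_Abelian_group S)"
  using assms by (intro group.generate_is_subgroup) auto

lemma generate_free_closed:
  fixes S :: "'a set"
  assumes "Rels \<subseteq> carrier (free_Abelian_group S)"
  defines "R \<equiv> generate (free_Abelian_group S) Rels"
  shows "u \<in> R \<Longrightarrow> v \<in> R \<Longrightarrow> u + v \<in> R" and "u \<in> R \<Longrightarrow> v \<in> R \<Longrightarrow> u - v \<in> R" and "0 \<in> R"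
    and "u \<in> R \<Longrightarrow> - u \<in> R" and "u \<in> R \<Longrightarrow> Poly_Mapping.keys u \<subseteq> S" and "u \<in> Rels \<Longrightarrow> u \<in> R"
proof -
  have R: "subgroup R (free_Abelian_group S)" unfolding R_def using assms(1) by (rule subgroup_generate_free)
  show k: "u \<in> R \<Longrightarrow> Poly_Mapping.keys u \<subseteq> S" for u using subgroup.mem_carrier[OF R] by simp
  show p: "u \<in> R \<Longrightarrow> v \<in> R \<Longrightarrow> u + v \<in> R" for u v using subgroup.m_closed[OF R] by simp
  show m: "u \<in> R \<Longrightarrow> - u \<in> R" for u using subgroup.m_inv_closed[OF R, of u] k[of u] by simp
  show "0 \<in> R" using subgroup.one_closed[OF R] by simp
  show "u \<in> R \<Longrightarrow> v \<in> R \<Longrightarrow> u - v \<in> R" using p[OF _ m, of u v] by simp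
  show "u \<in> Rels \<Longrightarrow> u \<in> R" unfolding R_def by (rule generate.incl)
qed

lemma generate_free_value:
  assumes "\<And>r. r \<in> Rels \<Longrightarrow> frag_value f r = 0" and Rels: "Rels \<subseteq> carrier (free_Abelian_group S)"
    and "u \<in> generate (free_Abelian_group S) Rels"
  shows "frag_value f u = 0"
  using assms(3)
proof (induction rule: generate.induct)
  case (inv h)
  then have "h \<in> carrier (free_Abelian_group S)" using Rels by (rule subsetD[rotated])
  then have "Poly_Mapping.keys h \<subseteq> S" unfolding carrier_free_Abelian_group_iff .
  then show ?case
    unfolding inv_free_Abelian_group[OF \<open>Poly_Mapping.keys h \<subseteq> S\<close>] frag_value_minus assms(1)[OF inv] by simp
qed (use assms(1) in \<open>auto simp: frag_value_add\<close>)

text \<open>The common setting of the integral Grothendieck group and of its rational extension: a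
  quotient of a free abelian group whose relations are exactly the kernel of a family of additive
  functionals. Equality in the quotient then amounts to equality of coordinates.\<close>

locale coordinates =
  fixes S :: "'a set" and Rels :: "('a \<Rightarrow>\<^sub>0 int) set" and val :: "'a \<Rightarrow> nat \<Rightarrow> rat"
  assumes Rels: "Rels \<subseteq> carrier (free_Abelian_group S)"
    and kernel: "Poly_Mapping.keys u \<subseteq> S \<Longrightarrow>
      u \<in> generate (free_Abelian_group S) Rels \<longleftrightarrow> (\<forall>j. frag_value (\<lambda>a. val a j) u = 0)"
begin

definition V :: "('a \<Rightarrow>\<^sub>0 int) \<Rightarrow> nat \<Rightarrow> rat" where
  "V u j = frag_value (\<lambda>a. val a j) u"

abbreviation F where "F \<equiv> free_Abelian_group S"
abbreviation R where "R \<equiv> generate F Rels"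

definition coset :: "('a \<Rightarrow>\<^sub>0 int) \<Rightarrow> ('a \<Rightarrow>\<^sub>0 int) set" where
  "coset u = R #>\<^bsub>F\<^esub> u"

definition Q :: "('a \<Rightarrow>\<^sub>0 int) set monoid" where "Q = F Mod R"

text \<open>Any representative may be chosen: cosets turn out to be the fibres of
  \<open>V\<close>.\<close>

definition cval :: "('a \<Rightarrow>\<^sub>0 int) set \<Rightarrow> nat \<Rightarrow> rat" where
  "cval U = V (SOME u. u \<in> U)"

lemmas closed = generate_free_closed[OF Rels]

lemma normal: "R \<lhd> F"
  using comm_group.subgroup_imp_normal[OF abelian_free_Abelian_group subgroup_generate_free[OF Rels]] .

lemma coset_eq:
  assumes "Poly_Mapping.keys u \<subseteq> S"
  shows "coset u = {v. Poly_Mapping.keys v \<subseteq> S \<and> V v = V u}"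
proof (intro equalityI subsetI)
  fix v assume "v \<in> coset u"
  then obtain r where r: "r \<in> R" "v = r + u" by (auto simp: coset_def r_coset_def)
  then show "v \<in> {v. Poly_Mapping.keys v \<subseteq> S \<and> V v = V u}"
    using kernel[OF closed(5)[OF r(1)]] closed(5)[OF r(1)] keys_add_subset[of r S u] assms
    by (simp add: V_def fun_eq_iff frag_value_add)
next
  fix v assume v: "v \<in> {v. Poly_Mapping.keys v \<subseteq> S \<and> V v = V u}"
  then have "v - u \<in> R"
    using assms by (subst kernel) (auto simp: keys_diff_subset V_def fun_eq_iff frag_value_diff)
  then show "v \<in> coset u" unfolding coset_def r_coset_def by (auto intro!: bexI[of _ "v - u"])
qed

lemma coset_eq_iff:
  "Poly_Mapping.keys u \<subseteq> S \<Longrightarrow> Poly_Mapping.keys v \<subseteq> S \<Longrightarrow> coset u = coset v \<longleftrightarrow> V u = V v"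
  by (auto simp: coset_eq)

lemma cval_coset:
  assumes "Poly_Mapping.keys u \<subseteq> S"
  shows "cval (coset u) = V u"
proof -
  have "u \<in> coset u" using assms by (simp add: coset_eq)
  then have "(SOME v. v \<in> coset u) \<in> coset u" by (rule someI)
  then show ?thesis using assms by (simp add: cval_def coset_eq)
qed

lemma carrier_Q: "carrier Q = coset ` {u. Poly_Mapping.keys u \<subseteq> S}"
  unfolding Q_def carrier_FactGroup coset_def by (rule image_cong) auto

lemma coset_in: "Poly_Mapping.keys u \<subseteq> S \<Longrightarrow> coset u \<in> carrier Q"
  unfolding carrier_Q by blast

lemma carrier_cases:
  assumes "U \<in> carrier Q"
  obtains u where "Poly_Mapping.keys u \<subseteq> S" "U = coset u"
  using assms unfolding carrier_Q by blast

lemma cval_inj: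
  assumes "U \<in> carrier Q" "U' \<in> carrier Q" "cval U = cval U'"
  shows "U = U'"
proof -
  obtain u where u: "Poly_Mapping.keys u \<subseteq> S" "U = coset u" using assms(1) by (rule carrier_cases)
  obtain u' where u': "Poly_Mapping.keys u' \<subseteq> S" "U' = coset u'" using assms(2) by (rule carrier_cases)
  show ?thesis using assms(3) u u' by (simp add: cval_coset coset_eq_iff)
qed

lemma V_add: "V (u + v) = (\<lambda>j. V u j + V v j)"
  by (simp add: V_def fun_eq_iff frag_value_add)

lemma coset_add:
  assumes "Poly_Mapping.keys u \<subseteq> S" "Poly_Mapping.keys v \<subseteq> S"
  shows "coset u \<otimes>\<^bsub>Q\<^esub> coset v = coset (u + v)"
  using normal.rcos_sum[OF normal, of u v] assms by (simp add: Q_def coset_def)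

lemma Q_mult:
  assumes "U \<in> carrier Q" "U' \<in> carrier Q"
  shows "U \<otimes>\<^bsub>Q\<^esub> U' \<in> carrier Q" "cval (U \<otimes>\<^bsub>Q\<^esub> U') = (\<lambda>j. cval U j + cval U' j)"
proof -
  obtain u where u: "Poly_Mapping.keys u \<subseteq> S" "U = coset u" using assms(1) by (rule carrier_cases)
  obtain u' where u': "Poly_Mapping.keys u' \<subseteq> S" "U' = coset u'" using assms(2) by (rule carrier_cases)
  note u = u u'
  show "U \<otimes>\<^bsub>Q\<^esub> U' \<in> carrier Q" "cval (U \<otimes>\<^bsub>Q\<^esub> U') = (\<lambda>j. cval U j + cval U' j)"
    using u by (simp_all add: coset_add coset_in keys_add_subset cval_coset V_add)
qed

lemma Q_one: "\<one>\<^bsub>Q\<^esub> = coset 0" "\<one>\<^bsub>Q\<^esub> \<in> carrier Q" "cval \<one>\<^bsub>Q\<^esub> = (\<lambda>j. 0)"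
proof -
  show one: "\<one>\<^bsub>Q\<^esub> = coset 0"
    using closed(5) by (force simp: Q_def coset_def r_coset_def)
  show "\<one>\<^bsub>Q\<^esub> \<in> carrier Q" "cval \<one>\<^bsub>Q\<^esub> = (\<lambda>j. 0)"
    unfolding one by (simp_all add: coset_in cval_coset V_def fun_eq_iff)
qed

text \<open>Products are defined as unions over all pairs of representatives. If the coordinates of
  \<open>t u u'\<close> depend only on those of \<open>u\<close> and \<open>u'\<close>, all members
  of the union are the same coset, so the union is that coset.\<close>

lemma bilinear_op:
  assumes "U \<in> carrier Q" "U' \<in> carrier Q"
    and "\<And>u u'. Poly_Mapping.keys u \<subseteq> S \<Longrightarrow> Poly_Mapping.keys u' \<subseteq> S \<Longrightarrow>
      Poly_Mapping.keys (t u u') \<subseteq> S \<and> V (t u u') = m (V u) (V u')"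
  shows "(\<Union>u\<in>U. \<Union>u'\<in>U'. R #>\<^bsub>F\<^esub> t u u') \<in> carrier Q"
    and "cval (\<Union>u\<in>U. \<Union>u'\<in>U'. R #>\<^bsub>F\<^esub> t u u') = m (cval U) (cval U')"
proof -
  obtain u where u: "Poly_Mapping.keys u \<subseteq> S" "U = coset u" using assms(1) by (rule carrier_cases)
  obtain u' where u': "Poly_Mapping.keys u' \<subseteq> S" "U' = coset u'" using assms(2) by (rule carrier_cases)
  note u = u u'
  have "coset (t v v') = coset (t u u')" if "v \<in> U" "v' \<in> U'" for v v'
  proof -
    have v: "Poly_Mapping.keys v \<subseteq> S" "V v = V u" "Poly_Mapping.keys v' \<subseteq> S" "V v' = V u'"
      using that unfolding u(2,4) coset_eq[OF u(1)] coset_eq[OF u(3)] by blast+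
    have "V (t v v') = V (t u u')"
      unfolding conjunct2[OF assms(3)[OF v(1,3)]] conjunct2[OF assms(3)[OF u(1,3)]] v(2,4) ..
    then show ?thesis
      unfolding coset_eq_iff[OF conjunct1[OF assms(3)[OF v(1,3)]] conjunct1[OF assms(3)[OF u(1,3)]]] .
  qed
  moreover have "u \<in> U" "u' \<in> U'" using u by (simp_all add: coset_eq)
  ultimately have eq: "(\<Union>u\<in>U. \<Union>u'\<in>U'. R #>\<^bsub>F\<^esub> t u u') = coset (t u u')"
    unfolding coset_def[symmetric] by blast
  have t: "Poly_Mapping.keys (t u u') \<subseteq> S" "V (t u u') = m (V u) (V u')"
    using assms(3)[OF u(1,3)] by blast+
  show "(\<Union>u\<in>U. \<Union>u'\<in>U'. R #>\<^bsub>F\<^esub> t u u') \<in> carrier Q"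
    unfolding eq using t(1) by (rule coset_in)
  have "cval U = V u" "cval U' = V u'"
    unfolding u(2,4) using cval_coset[OF u(1)] cval_coset[OF u(3)] .
  then show "cval (\<Union>u\<in>U. \<Union>u'\<in>U'. R #>\<^bsub>F\<^esub> t u u') = m (cval U) (cval U')"
    unfolding eq cval_coset[OF t(1)] t(2) by (simp only:)
qed

lemma linear_op:
  assumes "U \<in> carrier Q"
    and "\<And>u. Poly_Mapping.keys u \<subseteq> S \<Longrightarrow> Poly_Mapping.keys (t u) \<subseteq> S \<and> V (t u) = m (V u)"
  shows "(\<Union>u\<in>U. R #>\<^bsub>F\<^esub> t u) \<in> carrier Q" and "cval (\<Union>u\<in>U. R #>\<^bsub>F\<^esub> t u) = m (cval U)"
proof -
  obtain u where u: "Poly_Mapping.keys u \<subseteq> S" "U = coset u" using assms(1) by (rule carrier_cases)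
  have "coset (t v) = coset (t u)" if "v \<in> U" for v
  proof -
    have v: "Poly_Mapping.keys v \<subseteq> S" "V v = V u"
      using that unfolding u(2) coset_eq[OF u(1)] by blast+
    have "V (t v) = V (t u)"
      unfolding conjunct2[OF assms(2)[OF v(1)]] conjunct2[OF assms(2)[OF u(1)]] v(2) ..
    then show ?thesis
      unfolding coset_eq_iff[OF conjunct1[OF assms(2)[OF v(1)]] conjunct1[OF assms(2)[OF u(1)]]] .
  qed
  moreover have "u \<in> U" using u by (simp add: coset_eq)
  ultimately have eq: "(\<Union>u\<in>U. R #>\<^bsub>F\<^esub> t u) = coset (t u)"
    unfolding coset_def[symmetric] by blast
  have t: "Poly_Mapping.keys (t u) \<subseteq> S" "V (t u) = m (V u)"
    using assms(2)[OF u(1)] by blast+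
  show "(\<Union>u\<in>U. R #>\<^bsub>F\<^esub> t u) \<in> carrier Q"
    unfolding eq using t(1) by (rule coset_in)
  have "cval U = V u" unfolding u(2) using cval_coset[OF u(1)] .
  then show "cval (\<Union>u\<in>U. R #>\<^bsub>F\<^esub> t u) = m (cval U)"
    unfolding eq cval_coset[OF t(1)] t(2) by (simp only:)
qed

end

section \<open>Coordinates of bisets\<close>

text \<open>These are the coordinates of the class with respect to the basis c_1, ..., c_22.\<close>

definition biset_vec :: "(nat \<Rightarrow> nat, nat \<Rightarrow> nat, 'x) biset \<Rightarrow> nat \<Rightarrow> rat" where
  "biset_vec X j = biset_sum S3 S3 (\<lambda>D. type_weight (subgroup_type D) j) X"

lemma S3_stab_subgroup: "finite_biset S3 S3 X \<Longrightarrow> x \<in> carrier X \<Longrightarrow> S3_subgroup (biset_stab S3 S3 X x)"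
  unfolding S3_subgroup_def by (rule finite_biset.stab_subgroup)

lemma coeff_product_sum_left:
  "finite A \<Longrightarrow> coeff_product (\<lambda>i. \<Sum>x\<in>A. f x i) y k = (\<Sum>x\<in>A. coeff_product (f x) y k)"
proof (induction A rule: finite_induct)
  case empty
  then show ?case using coeff_product_left[of 0 "\<lambda>_. 0" 0 "\<lambda>_. 0" y k] by simp
next
  case (insert x A)
  then show ?case using coeff_product_left[of 1 "f x" 1 "\<lambda>i. \<Sum>x\<in>A. f x i" y k] by simp
qed

lemma coeff_product_sum_right:
  "finite A \<Longrightarrow> coeff_product y (\<lambda>i. \<Sum>x\<in>A. f x i) k = (\<Sum>x\<in>A. coeff_product y (f x) k)"
proof (induction A rule: finite_induct)
  case empty
  then show ?case using coeff_product_right[of y 0 "\<lambda>_. 0" 0 "\<lambda>_. 0" k] by simp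
next
  case (insert x A)
  then show ?case using coeff_product_right[of y 1 "f x" 1 "\<lambda>i. \<Sum>x\<in>A. f x i" k] by simp
qed

lemma card_S3: "card (carrier S3) = 6"
  by (simp add: carrier_S3)

lemma biset_vec_tensor:
  assumes X: "finite_biset S3 S3 X" and Y: "finite_biset S3 S3 Y"
  shows "biset_vec (biset_tensor S3 X Y) k = coeff_product (biset_vec X) (biset_vec Y) k"
proof -
  interpret X: finite_biset S3 S3 X by fact
  interpret Y: finite_biset S3 S3 Y by fact
  interpret T: composable_bisets S3 S3 S3 X Y
    by (intro composable_bisets.intro composable_bisets_axioms.intro X Y finite_S3)
  let ?s = "biset_stab S3 S3 X" and ?t = "biset_stab S3 S3 Y"
  define E where "E L M = of_nat (card (right_kernel S3 L \<inter> left_kernel S3 M)) * type_weight (subgroup_type (L O M)) k"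
    for L M :: "((nat \<Rightarrow> nat) \<times> (nat \<Rightarrow> nat)) set"
  have move: "?s (ract X x g) = conj_subgroup S3 S3 id g (?s x)" if "x \<in> carrier X" "g \<in> carrier S3" for x g
    using X.stab_move[OF that(1) S3.one_closed that(2)] X.lact_one[OF X.ract_closed[OF that]]
    unfolding S3_simps by simp
  have avg: "(\<Sum>g\<in>carrier S3. E (?s (ract X x g)) (?t y))
      = 36 * coeff_product (type_weight (subgroup_type (?s x))) (type_weight (subgroup_type (?t y))) k"
    if x: "x \<in> carrier X" and y: "y \<in> carrier Y" for x y
  proof -
    have "(\<Sum>g\<in>carrier S3. E (?s (ract X x g)) (?t y)) = (\<Sum>g\<in>carrier S3. E (conj_subgroup S3 S3 id g (?s x)) (?t y))"
      by (rule sum.cong[OF refl]) (simp only: move[OF x])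
    also have "\<dots> = 36 * coeff_product (type_weight (subgroup_type (?s x))) (type_weight (subgroup_type (?t y))) k"
      unfolding E_def
    proof (rule weight_average[OF S3_stab_subgroup[OF X x] S3_stab_subgroup[OF Y y]])
      fix g assume "g \<in> carrier S3"
      then show "S3_subgroup (conj_subgroup S3 S3 id g (?s x))"
        using S3.one_closed unfolding S3_simps by (intro S3_conj_subgroup S3_stab_subgroup[OF X x])
    qed
    finally show ?thesis .
  qed
  \<comment> \<open>This 6 comes from the orbit lengths in the tensor product; averaging over
    translations contributes another, and together they cancel the 36 of
    \<open>weight_average\<close>.\<close>
  have "biset_vec (biset_tensor S3 X Y) k = (\<Sum>x\<in>carrier X. \<Sum>y\<in>carrier Y. E (?s x) (?t y)) / 6"
    unfolding biset_vec_def T.biset_sum_tensor card_S3 E_def by simp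
  \<comment> \<open>Each point of \<open>X\<close> is replaced by all its right translates, whose
    stabilisers run through the conjugates that have to be averaged.\<close>
  also have "(\<Sum>x\<in>carrier X. \<Sum>y\<in>carrier Y. E (?s x) (?t y))
      = (\<Sum>x\<in>carrier X. \<Sum>g\<in>carrier S3. \<Sum>y\<in>carrier Y. E (?s (ract X x g)) (?t y)) / 6"
    using T.sum_average[of "\<lambda>x. \<Sum>y\<in>carrier Y. E (?s x) (?t y)"] unfolding card_S3 by simp
  also have "(\<Sum>x\<in>carrier X. \<Sum>g\<in>carrier S3. \<Sum>y\<in>carrier Y. E (?s (ract X x g)) (?t y))
      = (\<Sum>x\<in>carrier X. \<Sum>y\<in>carrier Y. \<Sum>g\<in>carrier S3. E (?s (ract X x g)) (?t y))"
    by (rule sum.cong[OF refl], rule sum.swap)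
  also have "\<dots> = (\<Sum>x\<in>carrier X. \<Sum>y\<in>carrier Y.
      36 * coeff_product (type_weight (subgroup_type (?s x))) (type_weight (subgroup_type (?t y))) k)"
    by (intro sum.cong refl) (rule avg)
  also have "\<dots> = 36 * (\<Sum>x\<in>carrier X. \<Sum>y\<in>carrier Y.
      coeff_product (type_weight (subgroup_type (?s x))) (type_weight (subgroup_type (?t y))) k)"
    by (simp only: sum_distrib_left)
  also have "(\<Sum>x\<in>carrier X. \<Sum>y\<in>carrier Y.
      coeff_product (type_weight (subgroup_type (?s x))) (type_weight (subgroup_type (?t y))) k)
      = coeff_product (biset_vec X) (biset_vec Y) k"
    unfolding biset_vec_def[abs_def] biset_sum_def
      coeff_product_sum_left[OF X.finite_carrier] coeff_product_sum_right[OF Y.finite_carrier] ..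
  finally show ?thesis by simp
qed

lemma biset_vec_iso:
  "finite_biset S3 S3 X \<Longrightarrow> biset_isomorphic S3 S3 X Y \<Longrightarrow> biset_vec X = biset_vec Y"
  unfolding biset_vec_def[abs_def] using finite_biset.biset_sum_iso by blast

lemma biset_vec_union:
  "finite_biset S3 S3 X \<Longrightarrow> finite_biset S3 S3 Y \<Longrightarrow> biset_vec (biset_union X Y) j = biset_vec X j + biset_vec Y j"
  unfolding biset_vec_def by (rule biset_sum_union)

lemma finite_biset_S3_coset: "S3_subgroup D \<Longrightarrow> finite_biset S3 S3 (coset_biset S3 S3 D)"
  unfolding S3_subgroup_iff
  by (rule finite_biset_coset[OF S3.group_axioms S3.group_axioms finite_S3 finite_S3])

lemma biset_vec_coset:
  assumes D: "S3_subgroup D"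
  shows "biset_vec (coset_biset S3 S3 D) = type_coeff (subgroup_type D)"
proof
  fix j
  interpret S3_subgroup D by fact
  have "of_nat (card D) * biset_vec (coset_biset S3 S3 D) j
      = of_nat (card (carrier S3) * card (carrier S3)) * type_weight (subgroup_type D) j"
    unfolding biset_vec_def
    by (rule biset_sum_coset[OF S3.group_axioms S3.group_axioms finite_S3 finite_S3 subgroup])
      (simp only: type_conj_subgroup)
  moreover have "card D > 0" using id_in finite by (auto simp: card_gt_0_iff)
  moreover have "type_weight (subgroup_type D) j = of_nat (card D) / 36 * type_coeff (subgroup_type D) j"
    using type_coeff_outside[OF type_in] unfolding type_weight_def type_order by simp
  ultimately show "biset_vec (coset_biset S3 S3 D) j = type_coeff (subgroup_type D) j"
    unfolding card_S3 by simp
qed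

lemma finite_biset_regular: "group G \<Longrightarrow> finite (carrier G) \<Longrightarrow> finite_biset G G (regular_biset G)"
proof -
  assume "group G" "finite (carrier G)"
  then interpret group G by simp
  show ?thesis
    by unfold_locales (use \<open>finite (carrier G)\<close> in \<open>auto simp: regular_biset_def m_assoc\<close>)
qed

text \<open>The regular biset is one orbit, and the stabiliser of the identity is the diagonal,
  which has the type of L_22. Its row is therefore row 22.\<close>

lemma biset_vec_regular: "biset_vec (regular_biset S3) = (\<lambda>j. if j \<in> {1, 6, 11, 17, 21, 22} then 1 else 0)"
proof -
  have X: "finite_biset S3 S3 (regular_biset S3)"
    by (rule finite_biset_regular[OF S3.group_axioms finite_S3])
  interpret X: finite_biset S3 S3 "regular_biset S3" by (rule X)
  define D where "D = biset_stab S3 S3 (regular_biset S3) id"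
  have id: "id \<in> carrier (regular_biset S3)"
    using S3.one_closed unfolding S3_simps by (simp add: regular_biset_def)
  have D: "D = (\<lambda>a. (a, a)) ` carrier S3"
    unfolding D_def biset_stab_def regular_biset_def by auto
  have SD: "S3_subgroup D" unfolding D_def using X id by (rule S3_stab_subgroup)
  have "biset_orbit S3 S3 (regular_biset S3) id = carrier (regular_biset S3)"
  proof
    show "carrier (regular_biset S3) \<subseteq> biset_orbit S3 S3 (regular_biset S3) id"
    proof
      fix a assume a: "a \<in> carrier (regular_biset S3)"
      then show "a \<in> biset_orbit S3 S3 (regular_biset S3) id"
        unfolding biset_orbit_def
        by (intro image_eqI[of _ _ "(a, id)"]) (use id in \<open>auto simp: regular_biset_def\<close>)
    qed
  qed (rule X.orbit_subset[OF id])
  then have iso: "biset_isomorphic S3 S3 (regular_biset S3) (coset_biset S3 S3 D)"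
    using X.orbit_isomorphic_coset[OF id] by (simp add: D_def)
  have "biset_vec (regular_biset S3) = type_coeff (subgroup_type D)"
    unfolding biset_vec_iso[OF X iso] by (rule biset_vec_coset[OF SD])
  also have "subgroup_type D = ((6, 1), (6, 1))"
  proof -
    have "fst ` D = carrier S3" "snd ` D = carrier S3" unfolding D by (auto simp: image_image)
    moreover have "left_kernel S3 D = {id}" "right_kernel S3 D = {id}"
      unfolding D left_kernel_def right_kernel_def using S3.one_closed unfolding S3_simps by auto
    ultimately show ?thesis by (simp add: subgroup_type_def card_S3)
  qed
  also have "((6, 1), (6, 1)) = S3_types ! (22 - 1)"
    by (simp add: S3_types_def)
  also have "type_coeff \<dots> = M' 22" by (rule type_coeff_S3_types) simp
  also have "M' 22 = (\<lambda>j. if j \<in> {1, 6, 11, 17, 21, 22} then 1 else 0)"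
    by (simp add: fun_eq_iff M'_def M'_rows_def)
  finally show ?thesis .
qed

section \<open>The chosen representatives\<close>

text \<open>Left translation by a member is injective on the finite set, hence onto; this produces
  first the identity and then the inverse.\<close>

lemma (in group) finite_closed_subgroup:
  assumes "finite A" "A \<noteq> {}" "A \<subseteq> carrier G" and closed: "\<And>a b. a \<in> A \<Longrightarrow> b \<in> A \<Longrightarrow> a \<otimes> b \<in> A"
  shows "subgroup A G"
proof (rule subgroupI)
  fix a assume a: "a \<in> A"
  then have ac: "a \<in> carrier G" using assms(3) by blast
  have "inj_on (\<lambda>x. a \<otimes> x) A"
    using ac assms(3) by (intro inj_onI) (auto simp: subset_iff)
  moreover have "(\<lambda>x. a \<otimes> x) ` A \<subseteq> A" using a closed by blast
  ultimately have surj: "(\<lambda>x. a \<otimes> x) ` A = A" using assms(1) by (intro endo_inj_surj)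
  have "a \<in> (\<lambda>x. a \<otimes> x) ` A" unfolding surj by (rule a)
  then obtain e where e: "e \<in> A" "a = a \<otimes> e" by (rule imageE) blast
  have "e \<in> carrier G" using e(1) assms(3) by blast
  then have "e = \<one>" using e(2) l_cancel[of a e \<one>] ac by simp
  then have "\<one> \<in> (\<lambda>x. a \<otimes> x) ` A" unfolding surj using e(1) by simp
  then obtain b where b: "b \<in> A" "\<one> = a \<otimes> b" by (rule imageE) blast
  have bc: "b \<in> carrier G" using b(1) assms(3) by blast
  have "inv a = b" using inv_equality[OF inv_comm[OF b(2)[symmetric] ac bc] ac bc] .
  then show "inv a \<in> A" using b(1) by simp
qed (use assms in auto)

text \<open>The sections can be read off from the subgroup: surjectivity of the isomorphism and its
  being defined on all cosets give the projections, its injectivity together with K_1 -> K_2 gives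
  the kernels.\<close>

lemma (in group) goursat_subgroup_projections:
  assumes "goursat_subgroup G (P1, K1) (P2, K2) L" and fin: "finite (carrier G)"
  shows "subgroup L (G \<times>\<times> G)" "fst ` L = P1" "snd ` L = P2" "left_kernel G L = K1" "right_kernel G L = K2"
proof -
  let ?G1 = "G\<lparr>carrier := P1\<rparr>" and ?G2 = "G\<lparr>carrier := P2\<rparr>"
  obtain \<phi> where P: "subgroup P1 G" "subgroup P2 G" and K: "K1 \<lhd> ?G1" "K2 \<lhd> ?G2"
    and \<phi>: "\<phi> \<in> iso (?G1 Mod K1) (?G2 Mod K2)"
    and L: "L = {(a1, a2) \<in> P1 \<times> P2. \<phi> (K1 #> a1) = K2 #> a2}"
    using assms(1) unfolding goursat_subgroup_def by auto
  interpret PP: group "G \<times>\<times> G" by (rule DirProd_group) unfold_locales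
  have KG: "subgroup K1 G" "subgroup K2 G"
    using incl_subgroup[OF P(1) normal_imp_subgroup[OF K(1)]] incl_subgroup[OF P(2) normal_imp_subgroup[OF K(2)]] .
  have KP: "K1 \<subseteq> P1" "K2 \<subseteq> P2"
    using subgroup.subset[OF normal_imp_subgroup[OF K(1)]] subgroup.subset[OF normal_imp_subgroup[OF K(2)]] by simp_all
  \<comment> \<open>Cosets in the subgroup P_i are literally cosets in \<open>G\<close>, because
    restricting the carrier leaves the multiplication unchanged.\<close>
  have car: "carrier (?G1 Mod K1) = (\<lambda>a. K1 #> a) ` P1" "carrier (?G2 Mod K2) = (\<lambda>a. K2 #> a) ` P2"
    by (simp_all add: carrier_FactGroup r_coset_def)
  have sum: "(K1 #> a) \<otimes>\<^bsub>?G1 Mod K1\<^esub> (K1 #> b) = K1 #> (a \<otimes> b)" if "a \<in> P1" "b \<in> P1" for a b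
    using normal.rcos_sum[OF K(1), of a b] that by (simp add: r_coset_def)
  have sum': "(K2 #> a) \<otimes>\<^bsub>?G2 Mod K2\<^esub> (K2 #> b) = K2 #> (a \<otimes> b)" if "a \<in> P2" "b \<in> P2" for a b
    using normal.rcos_sum[OF K(2), of a b] that by (simp add: r_coset_def)
  have bij: "bij_betw \<phi> (carrier (?G1 Mod K1)) (carrier (?G2 Mod K2))" and hom: "\<phi> \<in> hom (?G1 Mod K1) (?G2 Mod K2)"
    using \<phi> by (auto simp: iso_def)
  have K1_coset: "K1 #> a = K1 \<longleftrightarrow> a \<in> K1" if "a \<in> P1" for a
    using that coset_join1[OF _ _ KG(1)] coset_join2[OF _ KG(1)] subgroup.subset[OF P(1)] subgroup.subset[OF KG(1)] by blast
  have K2_coset: "K2 #> a = K2 \<longleftrightarrow> a \<in> K2" if "a \<in> P2" for a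
    using that coset_join1[OF _ _ KG(2)] coset_join2[OF _ KG(2)] subgroup.subset[OF P(2)] subgroup.subset[OF KG(2)] by blast
  have one: "\<one> \<in> P1" "\<one> \<in> P2" "\<one> \<in> K1" "\<one> \<in> K2"
    using P KG by (auto intro: subgroup.one_closed)
  have c1: "K1 #> \<one> = K1" "K2 #> \<one> = K2"
    using K1_coset[OF one(1)] K2_coset[OF one(2)] one(3,4) by simp_all
  have \<phi>1: "\<phi> K1 = K2"
  proof -
    interpret h: group_hom "?G1 Mod K1" "?G2 Mod K2" \<phi>
      using normal.factorgroup_is_group[OF K(1)] normal.factorgroup_is_group[OF K(2)] hom
      by (simp add: group_hom_def group_hom_axioms_def)
    show ?thesis using h.hom_one by simp
  qed
  have inj: "\<phi> (K1 #> a) = \<phi> K1 \<longleftrightarrow> K1 #> a = K1" if "a \<in> P1" for a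
    using bij that c1(1) one(1) unfolding bij_betw_def car
    by (intro inj_on_eq_iff[of \<phi> "(\<lambda>a. K1 #> a) ` P1"]) (auto intro!: image_eqI[of K1 _ \<one>])
  have sub: "L \<subseteq> carrier (G \<times>\<times> G)"
    using subgroup.subset[OF P(1)] subgroup.subset[OF P(2)] unfolding L by auto
  show "subgroup L (G \<times>\<times> G)"
  proof (rule PP.finite_closed_subgroup)
    show "finite L" using sub fin by (rule_tac finite_subset) auto
    have "(\<one>, \<one>) \<in> L" unfolding L using one c1 \<phi>1 by simp
    then show "L \<noteq> {}" by blast
    show "L \<subseteq> carrier (G \<times>\<times> G)" by (rule sub)
    fix u v assume uv: "u \<in> L" "v \<in> L"
    then obtain a b c d where abcd: "u = (a, b)" "v = (c, d)" "a \<in> P1" "b \<in> P2" "c \<in> P1" "d \<in> P2"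
      "\<phi> (K1 #> a) = K2 #> b" "\<phi> (K1 #> c) = K2 #> d"
      unfolding L by blast
    have "\<phi> (K1 #> (a \<otimes> c)) = \<phi> (K1 #> a) \<otimes>\<^bsub>?G2 Mod K2\<^esub> \<phi> (K1 #> c)"
      unfolding sum[OF abcd(3,5), symmetric]
      by (rule hom_mult[OF hom]) (use abcd in \<open>auto simp: car\<close>)
    then have "\<phi> (K1 #> (a \<otimes> c)) = K2 #> (b \<otimes> d)"
      unfolding abcd(7,8) sum'[OF abcd(4,6)] .
    then show "u \<otimes>\<^bsub>G \<times>\<times> G\<^esub> v \<in> L"
      unfolding L abcd(1,2)
      using subgroup.m_closed[OF P(1) abcd(3,5)] subgroup.m_closed[OF P(2) abcd(4,6)] by simp
  qed
  show "fst ` L = P1"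
  proof
    show "P1 \<subseteq> fst ` L"
    proof
      fix a assume a: "a \<in> P1"
      then have "\<phi> (K1 #> a) \<in> (\<lambda>a. K2 #> a) ` P2"
        using bij unfolding bij_betw_def car by blast
      then obtain b where "b \<in> P2" "\<phi> (K1 #> a) = K2 #> b" by blast
      then have "(a, b) \<in> L" unfolding L using a by blast
      then show "a \<in> fst ` L" by force
    qed
  qed (auto simp: L)
  show "snd ` L = P2"
  proof
    show "P2 \<subseteq> snd ` L"
    proof
      fix b assume b: "b \<in> P2"
      then have "K2 #> b \<in> \<phi> ` (\<lambda>a. K1 #> a) ` P1"
        using bij unfolding bij_betw_def car by blast
      then obtain a where "a \<in> P1" "\<phi> (K1 #> a) = K2 #> b" by auto
      then have "(a, b) \<in> L" unfolding L using b by blast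
      then show "b \<in> snd ` L" by force
    qed
  qed (auto simp: L)
  show "left_kernel G L = K1"
  proof -
    have "(a, \<one>) \<in> L \<longleftrightarrow> a \<in> K1" for a
    proof (cases "a \<in> P1")
      case True
      then have "(a, \<one>) \<in> L \<longleftrightarrow> \<phi> (K1 #> a) = \<phi> K1"
        unfolding L \<phi>1 using one(2) c1(2) by simp
      then show ?thesis unfolding inj[OF True] K1_coset[OF True] .
    qed (use KP in \<open>auto simp: L\<close>)
    then show ?thesis unfolding left_kernel_def by blast
  qed
  show "right_kernel G L = K2"
  proof -
    have "(\<one>, b) \<in> L \<longleftrightarrow> b \<in> K2" for b
    proof (cases "b \<in> P2")
      case True
      then have "(\<one>, b) \<in> L \<longleftrightarrow> K2 #> b = K2"
        unfolding L using one(1) c1(1) \<phi>1 by auto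
      then show ?thesis unfolding K2_coset[OF True] .
    qed (use KP in \<open>auto simp: L\<close>)
    then show ?thesis unfolding right_kernel_def by blast
  qed
qed

lemma goursat_type:
  assumes "goursat_subgroup S3 (P1, K1) (P2, K2) L"
  shows "S3_subgroup L" "subgroup_type L = ((card P1, card K1), (card P2, card K2))"
  unfolding S3_subgroup_iff subgroup_type_def
  by (simp_all only: S3.goursat_subgroup_projections[OF assms finite_S3])

lemma S3_sections_nth:
  assumes "i \<in> {1..22}" "\<forall>n\<in>{1, 2, 3, 6}. card (P n) = n"
  shows "case S3_sections P ! (i - 1) of ((P1, K1), (P2, K2)) \<Rightarrow>
    ((card P1, card K1), (card P2, card K2)) = S3_types ! (i - 1)"
proof -
  have c: "card (P 1) = 1" "card (P 2) = 2" "card (P 3) = 3" "card (P 6) = 6"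
    using assms(2) by blast+
  show ?thesis
    using assms(1) unfolding range_22
    by (elim insertE emptyE) (simp_all add: S3_sections_def S3_types_def c del: One_nat_def)
qed

text \<open>The chosen representatives enter the later argument through these two facts, so the
  result holds for every admissible choice.\<close>

lemma representatives_type:
  assumes "S3_representatives P L" "i \<in> {1..22}"
  shows "S3_subgroup (L i)" "subgroup_type (L i) = S3_types ! (i - 1)"
proof -
  obtain P1 K1 P2 K2 where s: "S3_sections P ! (i - 1) = ((P1, K1), (P2, K2))"
    by (cases "S3_sections P ! (i - 1)") auto
  have P: "\<forall>n\<in>{1, 2, 3, 6}. card (P n) = n"
    using assms(1) unfolding S3_representatives_def by blast
  have G: "case S3_sections P ! (i - 1) of (s, t) \<Rightarrow> goursat_subgroup S3 s t (L i)"
    using assms(1)[unfolded S3_representatives_def, THEN conjunct2] assms(2) by (rule bspec)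
  have t: "((card P1, card K1), (card P2, card K2)) = S3_types ! (i - 1)"
    using S3_sections_nth[OF assms(2) P] unfolding s by simp
  have "goursat_subgroup S3 (P1, K1) (P2, K2) (L i)"
    using G unfolding s by simp
  from goursat_type[OF this] show "S3_subgroup (L i)" "subgroup_type (L i) = S3_types ! (i - 1)"
    unfolding t .
qed

lemma biset_vec_representatives:
  assumes "S3_representatives P L" "i \<in> {1..22}"
  shows "biset_vec (coset_biset S3 S3 (L i)) = M' i"
  unfolding biset_vec_coset[OF representatives_type(1)[OF assms]] representatives_type(2)[OF assms]
  by (rule type_coeff_S3_types[OF assms(2)])

lemma S3_types_index:
  assumes "t \<in> set S3_types"
  obtains i where "i \<in> {1..22}" "S3_types ! (i - 1) = t"
proof -
  obtain n where "n < length S3_types" "S3_types ! n = t" using assms unfolding in_set_conv_nth by blast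
  moreover have "length S3_types = 22" by (simp add: S3_types_def)
  ultimately show thesis by (intro that[of "Suc n"]) simp_all
qed

text \<open>The stabiliser of \<open>x\<close> is only conjugate to a representative; moving to the
  point y = c x g of the same orbit makes the stabiliser equal to it.\<close>

lemma orbit_isomorphic_representative:
  assumes rep: "S3_representatives P L" and X: "finite_biset S3 S3 X" and x: "x \<in> carrier X"
  shows "\<exists>i\<in>{1..22}. \<exists>y\<in>carrier X. biset_isomorphic S3 S3 (X\<lparr>carrier := biset_orbit S3 S3 X y\<rparr>) (coset_biset S3 S3 (L i))"
proof -
  interpret X: finite_biset S3 S3 X by fact
  have S: "S3_subgroup (biset_stab S3 S3 X x)" using X x by (rule S3_stab_subgroup)
  obtain i where i: "i \<in> {1..22}" "S3_types ! (i - 1) = subgroup_type (biset_stab S3 S3 X x)"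
    using S3_subgroup.type_in[OF S] by (rule S3_types_index)
  have Li: "S3_subgroup (L i)" "subgroup_type (biset_stab S3 S3 X x) = subgroup_type (L i)"
    using representatives_type[OF rep i(1)] i(2) by simp_all
  obtain c g where cg: "c \<in> carrier S3" "g \<in> carrier S3" "conj_subgroup S3 S3 c g (biset_stab S3 S3 X x) = L i"
    using S3_conjugate_of_same_type[OF S Li] by blast
  define y where "y = lact X c (ract X x g)"
  have y: "y \<in> carrier X" unfolding y_def using cg x by (intro X.lact_closed X.ract_closed)
  have "biset_stab S3 S3 X y = L i" unfolding y_def X.stab_move[OF x cg(1,2)] by (rule cg(3))
  then show ?thesis using X.orbit_isomorphic_coset[OF y] i(1) y by auto
qed

section \<open>The rows of the base change matrix\<close>

text \<open>Column 0 is listed separately: coordinates are indexed by all natural numbers, and lower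
  triangularity says nothing to the left of the diagonal.\<close>

lemma M'_triangular: "i \<in> {1..22} \<Longrightarrow> i < j \<Longrightarrow> M' i j = 0"
  and M'_diagonal: "i \<in> {1..22} \<Longrightarrow> M' i i \<noteq> 0"
  and M'_support: "i \<in> {1..22} \<Longrightarrow> M' i 0 = 0"
  unfolding range_22 by (elim insertE emptyE; simp add: M'_def M'_rows_def del: One_nat_def)+

text \<open>Take the largest index m with a nonzero coefficient and look at column m: earlier rows
  vanish there by triangularity, later rows have coefficient 0, and the diagonal entry
  survives.\<close>

lemma M'_independent:
  assumes "\<And>j. (\<Sum>i\<in>{1..22}. q i * M' i j) = 0" "i \<in> {1..22}"
  shows "q i = 0"
proof (rule ccontr)
  assume "q i \<noteq> 0"
  define S where "S = {i \<in> {1..22}. q i \<noteq> 0}"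
  define m where "m = Max S"
  have S: "finite S" "S \<noteq> {}" using assms(2) \<open>q i \<noteq> 0\<close> by (auto simp: S_def)
  have m: "m \<in> S" unfolding m_def using S by (rule Max_in)
  have zero: "q k * M' k m = 0" if "k \<in> {1..22} - {m}" for k
  proof (cases "k < m")
    case True
    then show ?thesis using M'_triangular[of k m] that by simp
  next
    case False
    then have "k \<notin> S" using Max_ge[OF S(1), of k] that unfolding m_def by auto
    then show ?thesis using that by (auto simp: S_def)
  qed
  have "(\<Sum>k\<in>{1..22}. q k * M' k m) = q m * M' m m + (\<Sum>k\<in>{1..22} - {m}. q k * M' k m)"
    using m by (intro sum.remove) (auto simp: S_def)
  also have "(\<Sum>k\<in>{1..22} - {m}. q k * M' k m) = 0"
    using zero by (rule sum.neutral[rule_format])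
  finally have "q m * M' m m = 0" using assms(1)[of m] by simp
  then show False using m M'_diagonal[of m] by (auto simp: S_def)
qed

text \<open>Elimination from the highest index downwards: subtracting a multiple of row
  \<open>Suc k\<close> kills the coordinate \<open>Suc k\<close> and creates none above it.\<close>

lemma M'_spanning:
  assumes "\<And>j. j \<notin> {1..k} \<Longrightarrow> x j = 0" "k \<le> 22"
  shows "\<exists>q. \<forall>j. x j = (\<Sum>i\<in>{1..22}. q i * M' i j)"
  using assms
proof (induction k arbitrary: x)
  case 0
  then have "x = (\<lambda>_. 0)" by (simp add: fun_eq_iff)
  then show ?case by (intro exI[of _ "\<lambda>_. 0"]) simp
next
  case (Suc k)
  let ?m = "Suc k"
  have m: "?m \<in> {1..22}" using Suc.prems(2) by simp
  define y where "y j = x j - x ?m / M' ?m ?m * M' ?m j" for j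
  have "y j = 0" if "j \<notin> {1..k}" for j
  proof -
    consider "j = 0" | "j = ?m" | "j > ?m" using \<open>j \<notin> {1..k}\<close> by force
    then show ?thesis
    proof cases
      case 1
      then show ?thesis using Suc.prems(1)[of 0] M'_support[OF m] by (simp add: y_def)
    next
      case 2
      then show ?thesis using M'_diagonal[OF m] by (simp add: y_def)
    next
      case 3
      then show ?thesis using Suc.prems(1)[of j] M'_triangular[OF m] by (simp add: y_def)
    qed
  qed
  then obtain q where q: "y j = (\<Sum>i\<in>{1..22}. q i * M' i j)" for j
    using Suc.IH[of y] Suc.prems(2) by force
  have "x j = (\<Sum>i\<in>{1..22}. (q i + (if i = ?m then x ?m / M' ?m ?m else 0)) * M' i j)" for j
  proof -
    have "(\<Sum>i\<in>{1..22}. (if i = ?m then x ?m / M' ?m ?m else 0) * M' i j) = x ?m / M' ?m ?m * M' ?m j"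
      using m by (simp add: if_distrib[of "\<lambda>z. z * _"] cong: if_cong)
    then show ?thesis using q[of j] by (simp add: y_def ring_distribs sum.distrib)
  qed
  then show ?case by (intro exI allI)
qed

lemma M'_outside: "i \<in> {1..22} \<Longrightarrow> j \<notin> {1..22} \<Longrightarrow> M' i j = 0"
  using M'_support M'_triangular by (cases "j = 0") auto

section \<open>The double Burnside group in coordinates\<close>

type_synonym S3_class = "(nat \<Rightarrow> nat, nat \<Rightarrow> nat, nat) biset set"

text \<open>The choice is harmless because the members of a class are isomorphic and
  \<open>biset_vec\<close> is an isomorphism invariant.\<close>

definition class_vec :: "S3_class \<Rightarrow> nat \<Rightarrow> rat" where
  "class_vec A = biset_vec (SOME X. X \<in> A)"

lemma class_vec:
  assumes X: "finite_biset S3 S3 X"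
  shows "class_vec (biset_class S3 S3 X) = biset_vec X"
proof -
  obtain Y :: "(nat \<Rightarrow> nat, nat \<Rightarrow> nat, nat) biset" where "finite_biset S3 S3 Y" "biset_isomorphic S3 S3 X Y"
    using finite_biset.nat_copy[OF X] by blast
  then have "Y \<in> biset_class S3 S3 X" by (simp add: biset_class_def)
  then have "(SOME Y. Y \<in> biset_class S3 S3 X) \<in> biset_class S3 S3 X" by (rule someI)
  then have "biset_isomorphic S3 S3 X (SOME Y. Y \<in> biset_class S3 S3 X)" by (simp add: biset_class_def)
  then show ?thesis unfolding class_vec_def by (rule biset_vec_iso[OF X, symmetric])
qed

abbreviation S3_classes :: "S3_class set" where
  "S3_classes \<equiv> biset_classes S3 S3"

lemma S3_classes_cases:
  assumes "A \<in> S3_classes"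
  obtains X :: "(nat \<Rightarrow> nat, nat \<Rightarrow> nat, nat) biset" where "finite_biset S3 S3 X" "A = biset_class S3 S3 X"
  using assms unfolding biset_classes_def by blast

definition union_relations :: "(S3_class \<Rightarrow>\<^sub>0 int) set" where
  "union_relations = {frag_of (biset_class S3 S3 (biset_union X Y))
      - frag_of (biset_class S3 S3 X) - frag_of (biset_class S3 S3 Y)
    | (X :: (nat \<Rightarrow> nat, nat \<Rightarrow> nat, nat) biset) (Y :: (nat \<Rightarrow> nat, nat \<Rightarrow> nat, nat) biset).
      finite_biset S3 S3 X \<and> finite_biset S3 S3 Y}"

lemma burnside_relations_S3:
  "burnside_relations S3 S3 = generate (free_Abelian_group S3_classes) union_relations"
  unfolding burnside_relations_def union_relations_def ..

lemma union_relations_subset: "union_relations \<subseteq> carrier (free_Abelian_group S3_classes)"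
proof
  fix r assume "r \<in> union_relations"
  then obtain X Y :: "(nat \<Rightarrow> nat, nat \<Rightarrow> nat, nat) biset" where XY: "finite_biset S3 S3 X" "finite_biset S3 S3 Y"
    "r = frag_of (biset_class S3 S3 (biset_union X Y)) - frag_of (biset_class S3 S3 X) - frag_of (biset_class S3 S3 Y)"
    unfolding union_relations_def by blast
  have "biset_class S3 S3 (biset_union X Y) \<in> S3_classes" "biset_class S3 S3 X \<in> S3_classes" "biset_class S3 S3 Y \<in> S3_classes"
    using XY(1,2) finite_biset_union[OF XY(1,2)] finite_biset.biset_class_in by blast+
  then show "r \<in> carrier (free_Abelian_group S3_classes)"
    unfolding XY(3) carrier_free_Abelian_group_iff by (intro keys_diff_subset) (simp_all add: keys_frag_of)
qed

lemma union_relations_value: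
  assumes "r \<in> union_relations"
  shows "frag_value (\<lambda>a. class_vec a j) r = 0"
proof -
  obtain X Y :: "(nat \<Rightarrow> nat, nat \<Rightarrow> nat, nat) biset" where XY: "finite_biset S3 S3 X" "finite_biset S3 S3 Y"
    "r = frag_of (biset_class S3 S3 (biset_union X Y)) - frag_of (biset_class S3 S3 X) - frag_of (biset_class S3 S3 Y)"
    using assms unfolding union_relations_def by blast
  show ?thesis
    unfolding XY(3)
    by (simp add: frag_value_diff class_vec[OF XY(1)] class_vec[OF XY(2)]
        class_vec[OF finite_biset_union[OF XY(1,2)]] biset_vec_union[OF XY(1,2)])
qed

section \<open>Generation and independence of the transitive classes\<close>

locale S3_basis =
  fixes P :: "nat \<Rightarrow> (nat \<Rightarrow> nat) set" and L :: "nat \<Rightarrow> ((nat \<Rightarrow> nat) \<times> (nat \<Rightarrow> nat)) set"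
  assumes rep: "S3_representatives P L"
begin

definition b_class :: "nat \<Rightarrow> S3_class" where
  "b_class i = biset_class S3 S3 (coset_biset S3 S3 (L i))"

lemma finite_biset_b: "i \<in> {1..22} \<Longrightarrow> finite_biset S3 S3 (coset_biset S3 S3 (L i))"
  using representatives_type(1)[OF rep] by (rule finite_biset_S3_coset)

lemma b_class_in: "i \<in> {1..22} \<Longrightarrow> b_class i \<in> S3_classes"
  unfolding b_class_def using finite_biset_b by (rule finite_biset.biset_class_in)

lemma class_vec_b: "i \<in> {1..22} \<Longrightarrow> class_vec (b_class i) = M' i"
  unfolding b_class_def class_vec[OF finite_biset_b] by (rule biset_vec_representatives[OF rep])

lemmas closed = generate_free_closed[OF union_relations_subset]

text \<open>Induction on the number of points, splitting off one orbit at a time; the orbit is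
  isomorphic to the coset biset of some L_i. Stability under differences and under the relations is
  what both applications supply.\<close>

lemma class_induct:
  fixes X :: "(nat \<Rightarrow> nat, nat \<Rightarrow> nat, nat) biset"
  assumes X: "finite_biset S3 S3 X"
    and zero: "T 0" and b: "\<And>i. i \<in> {1..22} \<Longrightarrow> T (frag_of (b_class i))"
    and diff: "\<And>u v. T u \<Longrightarrow> T v \<Longrightarrow> T (u - v)"
    and cong: "\<And>u v. T u \<Longrightarrow> v - u \<in> burnside_relations S3 S3 \<Longrightarrow> T v"
  shows "T (frag_of (biset_class S3 S3 X))"
  using X
proof (induction "card (carrier X)" arbitrary: X rule: less_induct)
  case (less X)
  interpret X: finite_biset S3 S3 X by (rule less.prems)
  have rel: "frag_of (biset_class S3 S3 (biset_union Y Z)) - frag_of (biset_class S3 S3 Y) - frag_of (biset_class S3 S3 Z)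
      \<in> burnside_relations S3 S3" if "finite_biset S3 S3 Y" "finite_biset S3 S3 Z"
    for Y Z :: "(nat \<Rightarrow> nat, nat \<Rightarrow> nat, nat) biset"
    unfolding burnside_relations_S3 by (rule generate.incl) (use that in \<open>auto simp: union_relations_def\<close>)
  show ?case
  proof (cases "carrier X = {}")
    case True
    \<comment> \<open>The empty biset is isomorphic to its union with itself, so the union relation
      reduces to minus its own class.\<close>
    then have "biset_isomorphic S3 S3 X (biset_union X X)"
      by (intro biset_isomorphicI[of Inl]) (auto simp: biset_union_def bij_betw_def)
    then have "biset_class S3 S3 (biset_union X X) = biset_class S3 S3 X"
      using X.biset_class_eq by blast
    then have "- frag_of (biset_class S3 S3 X) \<in> burnside_relations S3 S3"
      using rel[OF less.prems less.prems] by simp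
    then have "frag_of (biset_class S3 S3 X) - 0 \<in> burnside_relations S3 S3"
      unfolding burnside_relations_S3 using closed(4) by force
    with zero show ?thesis by (rule cong)
  next
    case False
    then obtain x where "x \<in> carrier X" by blast
    then obtain i y where i: "i \<in> {1..22}" and y: "y \<in> carrier X"
      and iso: "biset_isomorphic S3 S3 (X\<lparr>carrier := biset_orbit S3 S3 X y\<rparr>) (coset_biset S3 S3 (L i))"
      using orbit_isomorphic_representative[OF rep less.prems] by blast
    define A where "A = biset_orbit S3 S3 X y"
    let ?Y = "X\<lparr>carrier := A\<rparr>" and ?Z = "X\<lparr>carrier := carrier X - A\<rparr>"
    have A: "A \<subseteq> carrier X" "y \<in> A" unfolding A_def using X.orbit_subset[OF y] X.orbit_self[OF y] .
    have la: "lact X a x \<in> A \<longleftrightarrow> x \<in> A" if "a \<in> carrier S3" "x \<in> carrier X" for a x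
      unfolding A_def using X.orbit_lact_iff[OF y that(2,1)] .
    have ra: "ract X x a \<in> A \<longleftrightarrow> x \<in> A" if "x \<in> carrier X" "a \<in> carrier S3" for a x
      unfolding A_def using X.orbit_ract_iff[OF y that] .
    have Y: "finite_biset S3 S3 ?Y"
    proof (rule X.finite_biset_restrict[OF A(1)])
      show "lact X a x \<in> A" if "a \<in> carrier S3" "x \<in> A" for a x
        using la[OF that(1), of x] that(2) A(1) by auto
      show "ract X x a \<in> A" if "x \<in> A" "a \<in> carrier S3" for x a
        using ra[of x, OF _ that(2)] that(1) A(1) by auto
    qed
    have Z: "finite_biset S3 S3 ?Z"
    proof (rule X.finite_biset_restrict)
      show "lact X a x \<in> carrier X - A" if "a \<in> carrier S3" "x \<in> carrier X - A" for a x
        using that la[OF that(1), of x] X.lact_closed[OF that(1), of x] by simp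
      show "ract X x a \<in> carrier X - A" if "x \<in> carrier X - A" "a \<in> carrier S3" for x a
        using that ra[of x, OF _ that(2)] X.ract_closed[of x, OF _ that(2)] by simp
    qed (rule Diff_subset)
    have "card (carrier X - A) < card (carrier X)"
      using A y X.finite_carrier by (intro psubset_card_mono) auto
    then have TZ: "T (frag_of (biset_class S3 S3 ?Z))"
      using less.hyps[of ?Z] Z by simp
    have "biset_class S3 S3 ?Y = b_class i"
      unfolding b_class_def using finite_biset.biset_class_eq[OF Y] iso unfolding A_def by blast
    then have TY: "T (frag_of (biset_class S3 S3 ?Y))" using b[OF i] by simp
    have XYZ: "biset_class S3 S3 (biset_union ?Y ?Z) = biset_class S3 S3 X"
      using biset_isomorphic_split[of A X S3 S3, OF A(1) la ra]
      by (intro finite_biset.biset_class_eq[OF finite_biset_union[OF Y Z]])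
    \<comment> \<open>The sum is written as a double difference because \<open>T\<close> is only
      assumed to be stable under differences.\<close>
    have "T (frag_of (biset_class S3 S3 ?Y) - (0 - frag_of (biset_class S3 S3 ?Z)))"
      by (intro diff TY TZ zero)
    moreover have "frag_of (biset_class S3 S3 X)
        - (frag_of (biset_class S3 S3 ?Y) - (0 - frag_of (biset_class S3 S3 ?Z))) \<in> burnside_relations S3 S3"
      using rel[OF Y Z] unfolding XYZ by (simp add: algebra_simps)
    ultimately show ?thesis by (rule cong)
  qed
qed

lemma burnside_induct [consumes 1, case_names zero b diff cong]:
  assumes u: "Poly_Mapping.keys u \<subseteq> S3_classes"
    and zero: "T 0" and b: "\<And>i. i \<in> {1..22} \<Longrightarrow> T (frag_of (b_class i))"
    and diff: "\<And>u v. T u \<Longrightarrow> T v \<Longrightarrow> T (u - v)"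
    and cong: "\<And>u v. T u \<Longrightarrow> v - u \<in> burnside_relations S3 S3 \<Longrightarrow> T v"
  shows "T u"
  using u
proof (induction u rule: frag_induction)
  case (one A)
  then obtain X :: "(nat \<Rightarrow> nat, nat \<Rightarrow> nat, nat) biset" where X: "finite_biset S3 S3 X" "A = biset_class S3 S3 X"
    by (rule S3_classes_cases)
  show ?case unfolding X(2) using X(1) zero b diff cong by (rule class_induct)
qed (use zero diff in blast)+

definition b_comb :: "(nat \<Rightarrow> int) \<Rightarrow> S3_class \<Rightarrow>\<^sub>0 int" where
  "b_comb n = (\<Sum>i\<in>{1..22}. frag_cmul (n i) (frag_of (b_class i)))"

lemma b_comb_spanning:
  assumes "Poly_Mapping.keys u \<subseteq> S3_classes"
  shows "\<exists>n. u - b_comb n \<in> burnside_relations S3 S3"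
  using assms
proof (induction u rule: burnside_induct)
  case zero
  have "b_comb (\<lambda>_. 0) = 0" by (simp add: b_comb_def)
  then show ?case
    unfolding burnside_relations_S3 by (intro exI[of _ "\<lambda>_. 0"]) (simp add: closed(3))
next
  case (b i)
  have "b_comb (\<lambda>k. if k = i then 1 else 0) = (\<Sum>k\<in>{1..22}. if k = i then frag_of (b_class i) else 0)"
    unfolding b_comb_def by (rule sum.cong) auto
  also have "\<dots> = frag_of (b_class i)" using b by simp
  finally have "frag_of (b_class i) - b_comb (\<lambda>k. if k = i then 1 else 0) = 0" by simp
  then show ?case
    unfolding burnside_relations_S3
    by (intro exI[of _ "\<lambda>k. if k = i then 1 else 0"]) (simp only: closed(3))
next
  case (diff u v)
  then obtain n m where nm: "u - b_comb n \<in> burnside_relations S3 S3" "v - b_comb m \<in> burnside_relations S3 S3" by blast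
  have "b_comb (\<lambda>i. n i - m i) = b_comb n - b_comb m"
    unfolding b_comb_def sum_subtractf[symmetric] by (rule sum.cong) (simp_all add: frag_cmul_diff_distrib)
  then have eq: "u - v - b_comb (\<lambda>i. n i - m i) = (u - b_comb n) - (v - b_comb m)" by simp
  have "u - v - b_comb (\<lambda>i. n i - m i) \<in> burnside_relations S3 S3"
    unfolding eq burnside_relations_S3 by (rule closed(2)[OF nm[unfolded burnside_relations_S3]])
  then show ?case by blast
next
  case (cong u v)
  then obtain n where n: "u - b_comb n \<in> burnside_relations S3 S3" by blast
  have eq: "v - b_comb n = (v - u) + (u - b_comb n)" by simp
  have "v - b_comb n \<in> burnside_relations S3 S3"
    unfolding eq burnside_relations_S3
    by (rule closed(1)[OF cong(2)[unfolded burnside_relations_S3] n[unfolded burnside_relations_S3]])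
  then show ?case by blast
qed

lemma frag_value_cmul: "frag_value f (frag_cmul c u) = of_int c * frag_value f u"
  using frag_value_superset[OF finite_keys keys_cmul, of f c u]
  by (simp add: frag_value_def sum_distrib_left mult.assoc)

lemma b_comb_value: "frag_value (\<lambda>a. class_vec a j) (b_comb n) = (\<Sum>i\<in>{1..22}. of_int (n i) * M' i j)"
  unfolding b_comb_def frag_value_sum frag_value_cmul frag_value_frag_of by (rule sum.cong) (simp_all add: class_vec_b)

text \<open>Modulo relations every element is an integral combination of the b_i. If its coordinates
  vanish, independence of the rows makes all coefficients 0, so the element itself is a
  relation.\<close>

sublocale B: coordinates S3_classes union_relations class_vec
proof
  show "union_relations \<subseteq> carrier (free_Abelian_group S3_classes)" by (rule union_relations_subset)
  fix u :: "S3_class \<Rightarrow>\<^sub>0 int" assume u: "Poly_Mapping.keys u \<subseteq> S3_classes"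
  let ?R = "generate (free_Abelian_group S3_classes) union_relations"
  have vanish: "frag_value (\<lambda>a. class_vec a j) r = 0" if "r \<in> ?R" for r j
    using union_relations_value union_relations_subset that by (rule generate_free_value)
  show "u \<in> ?R \<longleftrightarrow> (\<forall>j. frag_value (\<lambda>a. class_vec a j) u = 0)"
  proof (intro iffI allI)
    assume zero: "\<forall>j. frag_value (\<lambda>a. class_vec a j) u = 0"
    obtain n where n: "u - b_comb n \<in> ?R"
      using b_comb_spanning[OF u] unfolding burnside_relations_S3 by blast
    have z: "(\<Sum>i\<in>{1..22}. of_int (n i) * M' i j) = 0" for j
      using vanish[OF n, of j] unfolding frag_value_diff b_comb_value zero[rule_format] by simp
    have "of_int (n i) = (0 :: rat)" if "i \<in> {1..22}" for i
      by (rule M'_independent[where q = "\<lambda>i. of_int (n i)", OF z that])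
    then have n0: "n i = 0" if "i \<in> {1..22}" for i
      using that of_int_eq_0_iff by blast
    have "b_comb n = 0"
      unfolding b_comb_def by (rule sum.neutral, rule ballI) (simp only: n0 frag_cmul_zero)
    then show "u \<in> ?R" using n by simp
  next
    fix j assume "u \<in> ?R"
    then show "frag_value (\<lambda>a. class_vec a j) u = 0" by (rule vanish)
  qed
qed

end

section \<open>The double Burnside ring and its rational extension in coordinates\<close>

text \<open>All members of the union defining \<open>class_tensor\<close> are the same class, by
  invariance of tensor products under isomorphism.\<close>

lemma class_tensor_eq:
  fixes X Y :: "(nat \<Rightarrow> nat, nat \<Rightarrow> nat, nat) biset"
  assumes X: "finite_biset S3 S3 X" and Y: "finite_biset S3 S3 Y"
  shows "class_tensor S3 (biset_class S3 S3 X) (biset_class S3 S3 Y) = biset_class S3 S3 (biset_tensor S3 X Y)"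
proof -
  have T: "finite_biset S3 S3 (biset_tensor S3 X Y)"
    by (intro composable_bisets.finite_biset_tensor composable_bisets.intro composable_bisets_axioms.intro X Y finite_S3)
  have "biset_class S3 S3 (biset_tensor S3 X' Y') = biset_class S3 S3 (biset_tensor S3 X Y)"
    if "X' \<in> biset_class S3 S3 X" "Y' \<in> biset_class S3 S3 Y" for X' Y'
    using finite_biset.biset_class_eq[OF T biset_tensor_isomorphic[OF X Y]] that
    unfolding biset_class_def by blast
  moreover have "X \<in> biset_class S3 S3 X" "Y \<in> biset_class S3 S3 Y"
    using X Y biset_isomorphic_refl by (auto simp: biset_class_def)
  ultimately show ?thesis unfolding class_tensor_def by blast
qed

lemma class_vec_tensor:
  assumes "A \<in> S3_classes" "B \<in> S3_classes"
  shows "class_tensor S3 A B \<in> S3_classes"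
    and "class_vec (class_tensor S3 A B) k = coeff_product (class_vec A) (class_vec B) k"
proof -
  obtain X :: "(nat \<Rightarrow> nat, nat \<Rightarrow> nat, nat) biset" where X: "finite_biset S3 S3 X" "A = biset_class S3 S3 X"
    using assms(1) by (rule S3_classes_cases)
  obtain Y :: "(nat \<Rightarrow> nat, nat \<Rightarrow> nat, nat) biset" where Y: "finite_biset S3 S3 Y" "B = biset_class S3 S3 Y"
    using assms(2) by (rule S3_classes_cases)
  have T: "finite_biset S3 S3 (biset_tensor S3 X Y)"
    by (intro composable_bisets.finite_biset_tensor composable_bisets.intro composable_bisets_axioms.intro X(1) Y(1) finite_S3)
  show "class_tensor S3 A B \<in> S3_classes"
    unfolding X(2) Y(2) class_tensor_eq[OF X(1) Y(1)] using T by (rule finite_biset.biset_class_in)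
  show "class_vec (class_tensor S3 A B) k = coeff_product (class_vec A) (class_vec B) k"
    unfolding X(2) Y(2) class_tensor_eq[OF X(1) Y(1)] class_vec[OF T] class_vec[OF X(1)] class_vec[OF Y(1)]
    by (rule biset_vec_tensor[OF X(1) Y(1)])
qed

lemma coeff_product_diff_left:
  "coeff_product (\<lambda>i. x i - y i) z k = coeff_product x z k - coeff_product y z k"
  using coeff_product_left[of 1 x "-1" y z k] by simp

lemma coeff_product_diff_right:
  "coeff_product z (\<lambda>i. x i - y i) k = coeff_product z x k - coeff_product z y k"
  using coeff_product_right[of z 1 x "-1" y k] by simp

lemma coeff_product_0: "coeff_product (\<lambda>_. 0) z k = 0" "coeff_product z (\<lambda>_. 0) k = 0"
  using coeff_product_diff_left[of "\<lambda>_. 0" "\<lambda>_. 0" z k] coeff_product_diff_right[of z "\<lambda>_. 0" "\<lambda>_. 0" k] by simp_all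

lemma coeff_product_frag_left:
  "coeff_product (\<lambda>j. frag_value (\<lambda>a. f a j) u) z k = frag_value (\<lambda>a. coeff_product (f a) z k) u"
proof -
  have "Poly_Mapping.keys u \<subseteq> UNIV" by simp
  then show ?thesis
    by (induction u rule: frag_induction) (simp_all add: coeff_product_0 frag_value_diff coeff_product_diff_left)
qed

lemma coeff_product_frag_right:
  "coeff_product z (\<lambda>j. frag_value (\<lambda>a. f a j) u) k = frag_value (\<lambda>a. coeff_product z (f a) k) u"
proof -
  have "Poly_Mapping.keys u \<subseteq> UNIV" by simp
  then show ?thesis
    by (induction u rule: frag_induction) (simp_all add: coeff_product_0 frag_value_diff coeff_product_diff_right)
qed

text \<open>The shared extension step for both products: a rule on generators that multiplies
  coordinates by \<open>coeff_product\<close> does so for all formal combinations.\<close>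

lemma frag_bilinear:
  assumes "\<And>a b. a \<in> S \<Longrightarrow> b \<in> S \<Longrightarrow> t a b \<in> S"
    and "\<And>a b k. a \<in> S \<Longrightarrow> b \<in> S \<Longrightarrow> f (t a b) k = coeff_product (f a) (f b) k"
    and u: "Poly_Mapping.keys u \<subseteq> S" and v: "Poly_Mapping.keys v \<subseteq> S"
  defines "w \<equiv> frag_extend (\<lambda>a. frag_extend (\<lambda>b. frag_of (t a b)) v) u"
  shows "Poly_Mapping.keys w \<subseteq> S"
    and "frag_value (\<lambda>a. f a k) w = coeff_product (\<lambda>j. frag_value (\<lambda>a. f a j) u) (\<lambda>j. frag_value (\<lambda>a. f a j) v) k"
proof -
  show "Poly_Mapping.keys w \<subseteq> S"
    unfolding w_def
    by (rule keys_frag_extend_subset[OF u], rule keys_frag_extend_subset[OF v]) (use assms(1) in \<open>simp add: keys_frag_of\<close>)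
  have "frag_value (\<lambda>a. f a k) w = frag_value (\<lambda>a. frag_value (\<lambda>b. f (t a b) k) v) u"
    unfolding w_def frag_value_extend frag_value_frag_of ..
  also have "\<dots> = frag_value (\<lambda>a. frag_value (\<lambda>b. coeff_product (f a) (f b) k) v) u"
    by (intro frag_value_cong assms(2)) (use u v in blast)+
  also have "\<dots> = coeff_product (\<lambda>j. frag_value (\<lambda>a. f a j) u) (\<lambda>j. frag_value (\<lambda>a. f a j) v) k"
    unfolding coeff_product_frag_left coeff_product_frag_right ..
  finally show "frag_value (\<lambda>a. f a k) w
    = coeff_product (\<lambda>j. frag_value (\<lambda>a. f a j) u) (\<lambda>j. frag_value (\<lambda>a. f a j) v) k" .
qed

context S3_basis
begin

abbreviation BR where "BR \<equiv> burnside_ring S3"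

lemma BR_simps:
  "carrier BR = carrier B.Q" "add BR = monoid.mult B.Q" "zero BR = one B.Q"
  "burnside_of S3 S3 X = B.coset (frag_of (biset_class S3 S3 X))"
  by (simp_all add: burnside_ring_def burnside_group_def burnside_of_def B.Q_def B.coset_def burnside_relations_S3)

lemma BR_mult:
  assumes "U \<in> carrier BR" "U' \<in> carrier BR"
  shows "U \<otimes>\<^bsub>BR\<^esub> U' \<in> carrier BR" and "B.cval (U \<otimes>\<^bsub>BR\<^esub> U') = coeff_product (B.cval U) (B.cval U')"
proof -
  have mult: "U \<otimes>\<^bsub>BR\<^esub> U' = (\<Union>u\<in>U. \<Union>u'\<in>U'. B.R #>\<^bsub>B.F\<^esub> frag_tensor S3 u u')"
    by (simp add: burnside_ring_def burnside_relations_S3)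
  have t: "Poly_Mapping.keys (frag_tensor S3 u u') \<subseteq> S3_classes \<and> B.V (frag_tensor S3 u u') = coeff_product (B.V u) (B.V u')"
    if "Poly_Mapping.keys u \<subseteq> S3_classes" "Poly_Mapping.keys u' \<subseteq> S3_classes" for u u'
  proof
    show "Poly_Mapping.keys (frag_tensor S3 u u') \<subseteq> S3_classes"
      unfolding frag_tensor_def by (rule frag_bilinear(1)[OF class_vec_tensor that])
    show "B.V (frag_tensor S3 u u') = coeff_product (B.V u) (B.V u')"
      unfolding B.V_def[abs_def] frag_tensor_def
      by (rule ext) (rule frag_bilinear(2)[OF class_vec_tensor that])
  qed
  note op = B.bilinear_op[where t = "frag_tensor S3" and m = coeff_product, OF assms[unfolded BR_simps]]
  show "U \<otimes>\<^bsub>BR\<^esub> U' \<in> carrier BR"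
    unfolding mult BR_simps by (rule op(1)) (erule (1) t)
  show "B.cval (U \<otimes>\<^bsub>BR\<^esub> U') = coeff_product (B.cval U) (B.cval U')"
    unfolding mult by (rule op(2)) (erule (1) t)
qed

lemma burnside_of_in:
  assumes "finite_biset S3 S3 X"
  shows "burnside_of S3 S3 X \<in> carrier BR" "B.cval (burnside_of S3 S3 X) = biset_vec X"
proof -
  have "biset_class S3 S3 X \<in> S3_classes" using assms by (rule finite_biset.biset_class_in)
  then have k: "Poly_Mapping.keys (frag_of (biset_class S3 S3 X)) \<subseteq> S3_classes" by (simp add: keys_frag_of)
  show "burnside_of S3 S3 X \<in> carrier BR" unfolding BR_simps using k by (rule B.coset_in)
  show "B.cval (burnside_of S3 S3 X) = biset_vec X"
    unfolding BR_simps B.cval_coset[OF k] by (simp add: B.V_def class_vec[OF assms] fun_eq_iff)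
qed

definition b_el :: "nat \<Rightarrow> (S3_class \<Rightarrow>\<^sub>0 int) set" where
  "b_el i = burnside_of S3 S3 (coset_biset S3 S3 (L i))"

lemma b_el: "i \<in> {1..22} \<Longrightarrow> b_el i \<in> carrier BR" "i \<in> {1..22} \<Longrightarrow> B.cval (b_el i) = M' i"
  unfolding b_el_def using burnside_of_in[OF finite_biset_b] biset_vec_representatives[OF rep] by simp_all

section \<open>Rational tensors modulo bilinearity\<close>

definition tensor_relations :: "(rat \<times> (S3_class \<Rightarrow>\<^sub>0 int) set \<Rightarrow>\<^sub>0 int) set" where
  "tensor_relations = {frag_of (p + q, a) - frag_of (p, a) - frag_of (q, a) | p q a. a \<in> carrier BR} \<union>
     {frag_of (p, a \<oplus>\<^bsub>BR\<^esub> b) - frag_of (p, a) - frag_of (p, b) | p a b. a \<in> carrier BR \<and> b \<in> carrier BR}"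

lemma rat_tensor_relations_BR:
  "rat_tensor_relations BR = generate (free_Abelian_group (UNIV \<times> carrier BR)) tensor_relations"
  unfolding rat_tensor_relations_def tensor_relations_def rat_tensor_free_def ..

definition tensor_val :: "rat \<times> (S3_class \<Rightarrow>\<^sub>0 int) set \<Rightarrow> nat \<Rightarrow> rat" where
  "tensor_val x j = fst x * B.cval (snd x) j"

lemma BR_add:
  assumes "a \<in> carrier BR" "b \<in> carrier BR"
  shows "a \<oplus>\<^bsub>BR\<^esub> b \<in> carrier BR" "B.cval (a \<oplus>\<^bsub>BR\<^esub> b) = (\<lambda>j. B.cval a j + B.cval b j)"
  using B.Q_mult[OF assms[unfolded BR_simps]] unfolding BR_simps .

lemma tensor_relations_subset: "tensor_relations \<subseteq> carrier (free_Abelian_group (UNIV \<times> carrier BR))"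
proof
  have k: "frag_of x - frag_of y - frag_of z \<in> carrier (free_Abelian_group (UNIV \<times> carrier BR))"
    if "snd x \<in> carrier BR" "snd y \<in> carrier BR" "snd z \<in> carrier BR"
    for x y z :: "rat \<times> (S3_class \<Rightarrow>\<^sub>0 int) set"
    unfolding carrier_free_Abelian_group_iff
  proof (intro keys_diff_subset)
    show "Poly_Mapping.keys (frag_of x) \<subseteq> UNIV \<times> carrier BR" using that(1) by (cases x) (simp add: keys_frag_of)
    show "Poly_Mapping.keys (frag_of y) \<subseteq> UNIV \<times> carrier BR" using that(2) by (cases y) (simp add: keys_frag_of)
    show "Poly_Mapping.keys (frag_of z) \<subseteq> UNIV \<times> carrier BR" using that(3) by (cases z) (simp add: keys_frag_of)
  qed
  fix r assume "r \<in> tensor_relations"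
  then consider p q a where "a \<in> carrier BR" "r = frag_of (p + q, a) - frag_of (p, a) - frag_of (q, a)"
    | p a b where "a \<in> carrier BR" "b \<in> carrier BR" "r = frag_of (p, a \<oplus>\<^bsub>BR\<^esub> b) - frag_of (p, a) - frag_of (p, b)"
    unfolding tensor_relations_def by blast
  then show "r \<in> carrier (free_Abelian_group (UNIV \<times> carrier BR))"
  proof cases
    case 1
    show ?thesis unfolding 1(2) by (intro k) (simp_all only: snd_conv 1(1))
  next
    case 2
    show ?thesis unfolding 2(3) by (intro k) (simp_all only: snd_conv 2(1,2) BR_add(1))
  qed
qed

lemma tensor_relations_value: "r \<in> tensor_relations \<Longrightarrow> frag_value (\<lambda>x. tensor_val x j) r = 0"
  unfolding tensor_relations_def
  by (auto simp: frag_value_diff tensor_val_def BR_add(2) ring_distribs)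

lemmas tensor_closed = generate_free_closed[OF tensor_relations_subset]

abbreviation TR where "TR \<equiv> generate (free_Abelian_group (UNIV \<times> carrier BR)) tensor_relations"

lemma TR_left: "a \<in> carrier BR \<Longrightarrow> frag_of (p + q, a) - frag_of (p, a) - frag_of (q, a) \<in> TR"
  by (rule tensor_closed(6)) (auto simp: tensor_relations_def)

lemma TR_right: "a \<in> carrier BR \<Longrightarrow> b \<in> carrier BR \<Longrightarrow> frag_of (p, a \<oplus>\<^bsub>BR\<^esub> b) - frag_of (p, a) - frag_of (p, b) \<in> TR"
  by (rule tensor_closed(6)) (auto simp: tensor_relations_def)

text \<open>The relation for 0 + 0 reads minus the generator (0, a).\<close>

lemma TR_zero: "a \<in> carrier BR \<Longrightarrow> frag_of (0, a) \<in> TR"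
  using tensor_closed(4)[OF TR_left[of a 0 0]] by simp

text \<open>Rational coefficients sit in the first components of the pairs: the free abelian group
  itself allows only integral multiples.\<close>

definition t_comb :: "(nat \<Rightarrow> rat) \<Rightarrow> rat \<times> (S3_class \<Rightarrow>\<^sub>0 int) set \<Rightarrow>\<^sub>0 int" where
  "t_comb q = (\<Sum>i\<in>{1..22}. frag_of (q i, b_el i))"

lemma TR_sum: "(\<And>i. i \<in> I \<Longrightarrow> g i \<in> TR) \<Longrightarrow> sum g I \<in> TR"
  by (induction I rule: infinite_finite_induct) (simp_all add: tensor_closed(1,3))

text \<open>Additivity in the first component is applied termwise to q_i = (q_i - r_i) +
  r_i.\<close>

lemma t_comb_diff: "t_comb (\<lambda>i. q i - r i) - (t_comb q - t_comb r) \<in> TR"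
proof -
  have "t_comb (\<lambda>i. q i - r i) - (t_comb q - t_comb r)
      = (\<Sum>i\<in>{1..22}. - (frag_of (q i - r i + r i, b_el i) - frag_of (q i - r i, b_el i) - frag_of (r i, b_el i)))"
    unfolding t_comb_def by (simp add: sum_subtractf sum_negf sum.distrib algebra_simps)
  also have "\<dots> \<in> TR"
    by (intro TR_sum tensor_closed(4) TR_left b_el(1))
  finally show ?thesis .
qed

definition spanned :: "(rat \<times> (S3_class \<Rightarrow>\<^sub>0 int) set \<Rightarrow>\<^sub>0 int) \<Rightarrow> bool" where
  "spanned u \<longleftrightarrow> (\<exists>q. u - t_comb q \<in> TR)"

lemma spanned_diff:
  assumes "spanned u" "spanned v"
  shows "spanned (u - v)"
proof -
  obtain q r where q: "u - t_comb q \<in> TR" and r: "v - t_comb r \<in> TR" using assms unfolding spanned_def by blast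
  have eq: "u - v - t_comb (\<lambda>i. q i - r i)
      = (u - t_comb q) - (v - t_comb r) - (t_comb (\<lambda>i. q i - r i) - (t_comb q - t_comb r))" by simp
  have "u - v - t_comb (\<lambda>i. q i - r i) \<in> TR"
    unfolding eq by (intro tensor_closed(2) q r t_comb_diff)
  then show ?thesis unfolding spanned_def by - (rule exI, assumption)
qed

lemma spanned_cong:
  assumes "spanned u" "v - u \<in> TR"
  shows "spanned v"
proof -
  obtain q where q: "u - t_comb q \<in> TR" using assms unfolding spanned_def by blast
  have eq: "v - t_comb q = (v - u) + (u - t_comb q)" by simp
  have "v - t_comb q \<in> TR" unfolding eq by (intro tensor_closed(1) q assms(2))
  then show ?thesis unfolding spanned_def by - (rule exI, assumption)
qed

lemma spanned_b:
  assumes i: "i \<in> {1..22}"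
  shows "spanned (frag_of (p, b_el i))"
proof -
  let ?q = "\<lambda>k. if k = i then p else 0"
  have "t_comb ?q = frag_of (p, b_el i) + (\<Sum>k\<in>{1..22} - {i}. frag_of (?q k, b_el k))"
    unfolding t_comb_def using i by (subst sum.remove[of _ i]) auto
  then have eq: "frag_of (p, b_el i) - t_comb ?q = - (\<Sum>k\<in>{1..22} - {i}. frag_of (?q k, b_el k))" by simp
  have "frag_of (?q k, b_el k) \<in> TR" if "k \<in> {1..22} - {i}" for k
    using that TR_zero[OF b_el(1), of k] by auto
  then have "frag_of (p, b_el i) - t_comb ?q \<in> TR"
    unfolding eq by (intro tensor_closed(4) TR_sum)
  then show ?thesis unfolding spanned_def by - (rule exI, assumption)
qed

lemma spanned_0: "spanned 0"
  using spanned_diff[OF spanned_b spanned_b, of 1 1 0 0] by simp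

text \<open>The induction runs over a representative of the class in the second component. The bound
  on the keys is carried along because adding cosets requires it at each difference.\<close>

lemma spanned_coset:
  assumes "Poly_Mapping.keys u \<subseteq> S3_classes"
  shows "Poly_Mapping.keys u \<subseteq> S3_classes \<and> (\<forall>p. spanned (frag_of (p, B.coset u)))"
  using assms
proof (induction u rule: burnside_induct)
  case zero
  have in0: "B.coset 0 \<in> carrier BR" unfolding BR_simps by (rule B.coset_in) simp
  have add: "B.coset 0 \<oplus>\<^bsub>BR\<^esub> B.coset 0 = B.coset 0" unfolding BR_simps by (subst B.coset_add) simp_all
  have "frag_of (p, B.coset 0) - 0 \<in> TR" for p
    using tensor_closed(4)[OF TR_right[OF in0 in0, of p]] unfolding add by simp
  then show ?case using spanned_cong[OF spanned_0] by (intro conjI allI) simp_all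
next
  case (b i)
  have "B.coset (frag_of (b_class i)) = b_el i" unfolding b_el_def BR_simps b_class_def ..
  then show ?case using spanned_b[OF b] b_class_in[OF b] by (simp add: keys_frag_of)
next
  case (diff u v)
  then have k: "Poly_Mapping.keys u \<subseteq> S3_classes" "Poly_Mapping.keys v \<subseteq> S3_classes" "Poly_Mapping.keys (u - v) \<subseteq> S3_classes"
    using keys_diff_subset by blast+
  have c: "B.coset u \<in> carrier BR" "B.coset v \<in> carrier BR" "B.coset (u - v) \<in> carrier BR"
    unfolding BR_simps using k by (blast intro: B.coset_in)+
  have add: "B.coset (u - v) \<oplus>\<^bsub>BR\<^esub> B.coset v = B.coset u" unfolding BR_simps using k by (subst B.coset_add) simp_all
  have "spanned (frag_of (p, B.coset (u - v)))" for p
  proof (rule spanned_cong)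
    show "spanned (frag_of (p, B.coset u) - frag_of (p, B.coset v))" using diff by (intro spanned_diff) blast+
    show "frag_of (p, B.coset (u - v)) - (frag_of (p, B.coset u) - frag_of (p, B.coset v)) \<in> TR"
      using tensor_closed(4)[OF TR_right[OF c(3,2), of p]] unfolding add by (simp add: algebra_simps)
  qed
  then show ?case using k(3) by blast
next
  case (cong u v)
  have r: "v - u \<in> B.R" using cong(2) unfolding burnside_relations_S3 .
  have "Poly_Mapping.keys ((v - u) + u) \<subseteq> S3_classes"
    using closed(5)[OF r] cong(1) by (intro keys_add_subset) blast+
  then have k: "Poly_Mapping.keys v \<subseteq> S3_classes" by simp
  have "B.coset v = B.coset u"
    using r k cong(1) B.kernel[OF closed(5)[OF r]]
    by (subst B.coset_eq_iff) (simp_all add: B.V_def fun_eq_iff frag_value_diff)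
  then show ?case using cong(1) k by simp
qed

lemma spanned:
  assumes "Poly_Mapping.keys u \<subseteq> UNIV \<times> carrier BR"
  shows "spanned u"
  using assms
proof (induction u rule: frag_induction)
  case zero
  show ?case by (rule spanned_0)
next
  case (one x)
  obtain p a where x: "x = (p, a)" by (cases x)
  with one have "a \<in> carrier B.Q" unfolding BR_simps by simp
  then obtain u where "Poly_Mapping.keys u \<subseteq> S3_classes" "a = B.coset u" by (rule B.carrier_cases)
  then show ?case unfolding x using spanned_coset by blast
next
  case (diff u v)
  then show ?case by (rule spanned_diff)
qed

lemma t_comb_value: "frag_value (\<lambda>x. tensor_val x j) (t_comb q) = (\<Sum>i\<in>{1..22}. q i * M' i j)"
  unfolding t_comb_def frag_value_sum frag_value_frag_of
  by (rule sum.cong) (simp_all add: tensor_val_def b_el(2))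

text \<open>The argument of the integral case is repeated with rational coefficients: a combination
  of tensors q_i with b_i whose coordinates vanish has all q_i = 0, and such tensors are
  relations.\<close>

sublocale T: coordinates "UNIV \<times> carrier BR" tensor_relations tensor_val
proof
  show "tensor_relations \<subseteq> carrier (free_Abelian_group (UNIV \<times> carrier BR))" by (rule tensor_relations_subset)
  fix u :: "rat \<times> (S3_class \<Rightarrow>\<^sub>0 int) set \<Rightarrow>\<^sub>0 int"
  assume u: "Poly_Mapping.keys u \<subseteq> UNIV \<times> carrier BR"
  have vanish: "frag_value (\<lambda>x. tensor_val x j) r = 0" if "r \<in> TR" for r j
    using tensor_relations_value tensor_relations_subset that by (rule generate_free_value)
  show "u \<in> TR \<longleftrightarrow> (\<forall>j. frag_value (\<lambda>x. tensor_val x j) u = 0)"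
  proof (intro iffI allI)
    assume zero: "\<forall>j. frag_value (\<lambda>x. tensor_val x j) u = 0"
    obtain q where q: "u - t_comb q \<in> TR" using spanned[OF u] unfolding spanned_def by blast
    have z: "(\<Sum>i\<in>{1..22}. q i * M' i j) = 0" for j
      using vanish[OF q, of j] unfolding frag_value_diff t_comb_value zero[rule_format] by simp
    have "q i = 0" if "i \<in> {1..22}" for i
      by (rule M'_independent[OF z that])
    then have "t_comb q \<in> TR" unfolding t_comb_def using TR_zero[OF b_el(1)] by (intro TR_sum) simp
    then have "(u - t_comb q) + t_comb q \<in> TR" using q by (intro tensor_closed(1))
    then show "u \<in> TR" by simp
  next
    fix j assume "u \<in> TR"
    then show "frag_value (\<lambda>a. tensor_val a j) u = 0" by (rule vanish)
  qed
qed

end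

section \<open>The matrix algebra and the isomorphism\<close>

lemma beta_matrix_carrier: "beta_matrix x \<in> carrier_mat 8 8"
  unfolding beta_matrix_def
  by (rule carrier_matI; unfold mat_of_rows_list_def dim_row_mat dim_col_mat list.size) simp_all

lemma eq_mat_8I:
  assumes "A \<in> carrier_mat 8 8" "B \<in> carrier_mat 8 8"
    and "\<And>i j. i \<in> {0, 1, 2, 3, 4, 5, 6, 7} \<Longrightarrow> j \<in> {0, 1, 2, 3, 4, 5, 6, 7} \<Longrightarrow> A $$ (i, j) = B $$ (i, j)"
  shows "A = B"
proof (rule eq_matI)
  fix i j assume "i < dim_row B" "j < dim_col B"
  then have "i \<in> {0, 1, 2, 3, 4, 5, 6, 7}" "j \<in> {0, 1, 2, 3, 4, 5, 6, 7}" using assms(2) by auto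
  then show "A $$ (i, j) = B $$ (i, j)" by (rule assms(3))
qed (use assms in auto)

lemma beta_matrix_add: "beta_matrix (\<lambda>j. x j + y j) = beta_matrix x + beta_matrix y"
proof (rule eq_mat_8I)
  fix i j :: nat assume "i \<in> {0, 1, 2, 3, 4, 5, 6, 7}" "j \<in> {0, 1, 2, 3, 4, 5, 6, 7}"
  then show "beta_matrix (\<lambda>j. x j + y j) $$ (i, j) = (beta_matrix x + beta_matrix y) $$ (i, j)"
    by (elim insertE emptyE) (simp_all add: beta_matrix_def mat_of_rows_list_def)
qed (simp_all add: beta_matrix_carrier)

lemma beta_matrix_smult: "beta_matrix (\<lambda>j. r * x j) = r \<cdot>\<^sub>m beta_matrix x"
proof (rule eq_mat_8I)
  fix i j :: nat assume "i \<in> {0, 1, 2, 3, 4, 5, 6, 7}" "j \<in> {0, 1, 2, 3, 4, 5, 6, 7}"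
  then show "beta_matrix (\<lambda>j. r * x j) $$ (i, j) = (r \<cdot>\<^sub>m beta_matrix x) $$ (i, j)"
    by (elim insertE emptyE) (simp_all add: beta_matrix_def mat_of_rows_list_def)
qed (simp_all add: beta_matrix_carrier)

lemma beta_matrix_cong: "(\<And>j. j \<in> {1..22} \<Longrightarrow> x j = y j) \<Longrightarrow> beta_matrix x = beta_matrix y"
  unfolding range_22 beta_matrix_def by (simp only: insert_iff simp_thms)

lemma rat_ring_simps:
  "carrier rat_ring = UNIV" "monoid.mult rat_ring = (*)" "one rat_ring = 1" "add rat_ring = (+)" "zero rat_ring = 0"
  by (simp_all add: ring_of_type_algebra_def)

abbreviation (input) mat8 :: "(rat, rat mat) module" where
  "mat8 \<equiv> module_mat TYPE(rat) 8 8"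

lemma assoc_algebra_mat: "assoc_algebra rat_ring (module_mat TYPE(rat) n n)"
proof -
  interpret A: abelian_group "module_mat TYPE(rat) n n" by (rule abelian_group_mat)
  have "monoid (module_mat TYPE(rat) n n)"
    by (rule monoidI) (auto simp: module_mat_simps assoc_mult_mat)
  then have r: "ring (module_mat TYPE(rat) n n)"
    by (intro ringI A.abelian_group_axioms) (auto simp: module_mat_simps add_mult_distrib_mat mult_add_distrib_mat)
  have m: "module rat_ring (module_mat TYPE(rat) n n)"
    by (intro moduleI cring_from_type_algebra A.abelian_group_axioms)
      (auto simp: module_mat_simps rat_ring_simps algebra_simps intro!: eq_matI)
  show ?thesis
    by (intro assoc_algebra.intro assoc_algebra_axioms.intro m r)
      (auto simp: module_mat_simps mult_smult_assoc_mat mult_smult_distrib)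
qed

text \<open>Forward substitution in the triangular system. Where \<open>M'_independent\<close>
  concerns combinations of rows, this gives uniqueness of the solution c of b = M' c.\<close>

lemma M'_row_independent:
  assumes "\<And>i. i \<in> {1..22} \<Longrightarrow> (\<Sum>j\<in>{1..22}. M' i j * d j) = 0" "i \<in> {1..22}"
  shows "d i = 0"
  using assms(2)
proof (induction i rule: less_induct)
  case (less i)
  have "M' i k * d k = 0" if "k \<in> {1..22} - {i}" for k
  proof (cases "k < i")
    case True
    then show ?thesis using less.IH[of k] that by simp
  next
    case False
    then show ?thesis using M'_triangular[OF less.prems, of k] that by simp
  qed
  then have z: "(\<Sum>k\<in>{1..22} - {i}. M' i k * d k) = 0" by (rule sum.neutral[rule_format])
  have "M' i i * d i + (\<Sum>k\<in>{1..22} - {i}. M' i k * d k) = 0"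
    using assms(1)[OF less.prems] sum.remove[of "{1..22}" i "\<lambda>k. M' i k * d k"] less.prems by simp
  then show ?case using M'_diagonal[OF less.prems] unfolding z by simp
qed

section \<open>Operations of the rational algebra in coordinates\<close>

context S3_basis
begin

abbreviation C where "C \<equiv> carrier (QB S3)"

lemma QB_simps:
  "C = carrier T.Q" "add (QB S3) = monoid.mult T.Q" "zero (QB S3) = one T.Q"
  "pure_tensor BR q a = T.coset (frag_of (q, a))"
  by (simp_all add: QB_def rat_tensor_def rat_tensor_group_def rat_tensor_free_def T.Q_def T.coset_def
      pure_tensor_def rat_tensor_relations_BR)

lemma QB_add:
  assumes "x \<in> C" "y \<in> C"
  shows "x \<oplus>\<^bsub>QB S3\<^esub> y \<in> C" "T.cval (x \<oplus>\<^bsub>QB S3\<^esub> y) = (\<lambda>j. T.cval x j + T.cval y j)"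
  using T.Q_mult[OF assms[unfolded QB_simps]] unfolding QB_simps .

lemma QB_zero: "\<zero>\<^bsub>QB S3\<^esub> \<in> C" "T.cval \<zero>\<^bsub>QB S3\<^esub> = (\<lambda>j. 0)"
  using T.Q_one(2,3) unfolding QB_simps .

lemma QB_mult:
  assumes "x \<in> C" "y \<in> C"
  shows "x \<otimes>\<^bsub>QB S3\<^esub> y \<in> C" "T.cval (x \<otimes>\<^bsub>QB S3\<^esub> y) = coeff_product (T.cval x) (T.cval y)"
proof -
  define t where "t u v = frag_extend (\<lambda>x. frag_extend (\<lambda>y. frag_of (fst x * fst y, snd x \<otimes>\<^bsub>BR\<^esub> snd y)) v) u"
    for u v :: "rat \<times> (S3_class \<Rightarrow>\<^sub>0 int) set \<Rightarrow>\<^sub>0 int"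
  have mult: "x \<otimes>\<^bsub>QB S3\<^esub> y = (\<Union>u\<in>x. \<Union>v\<in>y. T.R #>\<^bsub>T.F\<^esub> t u v)"
    unfolding t_def by (simp add: QB_def rat_tensor_def rat_tensor_relations_BR rat_tensor_free_def case_prod_beta')
  have val: "tensor_val (fst a * fst b, snd a \<otimes>\<^bsub>BR\<^esub> snd b) k = coeff_product (tensor_val a) (tensor_val b) k"
    "(fst a * fst b, snd a \<otimes>\<^bsub>BR\<^esub> snd b) \<in> UNIV \<times> carrier BR"
    if "a \<in> UNIV \<times> carrier BR" "b \<in> UNIV \<times> carrier BR" for a b k
  proof -
    have ab: "snd a \<in> carrier BR" "snd b \<in> carrier BR" using that by auto
    show "tensor_val (fst a * fst b, snd a \<otimes>\<^bsub>BR\<^esub> snd b) k = coeff_product (tensor_val a) (tensor_val b) k"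
      unfolding tensor_val_def[abs_def] coeff_product_scale fst_conv snd_conv BR_mult(2)[OF ab] ..
    show "(fst a * fst b, snd a \<otimes>\<^bsub>BR\<^esub> snd b) \<in> UNIV \<times> carrier BR"
      using BR_mult(1)[OF ab] by simp
  qed
  have t: "Poly_Mapping.keys (t u v) \<subseteq> UNIV \<times> carrier BR \<and> T.V (t u v) = coeff_product (T.V u) (T.V v)"
    if uv: "Poly_Mapping.keys u \<subseteq> UNIV \<times> carrier BR" "Poly_Mapping.keys v \<subseteq> UNIV \<times> carrier BR" for u v
  proof
    show "Poly_Mapping.keys (t u v) \<subseteq> UNIV \<times> carrier BR"
      unfolding t_def by (rule frag_bilinear(1)[OF val(2,1) uv])
    show "T.V (t u v) = coeff_product (T.V u) (T.V v)"
      unfolding T.V_def[abs_def] t_def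
      by (rule ext) (rule frag_bilinear(2)[OF val(2,1) uv])
  qed
  note op = T.bilinear_op[where t = t and m = coeff_product, OF assms[unfolded QB_simps]]
  show "x \<otimes>\<^bsub>QB S3\<^esub> y \<in> C"
    unfolding mult QB_simps by (rule op(1)) (erule (1) t)
  show "T.cval (x \<otimes>\<^bsub>QB S3\<^esub> y) = coeff_product (T.cval x) (T.cval y)"
    unfolding mult by (rule op(2)) (erule (1) t)
qed

lemma QB_smult:
  assumes "x \<in> C"
  shows "r \<odot>\<^bsub>QB S3\<^esub> x \<in> C" "T.cval (r \<odot>\<^bsub>QB S3\<^esub> x) = (\<lambda>j. r * T.cval x j)"
proof -
  define t where "t u = frag_extend (\<lambda>x. frag_of (r * fst x, snd x)) u" for u :: "rat \<times> (S3_class \<Rightarrow>\<^sub>0 int) set \<Rightarrow>\<^sub>0 int"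
  have smult: "r \<odot>\<^bsub>QB S3\<^esub> x = (\<Union>u\<in>x. T.R #>\<^bsub>T.F\<^esub> t u)"
    unfolding t_def by (simp add: QB_def rat_tensor_def rat_tensor_relations_BR rat_tensor_free_def case_prod_beta')
  have t: "Poly_Mapping.keys (t u) \<subseteq> UNIV \<times> carrier BR \<and> T.V (t u) = (\<lambda>j. r * T.V u j)"
    if u: "Poly_Mapping.keys u \<subseteq> UNIV \<times> carrier BR" for u
  proof
    show "Poly_Mapping.keys (t u) \<subseteq> UNIV \<times> carrier BR"
      unfolding t_def by (rule keys_frag_extend_subset[OF u]) (auto simp: keys_frag_of)
    show "T.V (t u) = (\<lambda>j. r * T.V u j)"
      unfolding T.V_def[abs_def] t_def frag_value_extend frag_value_frag_of frag_value_scale[symmetric]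
      by (simp add: tensor_val_def mult.assoc)
  qed
  note op = T.linear_op[where t = t and m = "\<lambda>v j. r * v j", OF assms[unfolded QB_simps]]
  show "r \<odot>\<^bsub>QB S3\<^esub> x \<in> C"
    unfolding smult QB_simps by (rule op(1)) (erule t)
  show "T.cval (r \<odot>\<^bsub>QB S3\<^esub> x) = (\<lambda>j. r * T.cval x j)"
    unfolding smult by (rule op(2)) (erule t)
qed

lemma QB_of:
  assumes "finite_biset S3 S3 X"
  shows "QB_of S3 X \<in> C" "T.cval (QB_of S3 X) = biset_vec X"
proof -
  have k: "Poly_Mapping.keys (frag_of (1 :: rat, burnside_of S3 S3 X)) \<subseteq> UNIV \<times> carrier BR"
    using burnside_of_in(1)[OF assms] by (simp add: keys_frag_of)
  show "QB_of S3 X \<in> C" unfolding QB_of_def QB_simps using k by (rule T.coset_in)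
  show "T.cval (QB_of S3 X) = biset_vec X"
    unfolding QB_of_def QB_simps T.cval_coset[OF k]
    by (simp add: T.V_def[abs_def] tensor_val_def burnside_of_in(2)[OF assms])
qed

lemma QB_one: "\<one>\<^bsub>QB S3\<^esub> \<in> C" "beta_matrix (T.cval \<one>\<^bsub>QB S3\<^esub>) = 1\<^sub>m 8"
proof -
  have one: "\<one>\<^bsub>QB S3\<^esub> = QB_of S3 (regular_biset S3)"
    by (simp add: QB_def rat_tensor_def QB_of_def burnside_ring_def)
  have X: "finite_biset S3 S3 (regular_biset S3)"
    by (rule finite_biset_regular[OF S3.group_axioms finite_S3])
  show "\<one>\<^bsub>QB S3\<^esub> \<in> C" unfolding one by (rule QB_of(1)[OF X])
  show "beta_matrix (T.cval \<one>\<^bsub>QB S3\<^esub>) = 1\<^sub>m 8"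
    unfolding one QB_of(2)[OF X] biset_vec_regular by (rule beta_matrix_one)
qed

lemma QB_inj: "x \<in> C \<Longrightarrow> y \<in> C \<Longrightarrow> T.cval x = T.cval y \<Longrightarrow> x = y"
  unfolding QB_simps by (rule T.cval_inj)

lemma QB_support:
  assumes "x \<in> C" "j \<notin> {1..22}"
  shows "T.cval x j = 0"
proof -
  obtain u where u: "Poly_Mapping.keys u \<subseteq> UNIV \<times> carrier BR" "x = T.coset u"
    using assms(1) unfolding QB_simps by (rule T.carrier_cases)
  obtain q where q: "u - t_comb q \<in> TR" using spanned[OF u(1)] unfolding spanned_def by blast
  have "frag_value (\<lambda>x. tensor_val x j) (u - t_comb q) = 0"
    using tensor_relations_value tensor_relations_subset q by (rule generate_free_value)
  then have "frag_value (\<lambda>x. tensor_val x j) u = (\<Sum>i\<in>{1..22}. q i * M' i j)"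
    unfolding frag_value_diff t_comb_value by simp
  also have "\<dots> = 0" using M'_outside[OF _ assms(2)] by (intro sum.neutral) simp
  finally show ?thesis unfolding u(2) T.cval_coset[OF u(1)] T.V_def .
qed

text \<open>Triangularity with nonzero diagonal solves for rational coefficients of the b_i.
  Together with \<open>QB_inj\<close> and \<open>QB_support\<close> the algebra is identified with
  the vectors supported on 1, ..., 22.\<close>

lemma QB_surj:
  assumes "\<And>j. j \<notin> {1..22} \<Longrightarrow> v j = 0"
  shows "\<exists>x\<in>C. T.cval x = v"
proof -
  obtain q where q: "\<forall>j. v j = (\<Sum>i\<in>{1..22}. q i * M' i j)"
    using M'_spanning[of 22 v] assms by blast
  have k: "Poly_Mapping.keys (t_comb q) \<subseteq> UNIV \<times> carrier BR"
    unfolding t_comb_def by (rule keys_sum_subset) (simp add: keys_frag_of b_el(1))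
  have "T.cval (T.coset (t_comb q)) = v"
    unfolding T.cval_coset[OF k] T.V_def[abs_def] t_comb_value using q by (simp add: fun_eq_iff)
  then show ?thesis using T.coset_in[OF k] unfolding QB_simps by blast
qed

definition Psi :: "_ \<Rightarrow> rat mat" where
  "Psi x = beta_matrix (T.cval x)"

lemma Psi_inj: "x \<in> C \<Longrightarrow> y \<in> C \<Longrightarrow> Psi x = Psi y \<Longrightarrow> x = y"
proof -
  assume xy: "x \<in> C" "y \<in> C" "Psi x = Psi y"
  have "T.cval x j = T.cval y j" for j
  proof (cases "j \<in> {1..22}")
    case True
    with xy(3) show ?thesis unfolding Psi_def by (rule beta_matrix_inject)
  next
    case False
    show ?thesis unfolding QB_support[OF xy(1) False] QB_support[OF xy(2) False] ..
  qed
  then show "x = y" using xy(1,2) by (intro QB_inj ext)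
qed

lemma Psi_carrier: "Psi x \<in> carrier_mat 8 8"
  unfolding Psi_def by (rule beta_matrix_carrier)

lemma Psi_add: "x \<in> C \<Longrightarrow> y \<in> C \<Longrightarrow> Psi (x \<oplus>\<^bsub>QB S3\<^esub> y) = Psi x + Psi y"
  unfolding Psi_def by (simp only: QB_add(2) beta_matrix_add)

lemma Psi_smult: "x \<in> C \<Longrightarrow> Psi (r \<odot>\<^bsub>QB S3\<^esub> x) = r \<cdot>\<^sub>m Psi x"
  unfolding Psi_def by (simp only: QB_smult(2) beta_matrix_smult)

lemma Psi_mult: "x \<in> C \<Longrightarrow> y \<in> C \<Longrightarrow> Psi (x \<otimes>\<^bsub>QB S3\<^esub> y) = Psi x * Psi y"
  unfolding Psi_def by (simp only: QB_mult(2) beta_matrix_mult)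

lemma Psi_one: "Psi \<one>\<^bsub>QB S3\<^esub> = 1\<^sub>m 8"
  unfolding Psi_def by (rule QB_one(2))

section \<open>Algebra axioms for the rational double Burnside ring\<close>

lemma abelian_group_QB: "abelian_group (QB S3)"
proof (rule abelian_groupI)
  show "x \<oplus>\<^bsub>QB S3\<^esub> y \<oplus>\<^bsub>QB S3\<^esub> z = x \<oplus>\<^bsub>QB S3\<^esub> (y \<oplus>\<^bsub>QB S3\<^esub> z)"
    if "x \<in> C" "y \<in> C" "z \<in> C" for x y z
    by (rule QB_inj) (simp_all add: QB_add that add.assoc)
  show "x \<oplus>\<^bsub>QB S3\<^esub> y = y \<oplus>\<^bsub>QB S3\<^esub> x" if "x \<in> C" "y \<in> C" for x y
    by (rule QB_inj) (simp_all add: QB_add that add.commute)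
  show "\<zero>\<^bsub>QB S3\<^esub> \<oplus>\<^bsub>QB S3\<^esub> x = x" if "x \<in> C" for x
    by (rule QB_inj) (simp_all add: QB_add QB_zero that)
  fix x assume x: "x \<in> C"
  show "\<exists>y\<in>C. y \<oplus>\<^bsub>QB S3\<^esub> x = \<zero>\<^bsub>QB S3\<^esub>"
  proof (rule bexI[of _ "(-1) \<odot>\<^bsub>QB S3\<^esub> x"])
    show "(-1) \<odot>\<^bsub>QB S3\<^esub> x \<oplus>\<^bsub>QB S3\<^esub> x = \<zero>\<^bsub>QB S3\<^esub>"
      by (rule QB_inj) (simp_all add: QB_add QB_smult QB_zero x)
  qed (rule QB_smult(1)[OF x])
qed (simp_all only: QB_add(1) QB_zero(1))

lemma ring_QB: "ring (QB S3)"
proof (rule ringI)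
  show "abelian_group (QB S3)" by (rule abelian_group_QB)
  show "Group.monoid (QB S3)"
  proof (rule monoidI)
    show "x \<otimes>\<^bsub>QB S3\<^esub> y \<otimes>\<^bsub>QB S3\<^esub> z = x \<otimes>\<^bsub>QB S3\<^esub> (y \<otimes>\<^bsub>QB S3\<^esub> z)" if "x \<in> C" "y \<in> C" "z \<in> C" for x y z
      using that assoc_mult_mat[OF Psi_carrier Psi_carrier Psi_carrier]
      by (intro Psi_inj) (simp_all add: QB_mult(1) Psi_mult)
    show "\<one>\<^bsub>QB S3\<^esub> \<otimes>\<^bsub>QB S3\<^esub> x = x" if "x \<in> C" for x
      using that left_mult_one_mat[OF Psi_carrier[of x]] by (intro Psi_inj) (simp_all add: QB_mult(1) QB_one(1) Psi_mult Psi_one)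
    show "x \<otimes>\<^bsub>QB S3\<^esub> \<one>\<^bsub>QB S3\<^esub> = x" if "x \<in> C" for x
      using that right_mult_one_mat[OF Psi_carrier[of x]] by (intro Psi_inj) (simp_all add: QB_mult(1) QB_one(1) Psi_mult Psi_one)
  qed (auto simp: QB_mult(1) QB_one(1))
  show "(x \<oplus>\<^bsub>QB S3\<^esub> y) \<otimes>\<^bsub>QB S3\<^esub> z = x \<otimes>\<^bsub>QB S3\<^esub> z \<oplus>\<^bsub>QB S3\<^esub> y \<otimes>\<^bsub>QB S3\<^esub> z"
    if "x \<in> C" "y \<in> C" "z \<in> C" for x y z
    using that add_mult_distrib_mat[OF Psi_carrier Psi_carrier Psi_carrier, of x y z]
    by (intro Psi_inj) (simp_all add: QB_mult(1) QB_add(1) Psi_mult Psi_add)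
  show "z \<otimes>\<^bsub>QB S3\<^esub> (x \<oplus>\<^bsub>QB S3\<^esub> y) = z \<otimes>\<^bsub>QB S3\<^esub> x \<oplus>\<^bsub>QB S3\<^esub> z \<otimes>\<^bsub>QB S3\<^esub> y"
    if "x \<in> C" "y \<in> C" "z \<in> C" for x y z
    using that mult_add_distrib_mat[OF Psi_carrier Psi_carrier Psi_carrier, of z x y]
    by (intro Psi_inj) (simp_all add: QB_mult(1) QB_add(1) Psi_mult Psi_add)
qed

lemma module_QB: "module rat_ring (QB S3)"
proof (rule moduleI)
  fix a b x y assume x: "x \<in> C" and y: "y \<in> C"
  show "(a \<oplus>\<^bsub>rat_ring\<^esub> b) \<odot>\<^bsub>QB S3\<^esub> x = a \<odot>\<^bsub>QB S3\<^esub> x \<oplus>\<^bsub>QB S3\<^esub> b \<odot>\<^bsub>QB S3\<^esub> x"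
    by (rule QB_inj) (simp_all add: rat_ring_simps QB_add QB_smult x algebra_simps)
  show "a \<odot>\<^bsub>QB S3\<^esub> (x \<oplus>\<^bsub>QB S3\<^esub> y) = a \<odot>\<^bsub>QB S3\<^esub> x \<oplus>\<^bsub>QB S3\<^esub> a \<odot>\<^bsub>QB S3\<^esub> y"
    by (rule QB_inj) (simp_all add: QB_add QB_smult x y algebra_simps)
  show "(a \<otimes>\<^bsub>rat_ring\<^esub> b) \<odot>\<^bsub>QB S3\<^esub> x = a \<odot>\<^bsub>QB S3\<^esub> (b \<odot>\<^bsub>QB S3\<^esub> x)"
    by (rule QB_inj) (simp_all add: rat_ring_simps QB_smult x mult.assoc)
next
  fix x assume x: "x \<in> C"
  show "\<one>\<^bsub>rat_ring\<^esub> \<odot>\<^bsub>QB S3\<^esub> x = x"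
    by (rule QB_inj) (simp_all add: rat_ring_simps QB_smult x)
qed (simp_all only: cring_from_type_algebra abelian_group_QB QB_smult(1))

lemma assoc_algebra_QB: "assoc_algebra rat_ring (QB S3)"
proof (intro assoc_algebra.intro assoc_algebra_axioms.intro module_QB ring_QB)
  fix a x y assume "x \<in> C" "y \<in> C"
  then show "(a \<odot>\<^bsub>QB S3\<^esub> x) \<otimes>\<^bsub>QB S3\<^esub> y = a \<odot>\<^bsub>QB S3\<^esub> (x \<otimes>\<^bsub>QB S3\<^esub> y)"
    using mult_smult_assoc_mat[OF Psi_carrier Psi_carrier, of a x y]
    by (intro Psi_inj) (simp_all add: QB_mult(1) QB_smult(1) Psi_mult Psi_smult)
  from \<open>x \<in> C\<close> \<open>y \<in> C\<close> show "x \<otimes>\<^bsub>QB S3\<^esub> (a \<odot>\<^bsub>QB S3\<^esub> y) = a \<odot>\<^bsub>QB S3\<^esub> (x \<otimes>\<^bsub>QB S3\<^esub> y)"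
    using mult_smult_distrib[OF Psi_carrier Psi_carrier, of x a y]
    by (intro Psi_inj) (simp_all add: QB_mult(1) QB_smult(1) Psi_mult Psi_smult)
qed

lemma QB_finsum:
  assumes "finite I" "f \<in> I \<rightarrow> C"
  shows "finsum (QB S3) f I \<in> C \<and> T.cval (finsum (QB S3) f I) = (\<lambda>j. \<Sum>i\<in>I. T.cval (f i) j)"
proof -
  interpret abelian_group "QB S3" by (rule abelian_group_QB)
  show ?thesis
    using assms
  proof (induction I rule: finite_induct)
    case empty
    then show ?case by (simp add: QB_zero)
  next
    case (insert i I)
    then have f: "f i \<in> C" "f \<in> I \<rightarrow> C" by auto
    have "finsum (QB S3) f (insert i I) = f i \<oplus>\<^bsub>QB S3\<^esub> finsum (QB S3) f I"
      using insert.hyps f(2,1) by (rule finsum_insert)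
    then show ?case using insert.IH[OF f(2)] insert.hyps f(1) by (simp add: QB_add)
  qed
qed

lemma QB_comb:
  fixes c :: "nat \<Rightarrow> (rat \<times> (S3_class \<Rightarrow>\<^sub>0 int) set \<Rightarrow>\<^sub>0 int) set"
  assumes "\<And>i. i \<in> {1..22} \<Longrightarrow> c i \<in> C"
  shows "(\<Oplus>\<^bsub>QB S3\<^esub>i\<in>{1..22}. x i \<odot>\<^bsub>QB S3\<^esub> c i) \<in> C"
    and "T.cval (\<Oplus>\<^bsub>QB S3\<^esub>i\<in>{1..22}. x i \<odot>\<^bsub>QB S3\<^esub> c i) = (\<lambda>j. \<Sum>i\<in>{1..22}. x i * T.cval (c i) j)"
proof -
  have "(\<lambda>i. x i \<odot>\<^bsub>QB S3\<^esub> c i) \<in> {1..22} \<rightarrow> C" using QB_smult(1)[OF assms] by blast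
  note f = QB_finsum[OF finite_atLeastAtMost this]
  show "(\<Oplus>\<^bsub>QB S3\<^esub>i\<in>{1..22}. x i \<odot>\<^bsub>QB S3\<^esub> c i) \<in> C" using f by (rule conjunct1)
  show "T.cval (\<Oplus>\<^bsub>QB S3\<^esub>i\<in>{1..22}. x i \<odot>\<^bsub>QB S3\<^esub> c i) = (\<lambda>j. \<Sum>i\<in>{1..22}. x i * T.cval (c i) j)"
    unfolding conjunct2[OF f] by (intro ext sum.cong refl) (simp only: QB_smult(2)[OF assms])
qed

lemma S3_b: "i \<in> {1..22} \<Longrightarrow> S3_b L i \<in> C" "i \<in> {1..22} \<Longrightarrow> T.cval (S3_b L i) = M' i"
  unfolding S3_b_def using QB_of[OF finite_biset_b] biset_vec_representatives[OF rep] by simp_all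

definition unit_vec :: "nat \<Rightarrow> nat \<Rightarrow> rat" where
  "unit_vec i j = (if j = i then 1 else 0)"

lemma unit_comb: "(\<Sum>i\<in>{1..22}. x i * unit_vec i j) = (if j \<in> {1..22} then x j else 0)"
  by (simp add: unit_vec_def if_distrib[of "\<lambda>z. _ * z"] cong: if_cong)

text \<open>Coordinates are taken with respect to the c_j from the start, so the defining system
  must single out unit vectors. In each coordinate, the difference between a solution and the unit
  vectors solves the homogeneous triangular system.\<close>

lemma is_c_iff:
  "c \<in> {1..22} \<rightarrow>\<^sub>E C \<and> (\<forall>i\<in>{1..22}. S3_b L i = (\<Oplus>\<^bsub>QB S3\<^esub>j\<in>{1..22}. M' i j \<odot>\<^bsub>QB S3\<^esub> c j))
    \<longleftrightarrow> c \<in> {1..22} \<rightarrow>\<^sub>E C \<and> (\<forall>i\<in>{1..22}. T.cval (c i) = unit_vec i)"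
proof (cases "c \<in> {1..22} \<rightarrow>\<^sub>E C")
  case True
  then have c: "c i \<in> C" if "i \<in> {1..22}" for i using that by (rule PiE_mem)
  have b: "S3_b L i = (\<Oplus>\<^bsub>QB S3\<^esub>j\<in>{1..22}. M' i j \<odot>\<^bsub>QB S3\<^esub> c j)
      \<longleftrightarrow> M' i = (\<lambda>k. \<Sum>j\<in>{1..22}. M' i j * T.cval (c j) k)" if "i \<in> {1..22}" for i
  proof -
    have s: "(\<Oplus>\<^bsub>QB S3\<^esub>j\<in>{1..22}. M' i j \<odot>\<^bsub>QB S3\<^esub> c j) \<in> C" by (rule QB_comb(1)[OF c])
    have v: "T.cval (\<Oplus>\<^bsub>QB S3\<^esub>j\<in>{1..22}. M' i j \<odot>\<^bsub>QB S3\<^esub> c j)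
        = (\<lambda>k. \<Sum>j\<in>{1..22}. M' i j * T.cval (c j) k)"
      by (rule QB_comb(2)[OF c])
    show ?thesis
    proof
      assume "S3_b L i = (\<Oplus>\<^bsub>QB S3\<^esub>j\<in>{1..22}. M' i j \<odot>\<^bsub>QB S3\<^esub> c j)"
      from arg_cong[OF this, of T.cval]
      show "M' i = (\<lambda>k. \<Sum>j\<in>{1..22}. M' i j * T.cval (c j) k)" unfolding S3_b(2)[OF that] v .
    next
      assume m: "M' i = (\<lambda>k. \<Sum>j\<in>{1..22}. M' i j * T.cval (c j) k)"
      show "S3_b L i = (\<Oplus>\<^bsub>QB S3\<^esub>j\<in>{1..22}. M' i j \<odot>\<^bsub>QB S3\<^esub> c j)"
        by (rule QB_inj[OF S3_b(1)[OF that] s]) (unfold S3_b(2)[OF that] v, rule m)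
    qed
  qed
  have "(\<forall>i\<in>{1..22}. M' i = (\<lambda>k. \<Sum>j\<in>{1..22}. M' i j * T.cval (c j) k)) \<longleftrightarrow> (\<forall>i\<in>{1..22}. T.cval (c i) = unit_vec i)"
  proof (intro iffI ballI)
    fix i :: nat assume h: "\<forall>i\<in>{1..22}. M' i = (\<lambda>k. \<Sum>j\<in>{1..22}. M' i j * T.cval (c j) k)" and i: "i \<in> {1..22}"
    have "T.cval (c i) k - unit_vec i k = 0" for k
    proof (rule M'_row_independent[OF _ i, where d = "\<lambda>j. T.cval (c j) k - unit_vec j k"])
      fix m :: nat assume m: "m \<in> {1..22}"
      have "M' m k = (\<Sum>j\<in>{1..22}. M' m j * T.cval (c j) k)"
        using fun_cong[OF h[rule_format, OF m]] .
      moreover have "(\<Sum>j\<in>{1..22}. M' m j * unit_vec j k) = M' m k"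
        unfolding unit_comb using M'_outside[OF m] by simp
      ultimately show "(\<Sum>j\<in>{1..22}. M' m j * (T.cval (c j) k - unit_vec j k)) = 0"
        by (simp only: right_diff_distrib sum_subtractf)
    qed
    then show "T.cval (c i) = unit_vec i" by (simp add: fun_eq_iff)
  next
    fix i :: nat assume h: "\<forall>i\<in>{1..22}. T.cval (c i) = unit_vec i" and i: "i \<in> {1..22}"
    have "(\<Sum>j\<in>{1..22}. M' i j * T.cval (c j) k) = M' i k" for k
    proof -
      have "(\<Sum>j\<in>{1..22}. M' i j * T.cval (c j) k) = (\<Sum>j\<in>{1..22}. M' i j * unit_vec j k)"
        by (rule sum.cong) (simp_all add: h)
      then show ?thesis unfolding unit_comb using M'_outside[OF i] by simp
    qed
    then show "M' i = (\<lambda>k. \<Sum>j\<in>{1..22}. M' i j * T.cval (c j) k)" by (simp only:)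
  qed
  then show ?thesis using b by simp
qed simp

text \<open>The definite description is justified here: \<open>QB_surj\<close> provides elements
  with unit coordinates, and \<open>QB_inj\<close> makes them unique.\<close>

lemma S3_c:
  assumes "i \<in> {1..22}"
  shows "S3_c L i \<in> C" "T.cval (S3_c L i) = unit_vec i"
proof -
  have "\<exists>x\<in>C. T.cval x = unit_vec i" if "i \<in> {1..22}" for i
    by (rule QB_surj) (use that in \<open>auto simp: unit_vec_def\<close>)
  then have "\<forall>i\<in>{1..22}. \<exists>x. x \<in> C \<and> T.cval x = unit_vec i" by blast
  from bchoice[OF this] obtain e where e': "\<forall>i\<in>{1..22}. e i \<in> C \<and> T.cval (e i) = unit_vec i" ..
  then have e: "e i \<in> C" "T.cval (e i) = unit_vec i" if "i \<in> {1..22}" for i using that by simp_all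
  have "\<exists>!c. c \<in> {1..22} \<rightarrow>\<^sub>E C \<and> (\<forall>i\<in>{1..22}. T.cval (c i) = unit_vec i)"
  proof (rule ex1I[of _ "restrict e {1..22}"])
    show "restrict e {1..22} \<in> {1..22} \<rightarrow>\<^sub>E C \<and> (\<forall>i\<in>{1..22}. T.cval (restrict e {1..22} i) = unit_vec i)"
      using e by simp
    fix c assume c: "c \<in> {1..22} \<rightarrow>\<^sub>E C \<and> (\<forall>i\<in>{1..22}. T.cval (c i) = unit_vec i)"
    show "c = restrict e {1..22}"
    proof
      fix i
      show "c i = restrict e {1..22} i"
      proof (cases "i \<in> {1..22}")
        case True
        then have "c i \<in> C" "T.cval (c i) = T.cval (e i)" using c e(2) by auto
        then show ?thesis using QB_inj[OF _ e(1)[OF True]] True by simp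
      next
        case False
        \<comment> \<open>Outside the index range both families take the default value of
          extensional functions, without which the family would not be unique.\<close>
        have "c i = undefined" using conjunct1[OF c] False by (rule PiE_arb)
        then show ?thesis unfolding restrict_def if_not_P[OF False] .
      qed
    qed
  qed
  then have "S3_c L \<in> {1..22} \<rightarrow>\<^sub>E C \<and> (\<forall>i\<in>{1..22}. T.cval (S3_c L i) = unit_vec i)"
    unfolding S3_c_def is_c_iff by (rule theI')
  then show "S3_c L i \<in> C" "T.cval (S3_c L i) = unit_vec i"
    using assms by auto
qed

lemma S3_c_comb:
  "(\<Oplus>\<^bsub>QB S3\<^esub>i\<in>{1..22}. x i \<odot>\<^bsub>QB S3\<^esub> S3_c L i) \<in> C"
  "T.cval (\<Oplus>\<^bsub>QB S3\<^esub>i\<in>{1..22}. x i \<odot>\<^bsub>QB S3\<^esub> S3_c L i) j = (if j \<in> {1..22} then x j else 0)"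
proof -
  show "(\<Oplus>\<^bsub>QB S3\<^esub>i\<in>{1..22}. x i \<odot>\<^bsub>QB S3\<^esub> S3_c L i) \<in> C" by (rule QB_comb(1)[OF S3_c(1)])
  have "(\<Sum>i\<in>{1..22}. x i * T.cval (S3_c L i) j) = (\<Sum>i\<in>{1..22}. x i * unit_vec i j)"
    by (rule sum.cong[OF refl]) (simp only: S3_c(2))
  moreover have "T.cval (\<Oplus>\<^bsub>QB S3\<^esub>i\<in>{1..22}. x i \<odot>\<^bsub>QB S3\<^esub> S3_c L i)
      = (\<lambda>j. \<Sum>i\<in>{1..22}. x i * T.cval (S3_c L i) j)"
    by (rule QB_comb(2)[OF S3_c(1)])
  ultimately show "T.cval (\<Oplus>\<^bsub>QB S3\<^esub>i\<in>{1..22}. x i \<odot>\<^bsub>QB S3\<^esub> S3_c L i) j = (if j \<in> {1..22} then x j else 0)"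
    unfolding unit_comb by (simp only:)
qed

lemma linear_map_Psi: "linear_map rat_ring (QB S3) mat8 (restrict Psi C)"
  unfolding linear_map_def module_mat_simps rat_ring_simps
  by (auto simp: Psi_carrier QB_add(1) QB_smult(1) Psi_add Psi_smult)

text \<open>Since the c_i span the algebra, the prescribed values determine the map on the carrier,
  and extensionality fixes it elsewhere. Existence and all claimed properties thereby reduce to
  those of \<open>Psi\<close>.\<close>

lemma is_beta'_iff: "is_beta' L \<beta> \<longleftrightarrow> \<beta> = restrict Psi C"
proof
  assume \<beta>: "is_beta' L \<beta>"
  show "\<beta> = restrict Psi C"
  proof
    fix z
    show "\<beta> z = restrict Psi C z"
    proof (cases "z \<in> C")
      case True
      \<comment> \<open>The coefficients of the expansion in the c_i are the coordinates of z
        themselves, because each c_i has a unit vector as its coordinates.\<close>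
      have "z = (\<Oplus>\<^bsub>QB S3\<^esub>i\<in>{1..22}. T.cval z i \<odot>\<^bsub>QB S3\<^esub> S3_c L i)"
        (is "_ = ?s")
        using True S3_c_comb(1)
      proof (rule QB_inj)
        show "T.cval z = T.cval ?s"
        proof
          fix j
          show "T.cval z j = T.cval ?s j"
          proof (cases "j \<in> {1..22}")
            case True
            show ?thesis unfolding S3_c_comb(2) if_P[OF True] ..
          next
            case False
            show ?thesis unfolding S3_c_comb(2) if_not_P[OF False] by (rule QB_support[OF True False])
          qed
        qed
      qed
      then have "\<beta> z = \<beta> ?s" by (rule arg_cong)
      also have "\<dots> = beta_matrix (T.cval z)"
        using spec[OF conjunct2[OF conjunct2[OF \<beta>[unfolded is_beta'_def]]], of "T.cval z"] .
      finally have "\<beta> z = beta_matrix (T.cval z)" .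
      then show ?thesis using True by (simp add: Psi_def)
    next
      case False
      then show ?thesis using \<beta> unfolding is_beta'_def extensional_def by simp
    qed
  qed
next
  assume \<beta>: "\<beta> = restrict Psi C"
  have "restrict Psi C (\<Oplus>\<^bsub>QB S3\<^esub>i\<in>{1..22}. x i \<odot>\<^bsub>QB S3\<^esub> S3_c L i) = beta_matrix x" for x
  proof -
    have "restrict Psi C (\<Oplus>\<^bsub>QB S3\<^esub>i\<in>{1..22}. x i \<odot>\<^bsub>QB S3\<^esub> S3_c L i)
        = beta_matrix (T.cval (\<Oplus>\<^bsub>QB S3\<^esub>i\<in>{1..22}. x i \<odot>\<^bsub>QB S3\<^esub> S3_c L i))"
      using S3_c_comb(1) by (simp only: restrict_apply' Psi_def)
    also have "\<dots> = beta_matrix x"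
      by (rule beta_matrix_cong) (simp only: S3_c_comb(2) if_True)
    finally show ?thesis .
  qed
  then show "is_beta' L \<beta>"
    unfolding is_beta'_def \<beta> using linear_map_Psi by (intro conjI allI restrict_extensional)
qed

lemma algebra_hom_Psi: "algebra_hom rat_ring (QB S3) mat8 (restrict Psi C)"
proof -
  have "restrict Psi C \<in> Ring.ring_hom (QB S3) mat8"
    by (rule ring_hom_memI)
      (simp_all add: module_mat_simps Psi_carrier QB_mult(1) QB_add(1) QB_one(1) Psi_mult Psi_add Psi_one)
  then show ?thesis
    unfolding algebra_hom_def by (intro conjI assoc_algebra_QB assoc_algebra_mat linear_map_Psi)
qed

lemma inj_on_Psi: "inj_on (restrict Psi C) C"
proof (rule inj_onI)
  fix x y assume xy: "x \<in> C" "y \<in> C" "restrict Psi C x = restrict Psi C y"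
  have "Psi x = Psi y" using xy(3) unfolding restrict_def if_P[OF xy(1)] if_P[OF xy(2)] .
  with xy(1,2) show "x = y" by (rule Psi_inj)
qed

lemma beta'_properties:
  "(\<exists>!\<beta>. is_beta' L \<beta>) \<and>
    (\<forall>\<beta>. is_beta' L \<beta> \<longrightarrow> algebra_hom rat_ring (QB S3) mat8 \<beta> \<and> inj_on \<beta> C)"
  unfolding is_beta'_iff
proof (intro conjI allI impI)
  show "\<exists>!\<beta>. \<beta> = restrict Psi C" by (rule ex_ex1I) auto
  fix \<beta> assume \<beta>: "\<beta> = restrict Psi C"
  show "algebra_hom rat_ring (QB S3) mat8 \<beta>" "inj_on \<beta> C"
    unfolding \<beta> by (rule algebra_hom_Psi, rule inj_on_Psi)
qed

end

theorem theorem7p2: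
  fixes P :: "nat \<Rightarrow> (nat \<Rightarrow> nat) set"
    and L :: "nat \<Rightarrow> ((nat \<Rightarrow> nat) \<times> (nat \<Rightarrow> nat)) set"
  assumes "S3_representatives P L"
  shows "(\<exists>!\<beta>. is_beta' L \<beta>) \<and>
    (\<forall>\<beta>. is_beta' L \<beta> \<longrightarrow>
      algebra_hom rat_ring (QB S3) (module_mat TYPE(rat) 8 8) \<beta> \<and> inj_on \<beta> (carrier (QB S3)))"
proof -
  have "S3_basis P L" using assms by (rule S3_basis.intro)
  then show ?thesis by (rule S3_basis.beta'_properties)
qed

end
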